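(* Let $U\subset\mathbb{R}$ be a neighborhood of the origin and let $c:U\to\mathbb{R}$ satisfy $c(0)=1$ and $c(\theta)>0$ for all $\theta\in U$. Let $\varphi\in C_b^2(\mathbb{R})$ and $\psi\in C_b^1(\mathbb{R})$, and suppose that $\varphi_x(x)\to0$ and $\psi(x)\to0$ as $|x|\to\infty$. Suppose moreover that one of the following holds: (A) for some $p>2$, $c\in C^{\lceil p-2\rceil,\,p-\lceil p-1\rceil}(U)$, $c'(0)=\cdots=c^{(\lceil p-2\rceil)}(0)=0$, and there is a constant $C>0$ such that $C|\theta|^{p-2}\le c'(\theta)$ for all $\theta\in U$; (B) $c\in C^1(U)$ and $c'(0)>0$. Assume also that there exists a point $x_0\in\mathbb{R}$ such that at least one of the following two conditions is satisfied: (i) $\psi_x(x_0)+\varphi_{xx}(x_0)>0$; (ii) $\psi_x(x_0)-\varphi_{xx}(x_0)>0$. For $\varepsilon>0$ let $u$ be the classical solution of $$u_{tt}-c(u_x)^2u_{xx}=0,\qquad u(0,x)=\varepsilon\varphi(x),\quad u_t(0,x)=\varepsilon\psi(x),\qquad x\in\mathbb{R},$$ and let $T^*=T^*(\varepsilon)$ be its lifespan (defined in the context). Then there exist constants $\varepsilon_0>0$ and $C'>0$, with $C'$ independent of $\varepsilon$, such that for all $0<\varepsilon\le\varepsilon_0$: $$T^*(\varepsilon)\le C'\varepsilon^{-(p-1)}\ \text{ in case (A)},\qquad T^*(\varepsilon)\le C'\varepsilon^{-1}\ \text{ in case (B)},$$ and moreover $$\limsup_{t\to T^*}\bigl\{\|u_{tx}(t)\|_{L^\infty}+\|u_{xx}(t)\|_{L^\infty}\bigr\}=\infty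 .$$
   Context: $\lceil x\rceil$ is the least integer greater than or equal to $x$. $C^{m,\alpha}(U)$ is the class of $m$-times differentiable functions on $U$ whose $m$-th derivative is Hölder continuous with exponent $\alpha$ in $U$ (i.e. $|f^{(m)}(x)-f^{(m)}(y)|\le K|x-y|^\alpha$ on $U$ for some constant $K$). $C_b^m(\mathbb{R})$ is the set of $m$-times differentiable functions which, together with all their derivatives up to order $m$, are bounded and continuous on $\mathbb{R}$. Local-in-time existence and uniqueness of classical ($C^2$) solutions of the Cauchy problem is known for $\varphi\in C_b^2(\mathbb{R})$, $\psi\in C_b^1(\mathbb{R})$ (Courant–Lax, Hartman–Wintner, Douglis). The lifespan $T^*$ is the supremum of all $T>0$ such that the classical solution $u$ exists on $[0,T)\times\mathbb{R}$ with $$\sup_{t\in[0,T)}\bigl(\|u(t)\|_{L^\infty}+\|u_t(t)\|_{L^\infty}+\|u_x(t)\|_{L^\infty}+\|u_{tt}(t)\|_{L^\infty}+\|u_{tx}(t)\|_{L^\infty}+\|u_{xx}(t)\|_{L^\infty}\bigr)<\infty$$ and $\overline{u_x([0,T)\times\mathbb{R})}\subset U$. *)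

theory Defs
  imports "HOL-Analysis.Analysis" "HOL-Probability.Essential_Supremum"
begin

text \<open>Derivatives are taken relative to a set \<open>S\<close>, so that they are one-sided at a boundary point
  of \<open>S\<close>. In the interior of \<open>S\<close> they are the usual derivatives, see below.\<close>

definition deriv_on :: "real set \<Rightarrow> (real \<Rightarrow> real) \<Rightarrow> real \<Rightarrow> real" where
  "deriv_on S f x = vector_derivative f (at x within S)"

lemma deriv_on_interior:
  assumes "x \<in> interior S"
  shows "deriv_on S f x = deriv f x"
  unfolding deriv_on_def vector_derivative_def deriv_def at_within_interior[OF assms]
    has_real_derivative_iff_has_vector_derivative ..

lemma deriv_on_UNIV: "deriv_on UNIV f = deriv f"
  by (rule ext, rule deriv_on_interior) simp

definition times_differentiable_on :: "nat \<Rightarrow> real set \<Rightarrow> (real \<Rightarrow> real) \<Rightarrow> bool" where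
  "times_differentiable_on m S f \<longleftrightarrow>
     (\<forall>k<m. \<forall>x\<in>S. (deriv_on S ^^ k) f differentiable (at x within S))"

definition C_class :: "nat \<Rightarrow> real set \<Rightarrow> (real \<Rightarrow> real) set" where
  "C_class m S = {f. times_differentiable_on m S f \<and> continuous_on S ((deriv_on S ^^ m) f)}"

definition C_holder_class :: "nat \<Rightarrow> real \<Rightarrow> real set \<Rightarrow> (real \<Rightarrow> real) set" where
  "C_holder_class m \<alpha> S = {f. times_differentiable_on m S f \<and>
     (\<exists>K. \<forall>x\<in>S. \<forall>y\<in>S.
        \<bar>(deriv_on S ^^ m) f x - (deriv_on S ^^ m) f y\<bar> \<le> K * \<bar>x - y\<bar> powr \<alpha>)}"

definition C_bounded_class :: "nat \<Rightarrow> (real \<Rightarrow> real) set" where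
  "C_bounded_class m = {f. times_differentiable_on m UNIV f \<and>
     (\<forall>k\<le>m. continuous_on UNIV ((deriv_on UNIV ^^ k) f) \<and>
            bounded (range ((deriv_on UNIV ^^ k) f)))}"

definition Linf_norm :: "(real \<Rightarrow> real) \<Rightarrow> ereal" where
  "Linf_norm f = esssup lborel (\<lambda>x. ereal \<bar>f x\<bar>)"

text \<open>A function \<open>u\<close> is applied as \<open>u t x\<close>. Time derivatives are relative to \<open>t \<ge> 0\<close>, hence
  one-sided at \<open>t = 0\<close>; at a time \<open>t < T\<close> they depend only on \<open>u\<close> restricted to \<open>[0,T)\<close>.\<close>

definition dt :: "(real \<Rightarrow> real \<Rightarrow> real) \<Rightarrow> real \<Rightarrow> real \<Rightarrow> real" where
  "dt u t x = deriv_on {0..} (\<lambda>s. u s x) t"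

definition dx :: "(real \<Rightarrow> real \<Rightarrow> real) \<Rightarrow> real \<Rightarrow> real \<Rightarrow> real" where
  "dx u t x = deriv (u t) x"

definition C1_strip :: "real \<Rightarrow> (real \<Rightarrow> real \<Rightarrow> real) \<Rightarrow> bool" where
  "C1_strip T u \<longleftrightarrow>
     (\<forall>t\<in>{0..<T}. \<forall>x. (\<lambda>s. u s x) differentiable (at t within {0..}) \<and>
                        u t differentiable (at x)) \<and>
     continuous_on ({0..<T} \<times> UNIV) (\<lambda>(t, x). dt u t x) \<and>
     continuous_on ({0..<T} \<times> UNIV) (\<lambda>(t, x). dx u t x)"

definition C2_strip :: "real \<Rightarrow> (real \<Rightarrow> real \<Rightarrow> real) \<Rightarrow> bool" where
  "C2_strip T u \<longleftrightarrow> C1_strip T u \<and> C1_strip T (dt u) \<and> C1_strip T (dx u)"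

definition classical_solution ::
  "(real \<Rightarrow> real) \<Rightarrow> (real \<Rightarrow> real) \<Rightarrow> (real \<Rightarrow> real) \<Rightarrow> real \<Rightarrow> (real \<Rightarrow> real \<Rightarrow> real) \<Rightarrow> bool" where
  "classical_solution c f g T u \<longleftrightarrow>
     C2_strip T u \<and>
     (\<forall>t\<in>{0..<T}. \<forall>x. dt (dt u) t x - (c (dx u t x))\<^sup>2 * dx (dx u) t x = 0) \<and>
     (\<forall>x. u 0 x = f x) \<and> (\<forall>x. dt u 0 x = g x)"

text \<open>The closure condition keeps \<open>u\<^sub>x\<close> in the domain \<open>U\<close> of \<open>c\<close>; values of the HOL function
  \<open>c\<close> outside \<open>U\<close> are never used.\<close>

definition admissible_solution ::
  "real set \<Rightarrow> (real \<Rightarrow> real) \<Rightarrow> (real \<Rightarrow> real) \<Rightarrow> (real \<Rightarrow> real) \<Rightarrow> real \<Rightarrow>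
   (real \<Rightarrow> real \<Rightarrow> real) \<Rightarrow> bool" where
  "admissible_solution U c f g T u \<longleftrightarrow>
     classical_solution c f g T u \<and>
     (SUP t\<in>{0..<T}. Linf_norm (u t) + Linf_norm (dt u t) + Linf_norm (dx u t) +
        Linf_norm (dt (dt u) t) + Linf_norm (dx (dt u) t) + Linf_norm (dx (dx u) t)) < \<infinity> \<and>
     closure ((\<lambda>(t, x). dx u t x) ` ({0..<T} \<times> UNIV)) \<subseteq> U"

definition lifespan ::
  "real set \<Rightarrow> (real \<Rightarrow> real) \<Rightarrow> (real \<Rightarrow> real) \<Rightarrow> (real \<Rightarrow> real) \<Rightarrow> ereal" where
  "lifespan U c f g = Sup (ereal ` {T. 0 < T \<and> (\<exists>u. admissible_solution U c f g T u)})"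

text \<open>The classical solution on \<open>[0,T\<^sup>*)\<close>. Only its values at times in \<open>[0,T\<^sup>*)\<close> are constrained.\<close>

definition maximal_solution ::
  "real set \<Rightarrow> (real \<Rightarrow> real) \<Rightarrow> (real \<Rightarrow> real) \<Rightarrow> (real \<Rightarrow> real) \<Rightarrow>
   (real \<Rightarrow> real \<Rightarrow> real) \<Rightarrow> bool" where
  "maximal_solution U c f g u \<longleftrightarrow>
     (\<forall>T>0. ereal T < lifespan U c f g \<longrightarrow> admissible_solution U c f g T u)"

definition degenerate_speed :: "real set \<Rightarrow> (real \<Rightarrow> real) \<Rightarrow> real \<Rightarrow> bool" where
  "degenerate_speed U c p \<longleftrightarrow>
     p > 2 \<and>
     c \<in> C_holder_class (nat \<lceil>p - 2\<rceil>) (p - of_int \<lceil>p - 1\<rceil>) U \<and>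
     (\<forall>k\<in>{1..nat \<lceil>p - 2\<rceil>}. (deriv_on U ^^ k) c 0 = 0) \<and>
     (\<exists>C>0. \<forall>\<theta>\<in>U. C * \<bar>\<theta>\<bar> powr (p - 2) \<le> deriv_on U c \<theta>)"

definition nondegenerate_speed :: "real set \<Rightarrow> (real \<Rightarrow> real) \<Rightarrow> bool" where
  "nondegenerate_speed U c \<longleftrightarrow> c \<in> C_class 1 U \<and> deriv_on U c 0 > 0"

end

theory Submission
  imports Defs
begin

text \<open>Put \<open>v = u\<^sub>x\<close>, \<open>w = u\<^sub>t\<close>, \<open>G' = c\<close>, \<open>G 0 = 0\<close>. The Riemann invariants \<open>r = w + G v\<close> and \<open>s = w - G v\<close> are
  constant along \<open>dx/dt = - c\<close> and \<open>dx/dt = c\<close>, so \<open>v\<close> stays of size \<open>\<epsilon>\<close>, and \<open>Y = sqrt c * r\<^sub>x\<close> satisfies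
  the Riccati equation \<open>Y' = c' Y\<^sup>2 / (2 c\<^sup>3\<^sup>/\<^sup>2)\<close> along the first family. Choose a starting point with \<open>r\<^sub>x > 0\<close>
  and \<open>r \<noteq> 0\<close>. After a time independent of \<open>\<epsilon>\<close> the characteristic only meets values of \<open>s\<close> coming
  from the region where the data are small compared with \<open>r\<close>; there \<open>\<bar>v\<bar>\<close> is bounded below by a multiple of
  \<open>\<epsilon>\<close>, hence \<open>c'\<close> by a multiple of \<open>\<epsilon>\<^sup>p\<^sup>-\<^sup>2\<close>, and \<open>Y\<close> blows up in time \<open>O(\<epsilon>\<^sup>-\<^sup>(\<^sup>p\<^sup>-\<^sup>1\<^sup>))\<close>.

  Local existence holds on a time interval that depends only on bounds for the derivatives of \<open>v\<close> and \<open>w\<close>: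
  in the coordinates \<open>(a, b)\<close> given by the feet of the two characteristics through a point, \<open>r\<close> and \<open>s\<close> are
  known and \<open>(t, x)\<close> solves a linear system. If the second derivatives of \<open>u\<close> stayed bounded up to the
  lifespan, a solution started shortly before could be glued to \<open>u\<close> and would prolong it.\<close>

section \<open>Calculus in the plane\<close>

text \<open>Two obstacles shape the proof. The solution is only C^2, so \<open>r_x\<close> is merely
  continuous and the Riccati equation cannot be found by differentiating the transport equation for
  \<open>r\<close> in \<open>x\<close>. For the same reason an iteration for \<open>(v, w)\<close>
  in the variables \<open>(t, x)\<close> loses a derivative. In characteristic coordinates the
  quasilinear problem becomes linear, with coefficients that involve only first derivatives of the
  initial invariants, so that one contraction in the supremum norm suffices.

  The starting point needs \<open>r \<noteq> 0\<close> because \<open>c'\<close> may vanish at 0: a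
  positive slope alone does not make \<open>Y\<close> grow where \<open>v\<close> is close to 0, and
  \<open>2 * G v = r - s\<close>.

  The speed is controlled only near 0. All estimates are made for a speed on the whole line with
  values between 1/2 and 2 that agrees with \<open>c\<close> near 0, and small data keep
  \<open>v\<close> where the two agree. Condition (ii) is reduced to (i) by a reflection in
  space.\<close>

text \<open>Split the increment at the point \<open>(s, y)\<close>: the change of \<open>z\<close>
  at fixed \<open>s\<close> is governed by the continuous partial derivative \<open>f2\<close>, the
  change of \<open>s\<close> at fixed \<open>y\<close> by the single derivative \<open>a\<close>.
  Only one partial derivative has to be continuous, and \<open>S\<close> may be a half-open time
  interval.\<close>

lemma plane_has_derivative:
  fixes f f2 :: "real \<Rightarrow> real \<Rightarrow> real"
  assumes f1: "((\<lambda>s. f s y) has_real_derivative a) (at x within S)"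
    and f2: "\<And>s z. s \<in> S \<Longrightarrow> (f s has_real_derivative f2 s z) (at z)"
    and cont: "continuous_on (S \<times> UNIV) (\<lambda>(s, z). f2 s z)"
    and x: "x \<in> S"
  shows "((\<lambda>(s, z). f s z) has_derivative (\<lambda>(h, k). a * h + f2 x y * k)) (at (x, y) within S \<times> UNIV)"
proof -
  have "((\<lambda>(s, z). f s z) has_derivative
      (\<lambda>(h, k). a * h + blinfun_apply (blinfun_scaleR_left (f2 x y)) k)) (at (x, y) within S \<times> UNIV)"
  proof (rule has_derivative_partialsI[where fy="\<lambda>s z. blinfun_scaleR_left (f2 s z)"])
    show "((\<lambda>s. f s y) has_derivative (\<lambda>h. a * h)) (at x within S)"
      using f1 by (simp add: has_field_derivative_def)
    show "(f s has_derivative blinfun_apply (blinfun_scaleR_left (f2 s z))) (at z within UNIV)"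
      if "s \<in> S" for s z
      using f2[OF that, of z] by (simp add: has_field_derivative_def mult_commute_abs)
    have "continuous (at (x, y) within S \<times> UNIV) (\<lambda>(s, z). f2 s z)"
      using cont x by (simp add: continuous_on_eq_continuous_within)
    then show "continuous (at (x, y) within S \<times> UNIV) (\<lambda>(s, z). blinfun_scaleR_left (f2 s z))"
      unfolding continuous_within split_beta
      by (rule bounded_linear.tendsto[OF bounded_linear_blinfun_scaleR_left])
  qed auto
  then show ?thesis by (simp add: mult.commute)
qed

lemma chain_along_curve:
  fixes f f2 :: "real \<Rightarrow> real \<Rightarrow> real"
  assumes "((\<lambda>s. f s (X t)) has_real_derivative a) (at t within S)"
    and "\<And>s z. s \<in> S \<Longrightarrow> (f s has_real_derivative f2 s z) (at z)"
    and "continuous_on (S \<times> UNIV) (\<lambda>(s, z). f2 s z)"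
    and "t \<in> S" "(X has_real_derivative b) (at t within S)"
  shows "((\<lambda>s. f s (X s)) has_real_derivative a + f2 t (X t) * b) (at t within S)"
proof -
  have X: "((\<lambda>s. (s, X s)) has_derivative (\<lambda>h. (h, b * h))) (at t within S)"
    using assms(5) by (auto intro!: derivative_eq_intros simp: has_field_derivative_def)
  have F: "((\<lambda>(s, z). f s z) has_derivative (\<lambda>(h, k). a * h + f2 t (X t) * k)) (at (t, X t) within S \<times> UNIV)"
    by (rule plane_has_derivative[OF assms(1-4)])
  have F': "((\<lambda>(s, z). f s z) has_derivative (\<lambda>(h, k). a * h + f2 t (X t) * k))
      (at (t, X t) within (\<lambda>s. (s, X s)) ` S)"
    by (rule has_derivative_subset[OF F]) auto
  show ?thesis
    using has_derivative_in_compose[OF X F']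
    unfolding has_field_derivative_def
    by (auto elim!: has_derivative_eq_rhs simp: algebra_simps)
qed

lemma plane_continuous:
  fixes f f2 :: "real \<Rightarrow> real \<Rightarrow> real"
  assumes "\<And>s z. s \<in> S \<Longrightarrow> ((\<lambda>s. f s z) has_real_derivative f1 s z) (at s within S)"
    and "\<And>s z. s \<in> S \<Longrightarrow> (f s has_real_derivative f2 s z) (at z)"
    and "continuous_on (S \<times> UNIV) (\<lambda>(s, z). f2 s z)"
  shows "continuous_on (S \<times> UNIV) (\<lambda>(s, z). f s z)"
proof (rule has_derivative_continuous_on)
  fix p :: "real \<times> real"
  assume "p \<in> S \<times> UNIV"
  then show "((\<lambda>(s, z). f s z) has_derivative (\<lambda>(h, k). f1 (fst p) (snd p) * h + f2 (fst p) (snd p) * k))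
      (at p within S \<times> UNIV)"
    using plane_has_derivative[OF assms(1) assms(2,3), of "fst p" "snd p"] by auto
qed

lemma antiderivative_UNIV:
  fixes k :: "real \<Rightarrow> real"
  assumes "continuous_on UNIV k"
  obtains F where "F a = b" "\<And>x. (F has_real_derivative k x) (at x)"
proof -
  obtain F where F: "\<And>x. (F has_real_derivative k x) (at x)"
    using einterval_antiderivative[of "-\<infinity>" "\<infinity>" k] assms
    by (auto simp: continuous_on_eq_continuous_at has_real_derivative_iff_has_vector_derivative)
  show ?thesis
    by (rule that[of "\<lambda>x. F x - F a + b"]) (auto intro!: derivative_eq_intros F)
qed

text \<open>The oriented integral from \<open>a\<close> to \<open>b\<close>.\<close>

definition oint :: "real \<Rightarrow> real \<Rightarrow> (real \<Rightarrow> real) \<Rightarrow> real" where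
  "oint a b f = (b - a) * integral {0..1} (\<lambda>\<theta>. f (a + \<theta> * (b - a)))"

lemma oint_refl [simp]: "oint a a f = 0"
  by (simp add: oint_def)

lemma oint_segment:
  fixes a b \<theta> :: real
  assumes "0 \<le> \<theta>" "\<theta> \<le> 1"
  shows "a + \<theta> * (b - a) \<in> closed_segment a b"
  using assms unfolding in_segment by (intro exI[of _ \<theta>]) (auto simp: algebra_simps)

lemma oint_eq:
  assumes "\<And>x. x \<in> closed_segment a b \<Longrightarrow> (F has_real_derivative f x) (at x within closed_segment a b)"
  shows "oint a b f = F b - F a"
proof -
  have "((\<lambda>\<theta>. (b - a) * f (a + \<theta> * (b - a))) has_integral (F (a + 1 * (b - a)) - F (a + 0 * (b - a)))) {0..1}"
  proof (rule fundamental_theorem_of_calculus, simp)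
    fix \<theta> :: real assume \<theta>: "\<theta> \<in> {0..1}"
    have seg: "(\<lambda>\<theta>. a + \<theta> * (b - a)) ` {0..1} \<subseteq> closed_segment a b"
      using oint_segment by auto
    have "((\<lambda>\<theta>. a + \<theta> * (b - a)) has_real_derivative (b - a)) (at \<theta> within {0..1})"
      by (auto intro!: derivative_eq_intros)
    moreover have "(F has_real_derivative f (a + \<theta> * (b - a)))
        (at (a + \<theta> * (b - a)) within (\<lambda>\<theta>. a + \<theta> * (b - a)) ` {0..1})"
      using oint_segment[of \<theta> a b] \<theta> by (intro DERIV_subset[OF assms seg]) simp
    ultimately show "((\<lambda>\<theta>. F (a + \<theta> * (b - a))) has_vector_derivative (b - a) * f (a + \<theta> * (b - a)))
        (at \<theta> within {0..1})"
      using DERIV_image_chain[of F "f (a + \<theta> * (b - a))" "\<lambda>\<theta>. a + \<theta> * (b - a)" \<theta> "{0..1}" "b - a"]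
      by (simp add: has_real_derivative_iff_has_vector_derivative[symmetric] o_def mult.commute)
  qed
  from integral_unique[OF this] show ?thesis by (simp add: oint_def)
qed

lemma oint_has_derivative:
  assumes "continuous_on UNIV f"
  shows "((\<lambda>b. oint a b f) has_real_derivative f b) (at b)"
proof -
  obtain F where F: "\<And>x. (F has_real_derivative f x) (at x)"
    using antiderivative_UNIV[OF assms] by metis
  have "oint a b f = F b - F a" for b
    by (rule oint_eq) (rule has_field_derivative_at_within[OF F])
  then show "((\<lambda>b. oint a b f) has_real_derivative f b) (at b)"
    by (auto intro!: derivative_eq_intros F)
qed

lemma oint_split:
  assumes "continuous_on UNIV f"
  shows "oint a b f = oint c b f - oint c a f"
proof -
  obtain F where F: "\<And>x. (F has_real_derivative f x) (at x)"
    using antiderivative_UNIV[OF assms] by metis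
  have "oint a b f = F b - F a" for a b
    by (rule oint_eq) (rule has_field_derivative_at_within[OF F])
  then show ?thesis by simp
qed

lemma oint_bound:
  assumes "\<And>x. x \<in> closed_segment a b \<Longrightarrow> \<bar>f x\<bar> \<le> B" "continuous_on (closed_segment a b) f"
  shows "\<bar>oint a b f\<bar> \<le> \<bar>b - a\<bar> * B"
proof -
  note seg = oint_segment
  have "norm (integral {0..1} (\<lambda>\<theta>. f (a + \<theta> * (b - a)))) \<le> B * (1 - 0)"
    using seg assms(1)
    by (intro integral_bound)
      (auto intro!: continuous_intros continuous_on_compose2[OF assms(2)])
  then show ?thesis
    by (simp add: oint_def abs_mult mult_left_mono)
qed

lemma oint_diff:
  assumes "continuous_on UNIV f" "continuous_on UNIV g"
  shows "oint a b f - oint a b g = oint a b (\<lambda>x. f x - g x)"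
proof -
  have "(\<lambda>\<theta>. f (a + \<theta> * (b - a))) integrable_on {0..1}" "(\<lambda>\<theta>. g (a + \<theta> * (b - a))) integrable_on {0..1}"
    by (auto intro!: integrable_continuous_interval continuous_intros continuous_on_compose2[OF assms(1)]
      continuous_on_compose2[OF assms(2)])
  then show ?thesis
    by (simp add: oint_def integral_diff algebra_simps)
qed

text \<open>Rescaling to \<open>{0..1}\<close> moves the variable endpoints into the integrand, so
  the domain of integration no longer depends on the parameter.\<close>

lemma continuous_on_oint:
  fixes f :: "'a::topological_space \<Rightarrow> real \<Rightarrow> real"
  assumes "continuous_on (U \<times> UNIV) (\<lambda>(x, s). f x s)" "continuous_on U a" "continuous_on U b"
  shows "continuous_on U (\<lambda>x. oint (a x) (b x) (f x))"
proof -
  have "continuous_on (U \<times> cbox 0 1) (\<lambda>(x, \<theta>). f x (a x + \<theta> * (b x - a x)))"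
    unfolding split_beta
    by (rule continuous_on_compose2[OF assms(1), where f="\<lambda>z. (fst z, a (fst z) + snd z * (b (fst z) - a (fst z)))",
        unfolded split_beta fst_conv snd_conv])
      (auto intro!: continuous_intros continuous_on_compose2[OF assms(2)] continuous_on_compose2[OF assms(3)])
  from integral_continuous_on_param[OF this] show ?thesis
    unfolding oint_def by (auto intro!: continuous_intros assms)
qed

lemma oint_leibniz:
  fixes g g' :: "real \<Rightarrow> real \<Rightarrow> real"
  assumes g': "\<And>s x. s \<in> closed_segment a b \<Longrightarrow> (g s has_real_derivative g' s x) (at x)"
    and cont: "\<And>x. continuous_on (closed_segment a b) (\<lambda>s. g s x)"
    and cont': "continuous_on (closed_segment a b \<times> UNIV) (\<lambda>(s, x). g' s x)"
  shows "((\<lambda>x. oint a b (\<lambda>s. g s x)) has_real_derivative oint a b (\<lambda>s. g' s x)) (at x)"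
proof -
  note seg = oint_segment
  have "((\<lambda>x. integral (cbox 0 1) (\<lambda>\<theta>. g (a + \<theta> * (b - a)) x)) has_real_derivative
      integral (cbox 0 1) (\<lambda>\<theta>. g' (a + \<theta> * (b - a)) x)) (at x within UNIV)"
  proof (rule leibniz_rule_field_derivative)
    show "(g (a + \<theta> * (b - a)) has_real_derivative g' (a + \<theta> * (b - a)) x) (at x within UNIV)"
      if "\<theta> \<in> cbox 0 1" for \<theta> x using g' seg that by auto
    show "(\<lambda>\<theta>. g (a + \<theta> * (b - a)) x) integrable_on cbox 0 1" for x
      by (rule integrable_continuous)
        (auto intro!: continuous_intros continuous_on_compose2[OF cont] seg)
    show "continuous_on (UNIV \<times> cbox 0 1) (\<lambda>(x, \<theta>). g' (a + \<theta> * (b - a)) x)"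
      unfolding split_beta
      by (rule continuous_on_compose2[OF cont', where f="\<lambda>z. (a + snd z * (b - a), fst z)",
          unfolded split_beta fst_conv snd_conv])
        (auto intro!: continuous_intros seg)
  qed auto
  then show ?thesis
    unfolding oint_def by (auto intro!: derivative_eq_intros)
qed

section \<open>Ordinary differential equations\<close>

lemma oint_abs_le:
  assumes "\<And>x. x \<in> closed_segment a b \<Longrightarrow> \<bar>f x\<bar> \<le> g x"
    and "continuous_on UNIV f" "continuous_on UNIV g"
  shows "\<bar>oint a b f\<bar> \<le> \<bar>oint a b g\<bar>"
proof -
  have i: "(\<lambda>\<theta>. f (a + \<theta> * (b - a))) integrable_on {0..1}" "(\<lambda>\<theta>. g (a + \<theta> * (b - a))) integrable_on {0..1}"
    by (auto intro!: integrable_continuous_interval continuous_intros continuous_on_compose2[OF assms(2)]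
      continuous_on_compose2[OF assms(3)])
  have "\<bar>integral {0..1} (\<lambda>\<theta>. f (a + \<theta> * (b - a)))\<bar> \<le> integral {0..1} (\<lambda>\<theta>. g (a + \<theta> * (b - a)))"
    using integral_norm_bound_integral[OF i] assms(1) oint_segment by auto
  then show ?thesis
    unfolding oint_def abs_mult by (intro mult_left_mono) auto
qed

text \<open>The exponent carries twice the Lipschitz constant, so that integrating gains the factor
  1/2; this becomes the contraction constant of the Picard map.\<close>

lemma oint_exp_weight:
  fixes L :: real
  assumes "L > 0"
  shows "\<bar>oint 0 t (\<lambda>s. L * exp (2 * L * \<bar>s\<bar>) * D)\<bar> \<le> exp (2 * L * \<bar>t\<bar>) * \<bar>D\<bar> / 2"
proof (cases "t \<ge> 0")
  case True
  have "oint 0 t (\<lambda>s. L * exp (2 * L * \<bar>s\<bar>) * D) = exp (2 * L * t) * D / 2 - exp (2 * L * 0) * D / 2"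
    using True by (intro oint_eq) (auto intro!: derivative_eq_intros simp: closed_segment_eq_real_ivl)
  then have eq: "oint 0 t (\<lambda>s. L * exp (2 * L * \<bar>s\<bar>) * D) = (exp (2 * L * t) - 1) / 2 * D"
    by (simp add: field_simps)
  have "\<bar>oint 0 t (\<lambda>s. L * exp (2 * L * \<bar>s\<bar>) * D)\<bar> = (exp (2 * L * t) - 1) / 2 * \<bar>D\<bar>"
    unfolding eq using True assms by (simp add: abs_mult)
  also have "\<dots> \<le> exp (2 * L * t) / 2 * \<bar>D\<bar>"
    by (intro mult_right_mono) auto
  finally show ?thesis
    using True by simp
next
  case False
  have "oint 0 t (\<lambda>s. L * exp (2 * L * \<bar>s\<bar>) * D) = - exp (- 2 * L * t) * D / 2 - (- exp (- 2 * L * 0) * D / 2)"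
    using False by (intro oint_eq) (auto intro!: derivative_eq_intros simp: closed_segment_eq_real_ivl)
  then have eq: "oint 0 t (\<lambda>s. L * exp (2 * L * \<bar>s\<bar>) * D) = - ((exp (- 2 * L * t) - 1) / 2 * D)"
    by (simp add: field_simps)
  have "\<bar>oint 0 t (\<lambda>s. L * exp (2 * L * \<bar>s\<bar>) * D)\<bar> = (exp (- 2 * L * t) - 1) / 2 * \<bar>D\<bar>"
    unfolding eq using False assms by (simp add: abs_mult mult_nonneg_nonpos)
  also have "\<dots> \<le> exp (- 2 * L * t) / 2 * \<bar>D\<bar>"
    by (intro mult_right_mono) auto
  finally show ?thesis
    using False by simp
qed

text \<open>Picard iteration is a contraction for the norm weighted by \<open>exp (2 L |t|)\<close>, so one fixed
  point yields the solution on the whole line.\<close>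

lemma ode_solution_global:
  fixes V :: "real \<Rightarrow> real \<Rightarrow> real"
  assumes cont: "continuous_on UNIV (\<lambda>(t, x). V t x)"
    and lip: "\<And>t x y. \<bar>V t x - V t y\<bar> \<le> L * \<bar>x - y\<bar>"
    and bdd: "\<And>t x. \<bar>V t x\<bar> \<le> M"
  obtains X where "X t0 = x0" "\<And>t. (X has_real_derivative V t (X t)) (at t)"
proof -
  define l where "l = max 1 L"
  have l: "l > 0" "\<And>t x y. \<bar>V t x - V t y\<bar> \<le> l * \<bar>x - y\<bar>"
    using order_trans[OF lip mult_right_mono] by (auto simp: l_def)
  \<comment> \<open>The time shift centres the weight at the initial time.\<close>
  define V' where "V' t x = V (t + t0) x" for t x
  have V'c: "continuous_on A (\<lambda>s. V' (f s) (g s))" if "continuous_on A f" "continuous_on A g" for A :: "real set" and f g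
    unfolding V'_def
    by (rule continuous_on_compose2[OF cont, of A "\<lambda>s. (f s + t0, g s)", unfolded split_beta fst_conv snd_conv])
      (auto intro!: continuous_intros that)
  \<comment> \<open>The unknown is
    \<open>z t = exp (- (2 * l * \<bar>t\<bar>)) * (X t - x0)\<close>, written in shifted time. It
    is bounded, and the plain supremum norm of \<open>z\<close> is the weighted norm of
    \<open>X - x0\<close>.\<close>
  define F where "F z t = exp (- (2 * l * \<bar>t\<bar>)) * oint 0 t (\<lambda>s. V' s (x0 + exp (2 * l * \<bar>s\<bar>) * z s))"
    for z :: "real \<Rightarrow> real" and t
  have integrand: "continuous_on UNIV (\<lambda>s. V' s (x0 + exp (2 * l * \<bar>s\<bar>) * apply_bcontfun z s))" for z :: "real \<Rightarrow>\<^sub>C real"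
    by (auto intro!: V'c continuous_intros)
  have F: "F z \<in> bcontfun" for z :: "real \<Rightarrow>\<^sub>C real"
  proof (rule bcontfun_normI)
    have "continuous_on UNIV (\<lambda>t. oint 0 t (\<lambda>s. V' s (x0 + exp (2 * l * \<bar>s\<bar>) * z s)))"
      using oint_has_derivative[OF integrand] by (meson DERIV_isCont continuous_at_imp_continuous_on)
    then show "continuous_on UNIV (F z)"
      unfolding F_def by (auto intro!: continuous_intros)
    show "norm (F z t) \<le> \<bar>M\<bar> / (2 * l)" for t
    proof -
      have "\<bar>oint 0 t (\<lambda>s. V' s (x0 + exp (2 * l * \<bar>s\<bar>) * z s))\<bar> \<le> \<bar>t - 0\<bar> * \<bar>M\<bar>"
        using bdd by (intro oint_bound continuous_on_subset[OF integrand])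
          (auto simp: V'_def intro: order_trans[OF _ abs_ge_self])
      then have "norm (F z t) \<le> exp (- (2 * l * \<bar>t\<bar>)) * (\<bar>t\<bar> * \<bar>M\<bar>)"
        unfolding F_def real_norm_def abs_mult by (intro mult_mono) auto
      also have "\<dots> = ((2 * l * \<bar>t\<bar>) * exp (- (2 * l * \<bar>t\<bar>))) * (\<bar>M\<bar> / (2 * l))"
        using l(1) by simp
      also have "\<dots> \<le> 1 * (\<bar>M\<bar> / (2 * l))"
      proof (rule mult_right_mono)
        have "2 * l * \<bar>t\<bar> \<le> exp (2 * l * \<bar>t\<bar>)"
          using exp_ge_add_one_self[of "2 * l * \<bar>t\<bar>"] by linarith
        then show "(2 * l * \<bar>t\<bar>) * exp (- (2 * l * \<bar>t\<bar>)) \<le> 1"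
          by (simp add: exp_minus divide_simps)
      qed (use l in auto)
      finally show ?thesis by simp
    qed
  qed
  have Fz: "apply_bcontfun (Bcontfun (F z)) = F z" for z :: "real \<Rightarrow>\<^sub>C real"
    by (rule Bcontfun_inverse[OF F])
  have contraction: "dist (Bcontfun (F z1)) (Bcontfun (F z2)) \<le> 1 / 2 * dist z1 z2" for z1 z2 :: "real \<Rightarrow>\<^sub>C real"
  proof (rule dist_bound)
    fix t
    have "\<bar>oint 0 t (\<lambda>s. V' s (x0 + exp (2 * l * \<bar>s\<bar>) * z1 s)) - oint 0 t (\<lambda>s. V' s (x0 + exp (2 * l * \<bar>s\<bar>) * z2 s))\<bar>
      \<le> \<bar>oint 0 t (\<lambda>s. l * exp (2 * l * \<bar>s\<bar>) * dist z1 z2)\<bar>"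
      unfolding oint_diff[OF integrand integrand]
    proof (rule oint_abs_le)
      fix s
      have "\<bar>V' s (x0 + exp (2 * l * \<bar>s\<bar>) * z1 s) - V' s (x0 + exp (2 * l * \<bar>s\<bar>) * z2 s)\<bar>
        \<le> l * \<bar>exp (2 * l * \<bar>s\<bar>) * (z1 s - z2 s)\<bar>"
        unfolding V'_def by (rule order_trans[OF l(2)]) (simp add: algebra_simps)
      also have "\<dots> \<le> l * (exp (2 * l * \<bar>s\<bar>) * dist z1 z2)"
        using l(1) dist_bounded[of z1 s z2] by (auto simp: abs_mult dist_real_def intro!: mult_left_mono)
      finally show "\<bar>V' s (x0 + exp (2 * l * \<bar>s\<bar>) * z1 s) - V' s (x0 + exp (2 * l * \<bar>s\<bar>) * z2 s)\<bar>
        \<le> l * exp (2 * l * \<bar>s\<bar>) * dist z1 z2" by simp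
    qed (auto intro!: continuous_intros integrand)
    also have "\<dots> \<le> exp (2 * l * \<bar>t\<bar>) * dist z1 z2 / 2"
      using oint_exp_weight[OF l(1), of t "dist z1 z2"] by simp
    finally have "exp (- (2 * l * \<bar>t\<bar>)) * \<bar>oint 0 t (\<lambda>s. V' s (x0 + exp (2 * l * \<bar>s\<bar>) * z1 s)) - oint 0 t (\<lambda>s. V' s (x0 + exp (2 * l * \<bar>s\<bar>) * z2 s))\<bar>
      \<le> exp (- (2 * l * \<bar>t\<bar>)) * (exp (2 * l * \<bar>t\<bar>) * dist z1 z2 / 2)"
      by (intro mult_left_mono) auto
    also have "\<dots> = 1 / 2 * dist z1 z2"
      by (simp add: exp_minus)
    finally show "dist (apply_bcontfun (Bcontfun (F z1)) t) (apply_bcontfun (Bcontfun (F z2)) t) \<le> 1 / 2 * dist z1 z2"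
      unfolding Fz unfolding F_def dist_real_def right_diff_distrib[symmetric] abs_mult by simp
  qed
  obtain z :: "real \<Rightarrow>\<^sub>C real" where "Bcontfun (F z) = z"
    using banach_fix_type[of "1/2" "\<lambda>z. Bcontfun (F (apply_bcontfun z))"] contraction by auto
  then have z: "apply_bcontfun z t = F z t" for t
    using Fz by metis
  define X where "X t = x0 + exp (2 * l * \<bar>t - t0\<bar>) * z (t - t0)" for t
  have X: "X (t + t0) = x0 + oint 0 t (\<lambda>s. V' s (X (s + t0)))" for t
    unfolding X_def by (subst z) (simp add: F_def exp_minus)
  have d: "((\<lambda>t. X (t + t0)) has_real_derivative V' t (X (t + t0))) (at t)" for t
  proof -
    have "continuous_on UNIV (\<lambda>s. V' s (X (s + t0)))"
      unfolding X_def using integrand by simp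
    from oint_has_derivative[OF this] show ?thesis
      by (subst X) (auto intro!: derivative_eq_intros)
  qed
  show ?thesis
  proof (rule that[of X])
    show "X t0 = x0" using X[of 0] by simp
    show "(X has_real_derivative V t (X t)) (at t)" for t
      using d[of "t - t0"] DERIV_shift[of X "V t (X t)" "t - t0" t0]
      by (simp add: V'_def)
  qed
qed

section \<open>A priori estimates\<close>

text \<open>The first-order system for \<open>v = u\<^sub>x\<close> and \<open>w = u\<^sub>t\<close>, with \<open>v\<^sub>t = w\<^sub>x\<close> encoded by using \<open>wx\<close> twice.\<close>

definition psystem ::
  "(real \<Rightarrow> real) \<Rightarrow> real \<Rightarrow> (real \<Rightarrow> real \<Rightarrow> real) \<Rightarrow> (real \<Rightarrow> real \<Rightarrow> real) \<Rightarrow>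
   (real \<Rightarrow> real \<Rightarrow> real) \<Rightarrow> (real \<Rightarrow> real \<Rightarrow> real) \<Rightarrow> bool" where
  "psystem c T v w vx wx \<longleftrightarrow>
     (\<forall>t\<in>{0..<T}. \<forall>x.
        ((\<lambda>s. v s x) has_real_derivative wx t x) (at t within {0..<T}) \<and>
        ((\<lambda>s. w s x) has_real_derivative (c (v t x))\<^sup>2 * vx t x) (at t within {0..<T}) \<and>
        (v t has_real_derivative vx t x) (at x) \<and>
        (w t has_real_derivative wx t x) (at x)) \<and>
     continuous_on ({0..<T} \<times> UNIV) (\<lambda>(t, x). vx t x) \<and>
     continuous_on ({0..<T} \<times> UNIV) (\<lambda>(t, x). wx t x)"

text \<open>A speed on the whole line that stands in for the given one;
  \<open>speed_extension\<close> constructs it. The bounds 1/2 and 2 keep the characteristic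
  velocities away from 0 and make the antiderivative \<open>G\<close> a bi-Lipschitz bijection of
  the line.\<close>

locale speed =
  fixes c c' G :: "real \<Rightarrow> real" and K :: real
  assumes c_deriv: "(c has_real_derivative c' x) (at x)"
    and c'_cont: "continuous_on UNIV c'"
    and c_lower: "1 / 2 \<le> c x"
    and c_upper: "c x \<le> 2"
    and c'_bound: "\<bar>c' x\<bar> \<le> K"
    and G_deriv: "(G has_real_derivative c x) (at x)"
    and G_0: "G 0 = 0"
begin

lemma c_pos: "c x > 0"
  using c_lower[of x] by simp

lemma c_cont: "continuous_on A c"
  by (meson DERIV_isCont c_deriv continuous_at_imp_continuous_on)

lemma G_cont: "continuous_on A G"
  by (meson DERIV_isCont G_deriv continuous_at_imp_continuous_on)

lemma c_lipschitz: "\<bar>c x - c y\<bar> \<le> K * \<bar>x - y\<bar>"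
  using field_differentiable_bound[of UNIV c c' K x y] c_deriv c'_bound by simp

lemma G_mvt: obtains z where "G x - G y = c z * (x - y)"
proof (cases x y rule: linorder_cases)
  case less
  from MVT2[OF this, of G c] G_deriv obtain z where "G y - G x = (y - x) * c z" by auto
  then show ?thesis using that[of z] by (simp add: algebra_simps)
next
  case greater
  from MVT2[OF this, of G c] G_deriv obtain z where "G x - G y = (x - y) * c z" by auto
  then show ?thesis using that[of z] by (simp add: algebra_simps)
qed (use that in auto)

lemma G_abs_upper: "\<bar>G x\<bar> \<le> 2 * \<bar>x\<bar>"
proof -
  obtain z where "G x - G 0 = c z * (x - 0)" by (rule G_mvt)
  then show ?thesis
    using c_upper[of z] c_pos[of z] by (auto simp: G_0 abs_mult intro!: mult_right_mono)
qed

lemma G_abs_lower: "\<bar>x\<bar> \<le> 2 * \<bar>G x\<bar>"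
proof -
  obtain z where "G x - G 0 = c z * (x - 0)" by (rule G_mvt)
  then have "\<bar>G x\<bar> = c z * \<bar>x\<bar>"
    using c_pos[of z] by (simp add: G_0 abs_mult)
  then show ?thesis
    using mult_right_mono[OF c_lower[of z], of "\<bar>x\<bar>"] by simp
qed

end

text \<open>The bound \<open>N\<close> is qualitative. It makes the characteristic vector field
  Lipschitz and dominates a limit under an integral, but enters no conclusion, so the estimates are
  uniform over all solutions with bounded derivatives.\<close>

locale psys = speed +
  fixes T N :: real and v w vx wx :: "real \<Rightarrow> real \<Rightarrow> real"
  assumes sys: "psystem c T v w vx wx"
    and vx_bound: "0 \<le> t \<Longrightarrow> t < T \<Longrightarrow> \<bar>vx t x\<bar> \<le> N"
    and wx_bound: "0 \<le> t \<Longrightarrow> t < T \<Longrightarrow> \<bar>wx t x\<bar> \<le> N"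
begin

abbreviation "strip \<equiv> {0..<T} \<times> (UNIV :: real set)"

lemma derivs:
  assumes "t \<in> {0..<T}"
  shows v_t: "((\<lambda>s. v s x) has_real_derivative wx t x) (at t within {0..<T})"
    and w_t: "((\<lambda>s. w s x) has_real_derivative (c (v t x))\<^sup>2 * vx t x) (at t within {0..<T})"
    and v_x: "(v t has_real_derivative vx t x) (at x)"
    and w_x: "(w t has_real_derivative wx t x) (at x)"
  using sys assms unfolding psystem_def by blast+

lemma vx_cont: "continuous_on strip (\<lambda>(t, x). vx t x)"
  and wx_cont: "continuous_on strip (\<lambda>(t, x). wx t x)"
  using sys unfolding psystem_def by blast+

lemma v_cont: "continuous_on strip (\<lambda>(t, x). v t x)"
  by (rule plane_continuous[OF v_t v_x vx_cont])

lemma w_cont: "continuous_on strip (\<lambda>(t, x). w t x)"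
  by (rule plane_continuous[OF w_t w_x wx_cont])

lemma along:
  assumes "continuous_on strip (\<lambda>(t, x). f t x)" "continuous_on A X" "A \<subseteq> {0..<T}"
  shows "continuous_on A (\<lambda>t. f t (X t))"
  by (rule continuous_on_compose2[OF assms(1), of A "\<lambda>t. (t, X t)", unfolded split_beta fst_conv snd_conv])
    (use assms in \<open>auto intro!: continuous_intros\<close>)

text \<open>The sign \<open>\<sigma>\<close> treats both families at once: \<open>riem 1\<close> and
  \<open>riem (- 1)\<close> are the Riemann invariants \<open>r\<close> and
  \<open>s\<close>.\<close>

definition "riem \<sigma> t x = w t x + \<sigma> * G (v t x)"
definition "riemx \<sigma> t x = wx t x + \<sigma> * c (v t x) * vx t x"

lemma riem_x:
  assumes "t \<in> {0..<T}"
  shows "(riem \<sigma> t has_real_derivative riemx \<sigma> t x) (at x)"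
  unfolding riem_def[abs_def] riemx_def
  by (auto intro!: derivative_eq_intros w_x v_x assms DERIV_chain2[OF G_deriv])

lemma riem_t:
  assumes "t \<in> {0..<T}"
  shows "((\<lambda>s. riem \<sigma> s x) has_real_derivative (c (v t x))\<^sup>2 * vx t x + \<sigma> * c (v t x) * wx t x) (at t within {0..<T})"
  unfolding riem_def[abs_def]
  by (auto intro!: derivative_eq_intros w_t v_t assms DERIV_chain2[OF G_deriv])

lemma cv_cont: "continuous_on strip (\<lambda>(t, x). c (v t x))"
  using continuous_on_compose2[OF c_cont v_cont subset_UNIV] by (simp add: split_beta)

lemma c'v_cont: "continuous_on strip (\<lambda>(t, x). c' (v t x))"
  using continuous_on_compose2[OF c'_cont v_cont subset_UNIV] by (simp add: split_beta)

lemma riemx_cont: "continuous_on strip (\<lambda>(t, x). riemx \<sigma> t x)"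
  unfolding riemx_def split_beta
  using wx_cont cv_cont vx_cont unfolding split_beta by (auto intro!: continuous_intros)

lemma riem_along:
  assumes "t \<in> {0..<T}" "(X has_real_derivative b) (at t within {0..<T})"
  shows "((\<lambda>s. riem \<sigma> s (X s)) has_real_derivative
    (c (v t (X t)))\<^sup>2 * vx t (X t) + \<sigma> * c (v t (X t)) * wx t (X t) + riemx \<sigma> t (X t) * b) (at t within {0..<T})"
  by (rule chain_along_curve[OF riem_t riem_x riemx_cont]) (use assms in auto)

text \<open>The derivative is two-sided even at the ends of \<open>{0..T'}\<close>, because the
  curves come from an equation posed for all times.\<close>

definition "characteristic \<sigma> T' X \<longleftrightarrow>
  (\<forall>t\<in>{0..T'}. (X has_real_derivative - \<sigma> * c (v t (X t))) (at t))"

lemma characteristicD: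
  assumes "characteristic \<sigma> T' X" "t \<in> {0..T'}"
  shows "(X has_real_derivative - \<sigma> * c (v t (X t))) (at t within A)"
  using assms unfolding characteristic_def by (blast intro: has_field_derivative_at_within)

lemma characteristic_cont:
  assumes "characteristic \<sigma> T' X"
  shows "continuous_on {0..T'} X"
  by (rule has_real_derivative_imp_continuous_on[OF characteristicD[OF assms]])

lemma characteristic_exists:
  assumes \<sigma>: "\<sigma> * \<sigma> = 1" and T': "0 \<le> T'" "T' < T"
  obtains X where "X t0 = x0" "characteristic \<sigma> T' X"
proof -
  \<comment> \<open>Freezing the time outside \<open>{0..T'}\<close> gives a vector field on the
    whole plane that is globally Lipschitz and bounded. This needs \<open>T' < T\<close>, as the
    strip is open at \<open>T\<close>.\<close>
  define cl where "cl t = max 0 (min T' t)" for t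
  have cl: "cl t \<in> {0..<T}" "t \<in> {0..T'} \<Longrightarrow> cl t = t" for t
    using T' by (auto simp: cl_def)
  define V where "V t x = - \<sigma> * c (v (cl t) x)" for t x
  have abs\<sigma>: "\<bar>\<sigma>\<bar> = 1"
    using \<sigma> by (simp add: abs_square_eq_1[symmetric] power2_eq_square)
  have N: "N \<ge> 0"
    using vx_bound[of 0 0] T' by simp
  have K: "K \<ge> 0"
    using c'_bound[of 0] by simp
  have "continuous_on UNIV (\<lambda>p. c (v (cl (fst p)) (snd p)))"
    by (rule continuous_on_compose2[OF cv_cont, of UNIV "\<lambda>p. (cl (fst p), snd p)", unfolded split_beta fst_conv snd_conv])
      (use cl in \<open>auto simp: cl_def intro!: continuous_intros\<close>)
  then have 1: "continuous_on UNIV (\<lambda>(t, x). V t x)"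
    unfolding V_def split_beta by (intro continuous_intros)
  have 2: "\<bar>V t x - V t y\<bar> \<le> (K * N) * \<bar>x - y\<bar>" for t x y
  proof -
    have "\<bar>v (cl t) x - v (cl t) y\<bar> \<le> N * \<bar>x - y\<bar>"
      using field_differentiable_bound[of UNIV "v (cl t)" "vx (cl t)" N x y] v_x[OF cl(1)] vx_bound[of "cl t"] cl(1)[of t]
      by simp
    then have "K * \<bar>v (cl t) x - v (cl t) y\<bar> \<le> (K * N) * \<bar>x - y\<bar>"
      using mult_left_mono[OF _ K] by (fastforce simp: mult.assoc)
    moreover have "\<bar>V t x - V t y\<bar> = \<bar>\<sigma>\<bar> * \<bar>c (v (cl t) x) - c (v (cl t) y)\<bar>"
      unfolding V_def abs_mult[symmetric] by (subst abs_minus_commute) (simp add: algebra_simps)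
    then have "\<bar>V t x - V t y\<bar> = \<bar>c (v (cl t) x) - c (v (cl t) y)\<bar>"
      using abs\<sigma> by simp
    ultimately show ?thesis
      using c_lipschitz[of "v (cl t) x" "v (cl t) y"] by linarith
  qed
  have 3: "\<bar>V t x\<bar> \<le> 2" for t x
    using c_upper c_pos abs\<sigma> by (simp add: V_def abs_mult less_imp_le abs_of_pos)
  show ?thesis
  proof (rule ode_solution_global[OF 1 2 3])
    fix X assume X: "X t0 = x0" "\<And>t. (X has_real_derivative V t (X t)) (at t)"
    have "characteristic \<sigma> T' X"
      unfolding characteristic_def using X(2) cl(2) by (metis V_def)
    with X(1) show ?thesis by (rule that)
  qed
qed

text \<open>Since \<open>\<sigma> * \<sigma> = 1\<close>, the time derivative of
  \<open>riem \<sigma>\<close> at fixed \<open>x\<close> is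
  \<open>\<sigma> * c * riemx \<sigma>\<close>, which the velocity \<open>- \<sigma> * c\<close> of
  the curve cancels.\<close>

lemma riem_constant:
  assumes \<sigma>: "\<sigma> * \<sigma> = 1" and T': "T' < T" and X: "characteristic \<sigma> T' X" and t: "t \<in> {0..T'}"
  shows "riem \<sigma> t (X t) = riem \<sigma> 0 (X 0)"
proof -
  have "((\<lambda>s. riem \<sigma> s (X s)) has_real_derivative 0) (at s within {0..T'})" if s: "s \<in> {0..T'}" for s
  proof -
    have "((\<lambda>s. riem \<sigma> s (X s)) has_real_derivative
      (c (v s (X s)))\<^sup>2 * vx s (X s) + \<sigma> * c (v s (X s)) * wx s (X s) + riemx \<sigma> s (X s) * (- \<sigma> * c (v s (X s)))) (at s within {0..<T})"
      by (rule riem_along[OF _ characteristicD[OF X]]) (use s T' in auto)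
    also have "(c (v s (X s)))\<^sup>2 * vx s (X s) + \<sigma> * c (v s (X s)) * wx s (X s) + riemx \<sigma> s (X s) * (- \<sigma> * c (v s (X s)))
      = (c (v s (X s)))\<^sup>2 * vx s (X s) * (1 - \<sigma> * \<sigma>)"
      by (simp add: riemx_def algebra_simps power2_eq_square)
    finally have "((\<lambda>s. riem \<sigma> s (X s)) has_real_derivative 0) (at s within {0..<T})"
      using \<sigma> by simp
    then show ?thesis
      by (rule DERIV_subset) (use T' in auto)
  qed
  from has_field_derivative_zero_constant[OF _ this] obtain k where
    "\<And>s. s \<in> {0..T'} \<Longrightarrow> riem \<sigma> s (X s) = k"
    by auto
  then show ?thesis using t by auto
qed

lemma riem_bound:
  assumes \<sigma>: "\<sigma> * \<sigma> = 1" and "\<And>x. \<bar>riem \<sigma> 0 x\<bar> \<le> \<eta>" and t: "t \<in> {0..<T}"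
  shows "\<bar>riem \<sigma> t x\<bar> \<le> \<eta>"
proof -
  obtain X where X: "X t = x" "characteristic \<sigma> t X"
    using characteristic_exists[OF \<sigma>, of t t x] t by auto
  have "riem \<sigma> t (X t) = riem \<sigma> 0 (X 0)"
    by (rule riem_constant[OF \<sigma> _ X(2)]) (use t in auto)
  then show ?thesis using assms X by simp
qed

lemma v_bound:
  assumes "\<And>x. \<bar>riem 1 0 x\<bar> \<le> \<eta>" "\<And>x. \<bar>riem (- 1) 0 x\<bar> \<le> \<eta>" and t: "t \<in> {0..<T}"
  shows "\<bar>v t x\<bar> \<le> 2 * \<eta>"
proof -
  have "2 * G (v t x) = riem 1 t x - riem (- 1) t x"
    by (simp add: riem_def)
  then have "\<bar>G (v t x)\<bar> \<le> \<eta>"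
    using riem_bound[of 1, OF _ assms(1) t, of x] riem_bound[of "- 1", OF _ assms(2) t, of x] by linarith
  then show ?thesis using G_abs_lower[of "v t x"] by linarith
qed

lemma w_bound:
  assumes "\<And>x. \<bar>riem 1 0 x\<bar> \<le> \<eta>" "\<And>x. \<bar>riem (- 1) 0 x\<bar> \<le> \<eta>" and t: "t \<in> {0..<T}"
  shows "\<bar>w t x\<bar> \<le> \<eta>"
proof -
  have "2 * w t x = riem 1 t x + riem (- 1) t x"
    by (simp add: riem_def)
  then show ?thesis
    using riem_bound[of 1, OF _ assms(1) t, of x] riem_bound[of "- 1", OF _ assms(2) t, of x] by linarith
qed

end

section \<open>The Riccati equation and blow-up along the first family\<close>

lemma within_deriv_nonneg_imp_le:
  fixes f f' :: "real \<Rightarrow> real"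
  assumes "a \<le> b" and f': "\<And>x. x \<in> {a..b} \<Longrightarrow> (f has_real_derivative f' x) (at x within {a..b})"
    and "\<And>x. x \<in> {a..b} \<Longrightarrow> 0 \<le> f' x"
  shows "f a \<le> f b"
proof (rule DERIV_nonneg_imp_increasing_open[OF \<open>a \<le> b\<close>])
  show "continuous_on {a..b} f"
    by (auto simp: continuous_on_eq_continuous_within intro!: DERIV_continuous[OF f'])
  fix x assume "a < x" "x < b"
  then show "\<exists>y. (f has_real_derivative y) (at x) \<and> 0 \<le> y"
    using f'[of x] assms(3)[of x] by (auto simp: at_within_Icc_at)
qed

context psys
begin

text \<open>\<open>riemx\<close> is merely continuous, so it is differentiated along a characteristic by letting
  \<open>d \<rightarrow> 0\<close> in the evolution equation of the difference quotient
  \<open>(r(t, X + d) - r(t, X)) / d\<close>.\<close>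

lemma riemx_difference_quotient:
  assumes T': "0 \<le> T'" "T' < T" and X: "characteristic 1 T' X" and t: "t \<in> {0..T'}" and d: "d \<noteq> 0"
  shows "((\<lambda>s. (c (v s (X s + d)) - c (v s (X s))) / d * riemx 1 s (X s + d)) has_integral
    ((riem 1 t (X t + d) - riem 1 t (X t)) / d - (riem 1 0 (X 0 + d) - riem 1 0 (X 0)) / d)) {0..t}"
proof (rule fundamental_theorem_of_calculus)
  show "0 \<le> t" using t by simp
  fix s assume s: "s \<in> {0..t}"
  then have s': "s \<in> {0..<T}" "s \<in> {0..T'}" using t T' by auto
  have dX: "(X has_real_derivative - 1 * c (v s (X s))) (at s within {0..<T})"
    by (rule characteristicD[OF X s'(2)])
  then have dXd: "((\<lambda>s. X s + d) has_real_derivative - 1 * c (v s (X s))) (at s within {0..<T})"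
    by (auto intro!: derivative_eq_intros)
  have "((\<lambda>s. (riem 1 s (X s + d) - riem 1 s (X s)) / d) has_real_derivative
     (((c (v s (X s + d)))\<^sup>2 * vx s (X s + d) + 1 * c (v s (X s + d)) * wx s (X s + d) + riemx 1 s (X s + d) * (- 1 * c (v s (X s))))
     - ((c (v s (X s)))\<^sup>2 * vx s (X s) + 1 * c (v s (X s)) * wx s (X s) + riemx 1 s (X s) * (- 1 * c (v s (X s))))) / d) (at s within {0..<T})"
    by (rule DERIV_cdivide[OF DERIV_diff[OF riem_along[OF s'(1) dXd] riem_along[OF s'(1) dX]]])
  \<comment> \<open>Both points move with the velocity belonging to \<open>X s\<close>. At
    \<open>X s\<close> the invariant is constant; at \<open>X s + d\<close> there remains the
    mismatch of the two velocities times the slope at that point.\<close>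
  also have "((c (v s (X s + d)))\<^sup>2 * vx s (X s + d) + 1 * c (v s (X s + d)) * wx s (X s + d) + riemx 1 s (X s + d) * (- 1 * c (v s (X s))))
     - ((c (v s (X s)))\<^sup>2 * vx s (X s) + 1 * c (v s (X s)) * wx s (X s) + riemx 1 s (X s) * (- 1 * c (v s (X s))))
     = (c (v s (X s + d)) - c (v s (X s))) * riemx 1 s (X s + d)"
    by (simp add: riemx_def algebra_simps power2_eq_square)
  also have "(c (v s (X s + d)) - c (v s (X s))) * riemx 1 s (X s + d) / d = (c (v s (X s + d)) - c (v s (X s))) / d * riemx 1 s (X s + d)"
    by simp
  finally show "((\<lambda>s. (riem 1 s (X s + d) - riem 1 s (X s)) / d) has_vector_derivative
      (c (v s (X s + d)) - c (v s (X s))) / d * riemx 1 s (X s + d)) (at s within {0..t})"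
    unfolding has_real_derivative_iff_has_vector_derivative[symmetric]
    by (rule DERIV_subset) (use t T' in auto)
qed

text \<open>The increments form a sequence because dominated convergence will be applied to
  sequences.\<close>

lemma difference_quotient_tendsto:
  fixes f :: "real \<Rightarrow> real"
  assumes "(f has_real_derivative D) (at x)"
  shows "(\<lambda>n. (f (x + 1 / real (Suc n)) - f x) / (1 / real (Suc n))) \<longlonglongrightarrow> D"
proof -
  have "filterlim (\<lambda>n. 1 / real (Suc n)) (at 0) sequentially"
    unfolding filterlim_at using LIMSEQ_inverse_real_of_nat by (auto simp: inverse_eq_divide)
  from filterlim_compose[OF assms[unfolded DERIV_def] this] show ?thesis by simp
qed

text \<open>The limit in the integrated equation for the difference quotient. Dominated convergence
  applies because the bounds on \<open>c'\<close> and \<open>vx\<close> control the quotients of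
  \<open>c (v s x)\<close> uniformly in the increment.\<close>

lemma riemx_integral:
  assumes T': "0 \<le> T'" "T' < T" and X: "characteristic 1 T' X" and t: "t \<in> {0..T'}"
  shows "riemx 1 t (X t) = riemx 1 0 (X 0) + integral {0..t} (\<lambda>s. c' (v s (X s)) * vx s (X s) * riemx 1 s (X s))"
proof -
  define d where "d n = 1 / real (Suc n)" for n
  have d: "d n \<noteq> 0" for n by (simp add: d_def)
  define f where "f n s = (c (v s (X s + d n)) - c (v s (X s))) / d n * riemx 1 s (X s + d n)" for n s
  define Q where "Q n s = (riem 1 s (X s + d n) - riem 1 s (X s)) / d n" for n s
  have N: "N \<ge> 0"
    using vx_bound[of 0 0] T' by simp
  have K: "K \<ge> 0"
    using c'_bound[of 0] by simp
  have int: "(f n has_integral (Q n t - Q n 0)) {0..t}" for n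
    unfolding f_def Q_def by (rule riemx_difference_quotient[OF T' X t d])
  have Q: "(\<lambda>n. Q n s) \<longlonglongrightarrow> riemx 1 s (X s)" if "s \<in> {0..t}" for s
    unfolding Q_def d_def by (rule difference_quotient_tendsto, rule riem_x) (use that t T' in auto)
  have f: "(\<lambda>n. f n s) \<longlonglongrightarrow> c' (v s (X s)) * vx s (X s) * riemx 1 s (X s)" if s: "s \<in> {0..t}" for s
    unfolding f_def
  proof (rule tendsto_mult)
    have s': "s \<in> {0..<T}" using s t T' by auto
    have "((\<lambda>x. c (v s x)) has_real_derivative c' (v s (X s)) * vx s (X s)) (at (X s))"
      by (rule DERIV_chain2[OF c_deriv v_x[OF s']])
    then show "(\<lambda>n. (c (v s (X s + d n)) - c (v s (X s))) / d n) \<longlonglongrightarrow> c' (v s (X s)) * vx s (X s)"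
      unfolding d_def by (rule difference_quotient_tendsto)
    have "continuous_on UNIV (riemx 1 s)"
      by (rule continuous_on_compose2[OF riemx_cont, of UNIV "\<lambda>x. (s, x)", unfolded split_beta fst_conv snd_conv])
        (use s' in \<open>auto intro!: continuous_intros\<close>)
    moreover have "(\<lambda>n. X s + d n) \<longlonglongrightarrow> X s + 0"
      unfolding d_def by (intro tendsto_intros lim_1_over_n[THEN LIMSEQ_Suc])
    ultimately show "(\<lambda>n. riemx 1 s (X s + d n)) \<longlonglongrightarrow> riemx 1 s (X s)"
      by (auto simp: continuous_on_eq_continuous_at intro: isCont_tendsto_compose)
  qed
  \<comment> \<open>\<open>K * N\<close> is a Lipschitz constant of \<open>c (v s x)\<close> in
    \<open>x\<close>, and \<open>3 * N\<close> bounds \<open>riemx\<close> because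
    \<open>c \<le> 2\<close>.\<close>
  have bd: "norm (f n s) \<le> (K * N) * (3 * N)" if s: "s \<in> {0..t}" for n s
  proof -
    have s': "s \<in> {0..<T}" using s t T' by auto
    have "\<bar>v s (X s + d n) - v s (X s)\<bar> \<le> N * \<bar>(X s + d n) - X s\<bar>"
      using field_differentiable_bound[of UNIV "v s" "vx s" N "X s + d n" "X s"] v_x[OF s'] vx_bound[of s] s' by simp
    then have "K * \<bar>v s (X s + d n) - v s (X s)\<bar> \<le> K * (N * \<bar>d n\<bar>)"
      using K by (intro mult_left_mono) auto
    then have "\<bar>c (v s (X s + d n)) - c (v s (X s))\<bar> \<le> K * N * \<bar>d n\<bar>"
      using c_lipschitz[of "v s (X s + d n)" "v s (X s)"] by (simp add: mult.assoc)
    then have 1: "\<bar>(c (v s (X s + d n)) - c (v s (X s))) / d n\<bar> \<le> K * N"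
      using d[of n] by (simp add: divide_simps)
    have "\<bar>c (v s (X s + d n)) * vx s (X s + d n)\<bar> \<le> 2 * N"
      unfolding abs_mult using c_upper c_pos[THEN less_imp_le] vx_bound[of s] s' by (intro mult_mono) auto
    then have 2: "\<bar>riemx 1 s (X s + d n)\<bar> \<le> 3 * N"
      unfolding riemx_def using wx_bound[of s "X s + d n"] s' by auto
    show ?thesis
      unfolding f_def real_norm_def abs_mult using 1 2 K N by (intro mult_mono) auto
  qed
  have "(\<lambda>n. integral {0..t} (f n)) \<longlonglongrightarrow> integral {0..t} (\<lambda>s. c' (v s (X s)) * vx s (X s) * riemx 1 s (X s))"
    by (rule dominated_convergence(2)[where h="\<lambda>_. (K * N) * (3 * N)"])
      (use int bd f in \<open>auto intro: has_integral_integrable\<close>)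
  moreover have "(\<lambda>n. integral {0..t} (f n)) \<longlonglongrightarrow> riemx 1 t (X t) - riemx 1 0 (X 0)"
    unfolding integral_unique[OF int] using t by (intro tendsto_diff Q) auto
  ultimately show ?thesis
    using LIMSEQ_unique by fastforce
qed

lemma riemx_along:
  assumes T': "0 \<le> T'" "T' < T" and X: "characteristic 1 T' X" and t: "t \<in> {0..T'}"
  shows "((\<lambda>s. riemx 1 s (X s)) has_real_derivative c' (v t (X t)) * vx t (X t) * riemx 1 t (X t)) (at t within {0..T'})"
proof -
  have sub: "{0..T'} \<subseteq> {0..<T}" using T' by auto
  note along' = along[OF _ characteristic_cont[OF X] sub]
  have "continuous_on {0..T'} (\<lambda>s. c' (v s (X s)) * vx s (X s) * riemx 1 s (X s))"
    by (intro continuous_intros along'[OF c'v_cont] along'[OF vx_cont] along'[OF riemx_cont])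
  from integral_has_real_derivative[OF this t]
  have "((\<lambda>t. riemx 1 0 (X 0) + integral {0..t} (\<lambda>s. c' (v s (X s)) * vx s (X s) * riemx 1 s (X s)))
      has_real_derivative c' (v t (X t)) * vx t (X t) * riemx 1 t (X t)) (at t within {0..T'})"
    by (auto intro!: derivative_eq_intros)
  then show ?thesis
    by (rule has_field_derivative_transform_within[OF _ zero_less_one t])
      (rule riemx_integral[OF T' X, symmetric])
qed

lemma v_along:
  assumes T': "0 \<le> T'" "T' < T" and X: "characteristic 1 T' X" and t: "t \<in> {0..T'}"
  shows "((\<lambda>s. v s (X s)) has_real_derivative wx t (X t) - c (v t (X t)) * vx t (X t)) (at t within {0..T'})"
proof -
  have "((\<lambda>s. v s (X s)) has_real_derivative wx t (X t) + vx t (X t) * (- 1 * c (v t (X t)))) (at t within {0..<T})"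
    by (rule chain_along_curve[OF v_t v_x vx_cont _ characteristicD[OF X t]]) (use t T' in auto)
  from DERIV_subset[OF this, of "{0..T'}"] show ?thesis
    using T' by (simp add: subset_iff mult.commute)
qed

text \<open>Along the curve \<open>v\<close> changes at rate \<open>w_x - c v_x\<close>, so the
  weight \<open>sqrt c\<close> has logarithmic derivative \<open>c' (w_x - c v_x) / (2 c)\<close>.
  Adding the rate \<open>c' v_x\<close> of \<open>riemx\<close> gives
  \<open>c' (w_x + c v_x) / (2 c)\<close>, which is \<open>c' riemx / (2 c)\<close>. The weight is
  chosen so that the right-hand side becomes a pure square.\<close>

lemma riccati:
  assumes T': "0 \<le> T'" "T' < T" and X: "characteristic 1 T' X" and t: "t \<in> {0..T'}"
  shows "((\<lambda>s. sqrt (c (v s (X s))) * riemx 1 s (X s)) has_real_derivative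
    c' (v t (X t)) * (riemx 1 t (X t))\<^sup>2 / (2 * sqrt (c (v t (X t))))) (at t within {0..T'})"
proof -
  let ?c = "c (v t (X t))" and ?R = "riemx 1 t (X t)"
  have c: "?c > 0" by (rule c_pos)
  have sq: "sqrt ?c * sqrt ?c = ?c" "sqrt ?c > 0" using c by auto
  have "((\<lambda>s. sqrt (c (v s (X s)))) has_real_derivative
      inverse (sqrt ?c) / 2 * (c' (v t (X t)) * (wx t (X t) - ?c * vx t (X t)))) (at t within {0..T'})"
    by (rule DERIV_chain2[where f=sqrt and g="\<lambda>s. c (v s (X s))",
        OF DERIV_real_sqrt[OF c] DERIV_chain2[where f=c and g="\<lambda>s. v s (X s)", OF c_deriv v_along[OF T' X t]]])
  from DERIV_mult[OF this riemx_along[OF T' X t]]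
  have "((\<lambda>s. sqrt (c (v s (X s))) * riemx 1 s (X s)) has_real_derivative
    inverse (sqrt ?c) / 2 * (c' (v t (X t)) * (wx t (X t) - ?c * vx t (X t))) * ?R
    + c' (v t (X t)) * vx t (X t) * ?R * sqrt ?c) (at t within {0..T'})" .
  also have "inverse (sqrt ?c) / 2 * (c' (v t (X t)) * (wx t (X t) - ?c * vx t (X t))) * ?R
    + c' (v t (X t)) * vx t (X t) * ?R * sqrt ?c
    = c' (v t (X t)) * ?R * ((wx t (X t) - ?c * vx t (X t)) + 2 * vx t (X t) * (sqrt ?c * sqrt ?c)) / (2 * sqrt ?c)"
    using sq(2) by (simp add: field_simps)
  also have "\<dots> = c' (v t (X t)) * ?R\<^sup>2 / (2 * sqrt ?c)"
    unfolding sq(1) by (simp add: riemx_def power2_eq_square algebra_simps)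
  finally show ?thesis .
qed

text \<open>While \<open>c'\<close> is only nonnegative, \<open>Y\<close> cannot drop below
  \<open>\<rho> / 2\<close>. After \<open>t1\<close> the quantity \<open>1 / Y\<close> is at most
  \<open>2 / \<rho>\<close>, stays positive and decreases at rate at least
  \<open>\<kappa> / 6\<close>, which leaves a time of at most
  \<open>12 / (\<kappa> * \<rho>)\<close>.\<close>

lemma blowup_time_along:
  assumes T': "0 \<le> T'" "T' < T" and X: "characteristic 1 T' X"
    and nonneg: "\<And>t. t \<in> {0..T'} \<Longrightarrow> c' (v t (X t)) \<ge> 0"
    and \<kappa>: "\<kappa> > 0" "\<And>t. t \<in> {t1..T'} \<Longrightarrow> c' (v t (X t)) \<ge> \<kappa>"
    and \<rho>: "\<rho> > 0" "riemx 1 0 (X 0) \<ge> \<rho>" and t1: "t1 \<ge> 0"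
  shows "T' \<le> t1 + 12 / (\<kappa> * \<rho>)"
proof (cases "T' \<le> t1")
  case True
  have "12 / (\<kappa> * \<rho>) > 0" using \<kappa> \<rho> by simp
  then show ?thesis using True by linarith
next
  case False
  define Y where "Y s = sqrt (c (v s (X s))) * riemx 1 s (X s)" for s
  define Y' where "Y' t = c' (v t (X t)) * (riemx 1 t (X t))\<^sup>2 / (2 * sqrt (c (v t (X t))))" for t
  \<comment> \<open>Rational bounds for the root: 1/4 is below 1/2 and 9/4 is above 2.\<close>
  have sc: "1 / 2 \<le> sqrt (c x)" "sqrt (c x) \<le> 3 / 2" "sqrt (c x) > 0" for x
  proof -
    have "sqrt ((1 / 2)\<^sup>2) \<le> sqrt (c x)" "sqrt (c x) \<le> sqrt ((3 / 2)\<^sup>2)"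
      using c_lower[of x] c_upper[of x] by (auto simp: power2_eq_square intro!: real_sqrt_le_mono simp del: real_sqrt_abs)
    then show "1 / 2 \<le> sqrt (c x)" "sqrt (c x) \<le> 3 / 2" unfolding real_sqrt_abs by auto
    show "sqrt (c x) > 0" using c_pos by simp
  qed
  have Y': "(Y has_real_derivative Y' t) (at t within {0..T'})" if "t \<in> {0..T'}" for t
    unfolding Y_def Y'_def by (rule riccati[OF T' X that])
  have Y'_nonneg: "Y' t \<ge> 0" if "t \<in> {0..T'}" for t
    unfolding Y'_def using nonneg[OF that] sc(3)[of "v t (X t)"] by simp
  have mono: "Y a \<le> Y b" if "0 \<le> a" "a \<le> b" "b \<le> T'" for a b
    by (rule within_deriv_nonneg_imp_le[of a b Y Y'])
      (use that in \<open>auto intro!: DERIV_subset[OF Y'] Y'_nonneg\<close>)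
  have "Y 0 \<ge> 1 / 2 * \<rho>"
    unfolding Y_def using sc(1) \<rho> c_pos[THEN less_imp_le] by (intro mult_mono) auto
  then have Y_lower: "Y t \<ge> \<rho> / 2" if "t \<in> {0..T'}" for t
    using mono[of 0 t] that by auto
  then have Y_pos: "Y t > 0" if "t \<in> {0..T'}" for t
    using that \<rho>(1) by force
  \<comment> \<open>The rate is 1/6 because \<open>Y' / Y\<^sup>2 = c' / (2 * c * sqrt c)\<close>
    and \<open>c * sqrt c\<close> is at most 3.\<close>
  have "(- 1 / Y t1) - \<kappa> / 6 * t1 \<le> (- 1 / Y T') - \<kappa> / 6 * T'"
  proof (rule within_deriv_nonneg_imp_le[of t1 T' _ "\<lambda>t. Y' t / (Y t)\<^sup>2 - \<kappa> / 6"])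
    fix t assume t: "t \<in> {t1..T'}"
    then have t': "t \<in> {0..T'}" using t1 by auto
    have "((\<lambda>t. - 1 / Y t - \<kappa> / 6 * t) has_real_derivative Y' t / (Y t)\<^sup>2 - \<kappa> / 6) (at t within {0..T'})"
      using Y_pos[OF t'] by (auto intro!: derivative_eq_intros Y'[OF t'] simp: power2_eq_square)
    then show "((\<lambda>t. - 1 / Y t - \<kappa> / 6 * t) has_real_derivative Y' t / (Y t)\<^sup>2 - \<kappa> / 6) (at t within {t1..T'})"
      by (rule DERIV_subset) (use t1 in auto)
    let ?c = "c (v t (X t))"
    have R: "(riemx 1 t (X t))\<^sup>2 > 0"
      using Y_pos[OF t'] by (auto simp: Y_def)
    have "?c * sqrt ?c \<le> 2 * (3 / 2)"
      using c_upper sc(2) c_pos[THEN less_imp_le] sc(3)[THEN less_imp_le] by (intro mult_mono) auto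
    then have "\<kappa> / 6 * (2 * (?c * sqrt ?c)) \<le> \<kappa> / 6 * 6"
      using \<kappa>(1) by (intro mult_left_mono) auto
    also have "\<dots> \<le> c' (v t (X t))" using \<kappa>(2)[OF t] by simp
    finally have "\<kappa> / 6 \<le> c' (v t (X t)) / (2 * (?c * sqrt ?c))"
      using c_pos[of "v t (X t)"] by (simp add: pos_le_divide_eq)
    also have "\<dots> = Y' t / (Y t)\<^sup>2"
      unfolding Y'_def Y_def power_mult_distrib using R c_pos[of "v t (X t)"] by (simp add: field_simps)
    finally show "0 \<le> Y' t / (Y t)\<^sup>2 - \<kappa> / 6" by simp
  qed (use False in auto)
  then have "\<kappa> / 6 * T' + 1 / Y T' \<le> \<kappa> / 6 * t1 + 1 / Y t1"
    unfolding minus_divide_left[symmetric] by simp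
  moreover have "\<kappa> / 6 * T' \<le> \<kappa> / 6 * T' + 1 / Y T'"
    using Y_pos[of T'] T' by simp
  moreover have "1 / Y t1 \<le> 2 / \<rho>"
    using divide_left_mono[of "\<rho> / 2" "Y t1" 1] Y_lower[of t1] \<rho>(1) False t1 Y_pos[of t1] by simp
  ultimately have "\<kappa> / 6 * T' \<le> \<kappa> / 6 * t1 + 2 / \<rho>"
    by (meson add_left_mono order_trans)
  also have "\<dots> = \<kappa> / 6 * (t1 + 12 / (\<kappa> * \<rho>))"
    using \<kappa>(1) \<rho>(1) by (simp add: field_simps)
  finally show ?thesis using \<kappa>(1) by simp
qed

text \<open>Up to \<open>t1\<close> only the sign of \<open>c'\<close> matters. Later, the curve of
  the second family through a point of the chosen curve started so far to the left that
  \<open>s\<close> is at most half of \<open>r\<close> in size there, which keeps \<open>v\<close>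
  away from 0.\<close>

lemma blowup_time:
  assumes v\<delta>: "\<And>t x. 0 \<le> t \<Longrightarrow> t < T \<Longrightarrow> \<bar>v t x\<bar> \<le> \<delta>"
    and c'_lower: "\<And>\<theta>. \<bar>\<theta>\<bar> \<le> \<delta> \<Longrightarrow> C * \<bar>\<theta>\<bar> powr e \<le> c' \<theta>" and C: "C > 0" "e \<ge> 0"
    and \<eta>: "\<eta> > 0" "\<eta> \<le> \<bar>riem 1 0 x1\<bar>"
    and \<rho>: "\<rho> > 0" "\<rho> \<le> riemx 1 0 x1"
    and decay: "\<And>y. y \<le> x1 - t1 \<Longrightarrow> \<bar>riem (- 1) 0 y\<bar> \<le> \<eta> / 2" and t1: "t1 \<ge> 0"
  shows "T \<le> t1 + 12 / ((C * (\<eta> / 8) powr e) * \<rho>)"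
\<comment> \<open>The curves need a final time \<open>T'\<close> strictly before \<open>T\<close>;
  the slack \<open>\<epsilon>\<close> makes room for one that still exceeds the claimed
  bound.\<close>
proof (rule field_le_epsilon, rule ccontr)
  fix \<epsilon> :: real assume "\<epsilon> > 0"
  assume contr: "\<not> T \<le> t1 + 12 / ((C * (\<eta> / 8) powr e) * \<rho>) + \<epsilon>"
  define T' where "T' = t1 + 12 / ((C * (\<eta> / 8) powr e) * \<rho>) + \<epsilon>"
  have "12 / ((C * (\<eta> / 8) powr e) * \<rho>) > 0"
    using C \<eta> \<rho> by simp
  then have T': "0 \<le> T'" "T' < T" "t1 + 12 / ((C * (\<eta> / 8) powr e) * \<rho>) < T'"
    using contr t1 \<open>\<epsilon> > 0\<close> by (auto simp: T'_def)
  obtain X where X: "X 0 = x1" "characteristic 1 T' X"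
    using characteristic_exists[of 1 T' 0 x1] T' by auto
  have speed_ge: "X t \<le> x1 - t / 2" if "t \<in> {0..T'}" for t
  proof -
    have "- X 0 - 1 / 2 * 0 \<le> - X t - 1 / 2 * t"
    proof (rule within_deriv_nonneg_imp_le[of 0 t _ "\<lambda>t. c (v t (X t)) - 1 / 2"])
      fix s assume "s \<in> {0..t}"
      then have "(X has_real_derivative - 1 * c (v s (X s))) (at s within {0..t})"
        using that by (intro characteristicD[OF X(2)]) auto
      then show "((\<lambda>s. - X s - 1 / 2 * s) has_real_derivative c (v s (X s)) - 1 / 2) (at s within {0..t})"
        by (auto intro!: derivative_eq_intros)
    qed (use that c_lower in auto)
    then show ?thesis using X by simp
  qed
  \<comment> \<open>Both velocities have size at least 1/2, so
    \<open>Z 0 \<le> X t - t / 2 \<le> x1 - t\<close>. Then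
    \<open>\<bar>r - s\<bar> \<ge> \<eta> / 2\<close>, hence
    \<open>\<bar>G v\<bar> \<ge> \<eta> / 4\<close> and
    \<open>\<bar>v\<bar> \<ge> \<eta> / 8\<close>.\<close>
  have big: "(C * (\<eta> / 8) powr e) \<le> c' (v t (X t))" if t: "t \<in> {t1..T'}" for t
  proof -
    have t': "t \<in> {0..T'}" "0 \<le> t" "t < T" using t t1 T' by auto
    obtain Z where Z: "Z t = X t" "characteristic (- 1) T' Z"
      using characteristic_exists[of "- 1" T' t "X t"] T' by auto
    have "Z 0 - 1 / 2 * 0 \<le> Z t - 1 / 2 * t"
    proof (rule within_deriv_nonneg_imp_le[of 0 t _ "\<lambda>t. c (v t (Z t)) - 1 / 2"])
      fix s assume "s \<in> {0..t}"
      then have "(Z has_real_derivative - (- 1) * c (v s (Z s))) (at s within {0..t})"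
        using t' by (intro characteristicD[OF Z(2)]) auto
      then show "((\<lambda>s. Z s - 1 / 2 * s) has_real_derivative c (v s (Z s)) - 1 / 2) (at s within {0..t})"
        by (auto intro!: derivative_eq_intros)
    qed (use t' c_lower in auto)
    then have "Z 0 \<le> x1 - t1"
      using speed_ge[OF t'(1)] Z(1) t by auto
    then have "\<bar>riem (- 1) 0 (Z 0)\<bar> \<le> \<eta> / 2" by (rule decay)
    moreover have "riem (- 1) t (X t) = riem (- 1) 0 (Z 0)"
      using riem_constant[OF _ T'(2) Z(2) t'(1)] Z(1) by simp
    moreover have "riem 1 t (X t) = riem 1 0 x1"
      using riem_constant[OF _ T'(2) X(2) t'(1)] X(1) by simp
    moreover have "2 * G (v t (X t)) = riem 1 t (X t) - riem (- 1) t (X t)"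
      by (simp add: riem_def)
    ultimately have "\<eta> / 4 \<le> \<bar>G (v t (X t))\<bar>"
      using \<eta> by linarith
    then have "\<eta> / 8 \<le> \<bar>v t (X t)\<bar>"
      using G_abs_upper[of "v t (X t)"] by linarith
    then have "C * (\<eta> / 8) powr e \<le> C * \<bar>v t (X t)\<bar> powr e"
      using C \<eta> by (intro mult_left_mono powr_mono2) auto
    also have "\<dots> \<le> c' (v t (X t))"
      by (rule c'_lower[OF v\<delta>]) (use t' in auto)
    finally show ?thesis .
  qed
  have nonneg: "c' (v t (X t)) \<ge> 0" if "t \<in> {0..T'}" for t
  proof -
    have "C * \<bar>v t (X t)\<bar> powr e \<le> c' (v t (X t))"
      by (rule c'_lower[OF v\<delta>]) (use that T' in auto)
    moreover have "C * \<bar>v t (X t)\<bar> powr e \<ge> 0" using C by simp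
    ultimately show ?thesis by linarith
  qed
  have "T' \<le> t1 + 12 / ((C * (\<eta> / 8) powr e) * \<rho>)"
    by (rule blowup_time_along[OF T'(1,2) X(2) nonneg _ big \<rho>(1) _ t1])
      (use C \<eta> \<rho> X(1) in auto)
  then show False using T'(3) by simp
qed

end

section \<open>Local existence in characteristic coordinates\<close>

context speed
begin

lemma G_expanding: "\<bar>x - y\<bar> \<le> 2 * \<bar>G x - G y\<bar>"
proof -
  obtain z where "G x - G y = c z * (x - y)" by (rule G_mvt)
  then have "\<bar>G x - G y\<bar> = c z * \<bar>x - y\<bar>"
    using c_pos[of z] by (simp add: abs_mult)
  then show ?thesis
    using mult_right_mono[OF c_lower[of z], of "\<bar>x - y\<bar>"] by simp
qed

lemma G_inj: "inj G"
proof (rule injI)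
  fix x y assume "G x = G y"
  then show "x = y" using G_expanding[of x y] by simp
qed

lemma G_surj: "\<exists>x. G x = y"
proof -
  have up: "x / 2 \<le> G x" if "0 \<le> x" for x
  proof -
    obtain z where "G x - G 0 = c z * (x - 0)" by (rule G_mvt)
    then show ?thesis using mult_right_mono[OF c_lower[of z] that] by (simp add: G_0)
  qed
  have down: "G x \<le> x / 2" if "x \<le> 0" for x
  proof -
    obtain z where "G x - G 0 = c z * (x - 0)" by (rule G_mvt)
    then show ?thesis using mult_right_mono_neg[OF c_lower[of z] that] by (simp add: G_0)
  qed
  have "\<exists>x. - 2 * \<bar>y\<bar> \<le> x \<and> x \<le> 2 * \<bar>y\<bar> \<and> G x = y"
    by (rule IVT') (use up[of "2 * \<bar>y\<bar>"] down[of "- 2 * \<bar>y\<bar>"] G_cont in auto)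
  then show ?thesis by blast
qed

definition "\<Gamma> = inv G"

lemma G_\<Gamma> [simp]: "G (\<Gamma> y) = y"
  unfolding \<Gamma>_def by (metis G_surj f_inv_into_f rangeI)

lemma \<Gamma>_G [simp]: "\<Gamma> (G x) = x"
  unfolding \<Gamma>_def by (rule inv_f_f[OF G_inj])

lemma \<Gamma>_deriv: "(\<Gamma> has_real_derivative 1 / c (\<Gamma> y)) (at y)"
proof -
  have "\<bar>\<Gamma> a - \<Gamma> b\<bar> \<le> 2 * \<bar>a - b\<bar>" for a b
    using G_expanding[of "\<Gamma> a" "\<Gamma> b"] by simp
  then have "2-lipschitz_on UNIV \<Gamma>"
    by (intro lipschitz_onI) (auto simp: dist_real_def)
  then have "isCont \<Gamma> y"
    using lipschitz_on_continuous_on continuous_on_eq_continuous_at by blast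
  then have "(\<Gamma> has_real_derivative inverse (c (\<Gamma> y))) (at y)"
    using c_pos[of "\<Gamma> y"] by (intro DERIV_inverse_function[where f=G and a="y - 1" and b="y + 1"] G_deriv) auto
  then show ?thesis by (simp add: inverse_eq_divide)
qed

lemma \<Gamma>_cont: "continuous_on A \<Gamma>"
  by (meson DERIV_isCont \<Gamma>_deriv continuous_at_imp_continuous_on)

end

lemma continuous_on_plane_comp:
  assumes "continuous_on UNIV (\<lambda>(a, b). f a b)" "continuous_on A g" "continuous_on A h"
  shows "continuous_on A (\<lambda>x. f (g x) (h x))"
  by (rule continuous_on_compose2[OF assms(1), of A "\<lambda>x. (g x, h x)", unfolded split_beta fst_conv snd_conv])
    (auto intro!: continuous_intros assms)

lemma continuous_on_oint_plane:
  fixes E :: "real \<Rightarrow> real \<Rightarrow> real"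
  assumes E: "continuous_on UNIV (\<lambda>(a, b). E a b)"
    and "continuous_on UNIV p" "continuous_on UNIV q" "continuous_on UNIV r"
  shows "continuous_on UNIV (\<lambda>z::'a::topological_space. oint (p z) (q z) (E (r z)))"
    and "continuous_on UNIV (\<lambda>z. oint (p z) (q z) (\<lambda>s. E s (r z)))"
proof -
  have "continuous_on (UNIV \<times> UNIV) (\<lambda>(z, s). E (r z) s)"
    unfolding split_beta
    by (rule continuous_on_plane_comp[OF E])
      (auto intro!: continuous_intros continuous_on_compose2[OF assms(4)])
  then show "continuous_on UNIV (\<lambda>z. oint (p z) (q z) (E (r z)))"
    by (rule continuous_on_oint) (rule assms)+
  have "continuous_on (UNIV \<times> UNIV) (\<lambda>(z, s). E s (r z))"
    unfolding split_beta
    by (rule continuous_on_plane_comp[OF E])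
      (auto intro!: continuous_intros continuous_on_compose2[OF assms(4)])
  then show "continuous_on UNIV (\<lambda>z. oint (p z) (q z) (\<lambda>s. E s (r z)))"
    by (rule continuous_on_oint) (rule assms)+
qed

text \<open>A function with prescribed mixed derivative \<open>E\<close> and with first derivatives
  \<open>f\<close> and \<open>g\<close> on the diagonal. The double integral \<open>W\<close> has
  the mixed derivative; the one-variable terms \<open>A\<close> and \<open>B\<close> correct its
  first derivatives on the diagonal.\<close>

lemma potential_exists:
  fixes E :: "real \<Rightarrow> real \<Rightarrow> real"
  assumes E: "continuous_on UNIV (\<lambda>(a, b). E a b)"
    and f: "continuous_on UNIV f" and g: "continuous_on UNIV g"
  obtains t where
    "\<And>a b. ((\<lambda>a. t a b) has_real_derivative f a + oint a b (E a)) (at a)"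
    "\<And>a b. (t a has_real_derivative g b + oint b a (\<lambda>s. E s b)) (at b)"
    "t a0 a0 = t0"
proof -
  have E1: "continuous_on UNIV (E a)" and E2: "continuous_on UNIV (\<lambda>s. E s b)" for a b
    using continuous_on_plane_comp[OF E, of UNIV "\<lambda>_. a" "\<lambda>s. s"]
      continuous_on_plane_comp[OF E, of UNIV "\<lambda>s. s" "\<lambda>_. b"] by simp_all
  define W where "W a b = oint 0 a (\<lambda>a'. oint 0 b (E a'))" for a b
  have Wa: "((\<lambda>a. W a b) has_real_derivative oint 0 b (E a)) (at a)" for a b
    unfolding W_def
    by (rule oint_has_derivative, rule continuous_on_oint_plane[OF E]) (auto intro!: continuous_intros)
  have Wb: "(W a has_real_derivative oint 0 a (\<lambda>s. E s b)) (at b)" for a b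
    unfolding W_def[abs_def]
  proof (rule oint_leibniz)
    show "((\<lambda>b. oint 0 b (E s)) has_real_derivative E s b) (at b)" for s b
      by (rule oint_has_derivative[OF E1])
    show "continuous_on (closed_segment 0 a) (\<lambda>s. oint 0 b (E s))" for b
      by (rule continuous_on_subset[OF continuous_on_oint_plane(1)[OF E]]) (auto intro!: continuous_intros)
    show "continuous_on (closed_segment 0 a \<times> UNIV) (\<lambda>(s, x). E s x)"
      by (rule continuous_on_subset[OF E]) auto
  qed
  have "continuous_on UNIV (\<lambda>a. f a - oint 0 a (E a))"
    by (rule continuous_on_diff[OF f continuous_on_oint_plane(1)[OF E]]) (rule continuous_intros)+
  note antiderivative_UNIV[OF this]
  then obtain A where A: "\<And>a. (A has_real_derivative f a - oint 0 a (E a)) (at a)"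
    by metis
  have "continuous_on UNIV (\<lambda>b. g b - oint 0 b (\<lambda>s. E s b))"
    by (rule continuous_on_diff[OF g continuous_on_oint_plane(2)[OF E]]) (rule continuous_intros)+
  note antiderivative_UNIV[OF this]
  then obtain B where B: "\<And>b. (B has_real_derivative g b - oint 0 b (\<lambda>s. E s b)) (at b)"
    by metis
  define t where "t a b = W a b + A a + B b - (W a0 a0 + A a0 + B a0) + t0" for a b
  show ?thesis
  proof (rule that[of t])
    fix a b
    show "((\<lambda>a. t a b) has_real_derivative f a + oint a b (E a)) (at a)"
      unfolding t_def oint_split[OF E1, of a b a 0]
      by (auto intro!: derivative_eq_intros Wa A)
    show "(t a has_real_derivative g b + oint b a (\<lambda>s. E s b)) (at b)"
      unfolding t_def[abs_def] oint_split[OF E2, of b a b 0]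
      by (auto intro!: derivative_eq_intros Wb B)
  qed (simp add: t_def)
qed

lemma diagonal_deriv:
  fixes t ta tb :: "real \<Rightarrow> real \<Rightarrow> real"
  assumes "\<And>a b. ((\<lambda>a. t a b) has_real_derivative ta a b) (at a)"
    and "\<And>a b. (t a has_real_derivative tb a b) (at b)"
    and "continuous_on UNIV (\<lambda>(a, b). tb a b)"
  shows "((\<lambda>a. t a a) has_real_derivative ta a a + tb a a) (at a)"
  using chain_along_curve[of t "\<lambda>a. a" a "ta a a" UNIV tb 1] assms by simp

section \<open>A linear Goursat problem near the diagonal\<close>

text \<open>The unknown enters linearly through integrals of length at most \<open>h\<close>, so
  \<open>h * k \<le> 1 / 20\<close> makes the map a contraction. It also bounds the integrals by
  1/8, small against the lower bound 1/4 that \<open>P0\<close> has in the application.\<close>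

lemma goursat_fixed_point:
  fixes N1 N2 :: "real \<Rightarrow> real \<Rightarrow> real" and P0 :: "real \<Rightarrow> real" and h k :: real
  assumes N1: "continuous_on UNIV (\<lambda>(a, b). N1 a b)" "\<And>a b. \<bar>N1 a b\<bar> \<le> k"
    and N2: "continuous_on UNIV (\<lambda>(a, b). N2 a b)" "\<And>a b. \<bar>N2 a b\<bar> \<le> k"
    and P0: "continuous_on UNIV P0" "\<And>a. \<bar>P0 a\<bar> \<le> 1"
    and h: "h > 0" "h * k \<le> 1 / 20"
  obtains E where "continuous_on UNIV (\<lambda>(a, b). E a b)"
    and "\<And>a b. \<bar>a - b\<bar> \<le> h \<Longrightarrow>
      E a b = N1 a b * (P0 a - oint a b (E a)) + N2 a b * (- P0 b - oint b a (\<lambda>s. E s b))"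
    and "\<And>a b. \<bar>a - b\<bar> \<le> h \<Longrightarrow> \<bar>oint a b (E a)\<bar> \<le> 1 / 8"
    and "\<And>a b. \<bar>a - b\<bar> \<le> h \<Longrightarrow> \<bar>oint b a (\<lambda>s. E s b)\<bar> \<le> 1 / 8"
proof -
  have k: "k \<ge> 0" using N1(2)[of 0 0] by linarith
  \<comment> \<open>Clamping the length of integration makes the map act on bounded functions on the
    whole plane; near the diagonal it changes nothing.\<close>
  define cl where "cl d = max (- h) (min h d)" for d
  have cl_cont: "continuous_on A (\<lambda>x. cl (f x))" if "continuous_on A f" for A :: "(real \<times> real) set" and f
    unfolding cl_def by (intro continuous_intros that)
  have cl_abs: "\<bar>cl d\<bar> \<le> h" for d using h by (auto simp: cl_def)
  define I1 where "I1 E p = oint (fst p) (fst p + cl (snd p - fst p)) (\<lambda>s. E (fst p, s))" for E :: "real \<times> real \<Rightarrow> real" and p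
  define I2 where "I2 E p = oint (snd p) (snd p + cl (fst p - snd p)) (\<lambda>s. E (s, snd p))" for E :: "real \<times> real \<Rightarrow> real" and p
  define F where "F E p = N1 (fst p) (snd p) * (P0 (fst p) - I1 E p) + N2 (fst p) (snd p) * (- P0 (snd p) - I2 E p)"
    for E :: "real \<times> real \<Rightarrow> real" and p
  have slice: "continuous_on A (\<lambda>s. apply_bcontfun E (x, s))" "continuous_on A (\<lambda>s. apply_bcontfun E (s, x))" for E :: "(real \<times> real) \<Rightarrow>\<^sub>C real" and A and x :: real
    by (auto intro!: continuous_on_compose2[OF continuous_on_apply_bcontfun] continuous_intros)
  have I1: "\<bar>I1 E p\<bar> \<le> h * norm E" and I2: "\<bar>I2 E p\<bar> \<le> h * norm E" for E :: "(real \<times> real) \<Rightarrow>\<^sub>C real" and p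
  proof -
    have "\<bar>I1 E p\<bar> \<le> \<bar>fst p + cl (snd p - fst p) - fst p\<bar> * norm E"
      unfolding I1_def using norm_bounded[of E] by (intro oint_bound slice) auto
    also have "\<dots> \<le> h * norm E" using cl_abs by (intro mult_right_mono) auto
    finally show "\<bar>I1 E p\<bar> \<le> h * norm E" .
    have "\<bar>I2 E p\<bar> \<le> \<bar>snd p + cl (fst p - snd p) - snd p\<bar> * norm E"
      unfolding I2_def using norm_bounded[of E] by (intro oint_bound slice) auto
    also have "\<dots> \<le> h * norm E" using cl_abs by (intro mult_right_mono) auto
    finally show "\<bar>I2 E p\<bar> \<le> h * norm E" .
  qed
  have Icont: "continuous_on UNIV (I1 E)" "continuous_on UNIV (I2 E)" for E :: "(real \<times> real) \<Rightarrow>\<^sub>C real"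
  proof -
    have E: "continuous_on UNIV (\<lambda>(a, b). apply_bcontfun E (a, b))" by simp
    show "continuous_on UNIV (I1 E)" "continuous_on UNIV (I2 E)"
      unfolding I1_def[abs_def] I2_def[abs_def]
      by (auto intro!: continuous_on_oint_plane[OF E] continuous_intros cl_cont)
  qed
  have bound: "\<bar>F E p\<bar> \<le> 2 * k * (1 + h * norm E)" for E :: "(real \<times> real) \<Rightarrow>\<^sub>C real" and p
  proof -
    have "\<bar>N1 (fst p) (snd p) * (P0 (fst p) - I1 E p)\<bar> \<le> k * (1 + h * norm E)"
      unfolding abs_mult using N1(2) I1[of E p] P0(2)[of "fst p"] k by (intro mult_mono) auto
    moreover have "\<bar>N2 (fst p) (snd p) * (- P0 (snd p) - I2 E p)\<bar> \<le> k * (1 + h * norm E)"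
      unfolding abs_mult using N2(2) I2[of E p] P0(2)[of "snd p"] k by (intro mult_mono) auto
    ultimately show ?thesis unfolding F_def by linarith
  qed
  have F: "F E \<in> bcontfun" for E :: "(real \<times> real) \<Rightarrow>\<^sub>C real"
  proof (rule bcontfun_normI)
    show "continuous_on UNIV (F E)"
      unfolding F_def[abs_def]
      by (intro continuous_intros Icont continuous_on_plane_comp[OF N1(1)] continuous_on_plane_comp[OF N2(1)]
          continuous_on_compose2[OF P0(1)]) auto
    show "norm (F E p) \<le> 2 * k * (1 + h * norm E)" for p using bound by simp
  qed
  have Fz: "apply_bcontfun (Bcontfun (F E)) = F E" for E :: "(real \<times> real) \<Rightarrow>\<^sub>C real"
    by (rule Bcontfun_inverse[OF F])
  have diffs: "I1 E1 p - I1 E2 p = I1 (E1 - E2) p" "I2 E1 p - I2 E2 p = I2 (E1 - E2) p" for E1 E2 :: "(real \<times> real) \<Rightarrow>\<^sub>C real" and p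
    unfolding I1_def I2_def by (simp_all add: oint_diff slice)
  have contraction: "dist (Bcontfun (F E1)) (Bcontfun (F E2)) \<le> 1 / 2 * dist E1 E2" for E1 E2 :: "(real \<times> real) \<Rightarrow>\<^sub>C real"
  proof (rule dist_bound)
    fix p
    have "F E1 p - F E2 p = - (N1 (fst p) (snd p) * (I1 E1 p - I1 E2 p)) - N2 (fst p) (snd p) * (I2 E1 p - I2 E2 p)"
      unfolding F_def by (simp add: algebra_simps)
    moreover have "\<bar>N1 (fst p) (snd p) * (I1 E1 p - I1 E2 p)\<bar> \<le> k * (h * norm (E1 - E2))"
      unfolding abs_mult diffs using N1(2) I1[of "E1 - E2" p] k by (intro mult_mono) auto
    moreover have "\<bar>N2 (fst p) (snd p) * (I2 E1 p - I2 E2 p)\<bar> \<le> k * (h * norm (E1 - E2))"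
      unfolding abs_mult diffs using N2(2) I2[of "E1 - E2" p] k by (intro mult_mono) auto
    moreover have "k * (h * norm (E1 - E2)) \<le> 1 / 20 * norm (E1 - E2)"
      using mult_right_mono[OF h(2), of "norm (E1 - E2)"] by (simp add: mult_ac)
    ultimately have "\<bar>F E1 p - F E2 p\<bar> \<le> 1 / 2 * norm (E1 - E2)"
      using norm_ge_zero[of "E1 - E2"] by linarith
    then show "dist (apply_bcontfun (Bcontfun (F E1)) p) (apply_bcontfun (Bcontfun (F E2)) p) \<le> 1 / 2 * dist E1 E2"
      unfolding Fz by (simp add: dist_real_def dist_norm)
  qed
  obtain E :: "(real \<times> real) \<Rightarrow>\<^sub>C real" where "Bcontfun (F E) = E"
    using banach_fix_type[of "1/2" "\<lambda>E. Bcontfun (F (apply_bcontfun E))"] contraction by auto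
  then have E: "apply_bcontfun E p = F E p" for p
    using Fz by metis
  \<comment> \<open>Self-bound of the fixed point:
    \<open>h * norm E \<le> (1 + h * norm E) / 10\<close>, so
    \<open>h * norm E \<le> 1 / 9\<close>.\<close>
  have "norm E \<le> 2 * k * (1 + h * norm E)"
    by (rule norm_bound) (use bound E in simp)
  then have "h * norm E \<le> h * (2 * k * (1 + h * norm E))"
    using h by (intro mult_left_mono) auto
  also have "\<dots> = 2 * (h * k) * (1 + h * norm E)" by simp
  also have "\<dots> \<le> 2 * (1 / 20) * (1 + h * norm E)"
    using h by (intro mult_right_mono mult_left_mono) auto
  finally have hE: "h * norm E \<le> 1 / 8" by simp
  have I1': "I1 E (a, b) = oint a b (\<lambda>s. apply_bcontfun E (a, s))" and I2': "I2 E (a, b) = oint b a (\<lambda>s. apply_bcontfun E (s, b))" if "\<bar>a - b\<bar> \<le> h" for a b :: real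
  proof -
    have "cl (b - a) = b - a" "cl (a - b) = a - b" using that by (auto simp: cl_def)
    then show "I1 E (a, b) = oint a b (\<lambda>s. apply_bcontfun E (a, s))" "I2 E (a, b) = oint b a (\<lambda>s. apply_bcontfun E (s, b))"
      by (simp_all add: I1_def I2_def)
  qed
  show ?thesis
  proof (rule that[of "\<lambda>a b. apply_bcontfun E (a, b)"])
    fix a b :: real assume ab: "\<bar>a - b\<bar> \<le> h"
    show "apply_bcontfun E (a, b) = N1 a b * (P0 a - oint a b (\<lambda>s. apply_bcontfun E (a, s))) + N2 a b * (- P0 b - oint b a (\<lambda>s. apply_bcontfun E (s, b)))"
      using E[of "(a, b)"] I1'[OF ab] I2'[OF ab] by (simp add: F_def)
    show "\<bar>oint a b (\<lambda>s. apply_bcontfun E (a, s))\<bar> \<le> 1 / 8" "\<bar>oint b a (\<lambda>s. apply_bcontfun E (s, b))\<bar> \<le> 1 / 8"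
      using I1[of E "(a, b)"] I2[of E "(a, b)"] I1'[OF ab] I2'[OF ab] hE by simp_all
  qed simp
qed

text \<open>Inversion of the map \<open>(a, b) \<mapsto> (t, x)\<close> from characteristic coordinates. The rates of change of
  \<open>t\<close> and \<open>x\<close> have fixed signs, which gives injectivity along segments; surjectivity comes from the
  intermediate value theorem in \<open>b\<close> and then in \<open>a\<close>.\<close>

locale char_coords =
  fixes t x ta tb xa xb lam :: "real \<Rightarrow> real \<Rightarrow> real" and h :: real
  assumes h: "h > 0"
    and t_a: "\<And>a b. ((\<lambda>a. t a b) has_real_derivative ta a b) (at a)"
    and t_b: "\<And>a b. (t a has_real_derivative tb a b) (at b)"
    and x_a: "\<And>a b. ((\<lambda>a. x a b) has_real_derivative xa a b) (at a)"
    and x_b: "\<And>a b. (x a has_real_derivative xb a b) (at b)"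
    and tb_cont: "continuous_on UNIV (\<lambda>(a, b). tb a b)"
    and xb_cont: "continuous_on UNIV (\<lambda>(a, b). xb a b)"
    and t_diag: "\<And>a. t a a = 0" and x_diag: "\<And>a. x a a = a"
    and ta_bounds: "\<And>a b. \<bar>a - b\<bar> < h \<Longrightarrow> 1 / 8 \<le> ta a b \<and> ta a b \<le> 2"
    and tb_bounds: "\<And>a b. \<bar>a - b\<bar> < h \<Longrightarrow> 1 / 8 \<le> - tb a b \<and> - tb a b \<le> 2"
    and xa_eq: "\<And>a b. \<bar>a - b\<bar> < h \<Longrightarrow> xa a b = lam a b * ta a b"
    and xb_eq: "\<And>a b. \<bar>a - b\<bar> < h \<Longrightarrow> xb a b = - lam a b * tb a b"
    and lam_bounds: "\<And>a b. 1 / 2 \<le> lam a b \<and> lam a b \<le> 2"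
begin

lemma t_deriv: "((\<lambda>(a, b). t a b) has_derivative (\<lambda>(u, w). ta a b * u + tb a b * w)) (at (a, b))"
  using plane_has_derivative[of t b "ta a b" a UNIV tb] t_a t_b tb_cont by simp

lemma x_deriv: "((\<lambda>(a, b). x a b) has_derivative (\<lambda>(u, w). xa a b * u + xb a b * w)) (at (a, b))"
  using plane_has_derivative[of x b "xa a b" a UNIV xb] x_a x_b xb_cont by simp

definition "\<Phi> p = (t (fst p) (snd p), x (fst p) (snd p))"

definition "S = {p. \<bar>fst p - snd p\<bar> < h}"

lemma S_open: "open S"
  unfolding S_def by (intro open_Collect_less continuous_intros)

lemma \<Phi>_deriv: "(\<Phi> has_derivative (\<lambda>(u, w). (ta a b * u + tb a b * w, xa a b * u + xb a b * w))) (at (a, b))"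
proof -
  have "\<Phi> = (\<lambda>p. ((\<lambda>(a, b). t a b) p, (\<lambda>(a, b). x a b) p))"
    by (auto simp: \<Phi>_def fun_eq_iff)
  then show ?thesis
    using has_derivative_Pair[OF t_deriv[of a b] x_deriv[of a b]] by (simp add: case_prod_beta')
qed

lemma \<Phi>_cont: "continuous_on A \<Phi>"
proof (rule has_derivative_continuous_on)
  fix p show "(\<Phi> has_derivative (\<lambda>(u, w). (ta (fst p) (snd p) * u + tb (fst p) (snd p) * w,
      xa (fst p) (snd p) * u + xb (fst p) (snd p) * w))) (at p within A)"
    using has_derivative_at_withinI[OF \<Phi>_deriv[of "fst p" "snd p"]] by simp
qed

lemma x_cont: "continuous_on A (\<lambda>(a, b). x a b)"
  using continuous_on_snd[OF \<Phi>_cont, of A] by (simp add: \<Phi>_def split_beta)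

lemma strip_segment:
  assumes "\<bar>a1 - b1\<bar> < h" "\<bar>a2 - b2\<bar> < h" "\<theta> \<in> {0..1}"
  shows "\<bar>(a1 + \<theta> * (a2 - a1)) - (b1 + \<theta> * (b2 - b1))\<bar> < h"
proof -
  have "(a1 + \<theta> * (a2 - a1)) - (b1 + \<theta> * (b2 - b1)) = (1 - \<theta>) * (a1 - b1) + \<theta> * (a2 - b2)"
    by (simp add: algebra_simps)
  moreover have "\<bar>(1 - \<theta>) * (a1 - b1) + \<theta> * (a2 - b2)\<bar> < h"
  proof (rule convex_bound_lt[of "\<bar>a1 - b1\<bar>" h "\<bar>a2 - b2\<bar>" "1 - \<theta>" \<theta>, THEN le_less_trans[rotated]])
    show "\<bar>(1 - \<theta>) * (a1 - b1) + \<theta> * (a2 - b2)\<bar> \<le> (1 - \<theta>) * \<bar>a1 - b1\<bar> + \<theta> * \<bar>a2 - b2\<bar>"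
      using assms(3) by (intro order_trans[OF abs_triangle_ineq]) (simp add: abs_mult)
  qed (use assms in auto)
  ultimately show ?thesis by simp
qed

lemma segment_deriv:
  assumes "\<And>a b. ((\<lambda>(a, b). f a b) has_derivative (\<lambda>(u, w). fa a b * u + fb a b * w)) (at (a, b))"
  shows "((\<lambda>\<theta>. f (a1 + \<theta> * d1) (b1 + \<theta> * d2)) has_real_derivative
    fa (a1 + \<theta> * d1) (b1 + \<theta> * d2) * d1 + fb (a1 + \<theta> * d1) (b1 + \<theta> * d2) * d2) (at \<theta>)"
proof -
  have "((\<lambda>\<theta>. (a1 + \<theta> * d1, b1 + \<theta> * d2)) has_derivative (\<lambda>k. (k * d1, k * d2))) (at \<theta>)"
    by (auto intro!: derivative_eq_intros)
  from diff_chain_at[OF this assms] show ?thesis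
    unfolding has_field_derivative_def
    by (auto elim!: has_derivative_eq_rhs simp: o_def algebra_simps)
qed

lemma segment_increasing:
  assumes f: "\<And>a b. ((\<lambda>(a, b). f a b) has_derivative (\<lambda>(u, w). fa a b * u + fb a b * w)) (at (a, b))"
    and S: "\<bar>a1 - b1\<bar> < h" "\<bar>a2 - b2\<bar> < h"
    and pos: "\<And>a b. \<bar>a - b\<bar> < h \<Longrightarrow> fa a b * (a2 - a1) + fb a b * (b2 - b1) > 0"
  shows "f a1 b1 < f a2 b2"
proof -
  have "f (a1 + 0 * (a2 - a1)) (b1 + 0 * (b2 - b1)) < f (a1 + 1 * (a2 - a1)) (b1 + 1 * (b2 - b1))"
  proof (rule DERIV_pos_imp_increasing[of 0 1 "\<lambda>\<theta>. f (a1 + \<theta> * (a2 - a1)) (b1 + \<theta> * (b2 - b1))"])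
    fix \<theta> :: real assume "0 \<le> \<theta>" "\<theta> \<le> 1"
    then show "\<exists>y. ((\<lambda>\<theta>. f (a1 + \<theta> * (a2 - a1)) (b1 + \<theta> * (b2 - b1))) has_real_derivative y) (at \<theta>) \<and> 0 < y"
      using segment_deriv[OF f] pos[OF strip_segment[OF S, of \<theta>]] by (intro exI conjI) auto
  qed simp
  then show ?thesis by simp
qed

lemma pos_neg:
  assumes "\<bar>a - b\<bar> < h"
  shows "ta a b > 0" "tb a b < 0" "xa a b > 0" "xb a b > 0"
proof -
  show 1: "ta a b > 0" "tb a b < 0"
    using ta_bounds[OF assms] tb_bounds[OF assms] by linarith+
  have "lam a b > 0" using lam_bounds[of a b] by linarith
  with 1 show "xa a b > 0" "xb a b > 0"
    unfolding xa_eq[OF assms] xb_eq[OF assms] by (auto simp: mult_less_0_iff)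
qed

lemma t_increasing:
  assumes "\<bar>a1 - b1\<bar> < h" "\<bar>a2 - b2\<bar> < h" "a1 \<le> a2" "b2 \<le> b1" "a1 < a2 \<or> b2 < b1"
  shows "t a1 b1 < t a2 b2"
proof (rule segment_increasing[OF t_deriv assms(1,2)])
  fix a b assume "\<bar>a - b\<bar> < h"
  note n = pos_neg[OF this]
  have "0 \<le> ta a b * (a2 - a1)" "0 \<le> tb a b * (b2 - b1)"
    using n assms(3,4) by (auto intro: mult_nonneg_nonneg mult_nonpos_nonpos)
  moreover have "0 < ta a b * (a2 - a1) \<or> 0 < tb a b * (b2 - b1)"
    using n assms(5) by (auto intro: mult_pos_pos mult_neg_neg)
  ultimately show "0 < ta a b * (a2 - a1) + tb a b * (b2 - b1)" by linarith
qed

lemma x_increasing: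
  assumes "\<bar>a1 - b1\<bar> < h" "\<bar>a2 - b2\<bar> < h" "a1 < a2" "b1 < b2"
  shows "x a1 b1 < x a2 b2"
proof (rule segment_increasing[OF x_deriv assms(1,2)])
  fix a b assume "\<bar>a - b\<bar> < h"
  from pos_neg[OF this] show "0 < xa a b * (a2 - a1) + xb a b * (b2 - b1)"
    using assms(3-4) by (auto intro: add_pos_pos)
qed

text \<open>If \<open>a\<close> does not decrease and \<open>b\<close> does not increase,
  \<open>t\<close> grows strictly between distinct points; if both increase, \<open>x\<close> does.
  These cases, up to exchanging the points, cover every pair. The segments stay in the strip because
  it is convex.\<close>

lemma injective_aux:
  assumes "\<bar>a1 - b1\<bar> < h" "\<bar>a2 - b2\<bar> < h" "t a1 b1 = t a2 b2" "x a1 b1 = x a2 b2" "a1 \<le> a2"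
  shows "a1 = a2 \<and> b1 = b2"
proof (rule ccontr)
  assume neq: "\<not> (a1 = a2 \<and> b1 = b2)"
  show False
  proof (cases "b2 \<le> b1")
    case True
    then show False using t_increasing[OF assms(1,2,5)] neq assms by auto
  next
    case False
    show False
    proof (cases "a1 = a2")
      case True
      then show False using t_increasing[OF assms(2,1)] False assms by auto
    next
      case a: False
      then show False using x_increasing[OF assms(1,2)] False assms by auto
    qed
  qed
qed

lemma \<Phi>_inj: "inj_on \<Phi> S"
proof (rule inj_onI)
  fix p q assume "p \<in> S" "q \<in> S" "\<Phi> p = \<Phi> q"
  then have "fst p = fst q \<and> snd p = snd q"
    using injective_aux[of "fst p" "snd p" "fst q" "snd q"] injective_aux[of "fst q" "snd q" "fst p" "snd p"]
    by (cases "fst p \<le> fst q") (auto simp: \<Phi>_def S_def)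
  then show "p = q" by (simp add: prod_eq_iff)
qed

lemma t_rate_b:
  assumes "\<bar>a - b\<bar> < h" "\<bar>a - b'\<bar> < h" "b \<le> b'"
  shows "(b' - b) / 8 \<le> t a b - t a b'"
proof -
  have "- t a b - 1 / 8 * b \<le> - t a b' - 1 / 8 * b'"
  proof (rule DERIV_nonneg_imp_nondecreasing[OF assms(3)])
    fix z assume "b \<le> z" "z \<le> b'"
    then have "\<bar>a - z\<bar> < h" using assms by linarith
    then show "\<exists>y. ((\<lambda>b. - t a b - 1 / 8 * b) has_real_derivative y) (at z) \<and> y \<ge> 0"
      by (intro exI[of _ "- tb a z - 1 / 8"]) (use tb_bounds[of a z] in \<open>auto intro!: derivative_eq_intros t_b\<close>)
  qed
  then show ?thesis by (simp add: field_simps)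
qed

lemma t_rate_a:
  assumes "\<bar>a - b\<bar> < h" "\<bar>a' - b\<bar> < h" "a \<le> a'"
  shows "t a' b - t a b \<le> 2 * (a' - a)"
proof -
  have "2 * a - t a b \<le> 2 * a' - t a' b"
  proof (rule DERIV_nonneg_imp_nondecreasing[OF assms(3)])
    fix z assume "a \<le> z" "z \<le> a'"
    then have "\<bar>z - b\<bar> < h" using assms by linarith
    from ta_bounds[OF this] show "\<exists>y. ((\<lambda>a. 2 * a - t a b) has_real_derivative y) (at z) \<and> y \<ge> 0"
      by (intro exI[of _ "2 - ta z b"]) (auto intro!: derivative_eq_intros t_a)
  qed
  then show ?thesis by simp
qed

text \<open>From the value 0 on the diagonal, moving \<open>b\<close> by \<open>h / 2\<close>
  changes \<open>t\<close> by at least \<open>h / 16\<close>, since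
  \<open>\<bar>tb\<bar> \<ge> 1 / 8\<close>. This is where the existence time \<open>h / 16\<close>
  comes from.\<close>

lemma level_exists:
  assumes "\<bar>s\<bar> < h / 16"
  shows "\<exists>b. \<bar>a - b\<bar> \<le> h / 2 \<and> t a b = s"
proof -
  have "(a - (a - h / 2)) / 8 \<le> t a (a - h / 2) - t a a" "((a + h / 2) - a) / 8 \<le> t a a - t a (a + h / 2)"
    using h by (intro t_rate_b; simp)+
  then have 1: "s \<le> t a (a - h / 2)" "t a (a + h / 2) \<le> s"
    using assms by (auto simp: t_diag)
  have "\<exists>b. a - h / 2 \<le> b \<and> b \<le> a + h / 2 \<and> t a b = s"
    by (rule IVT2[of "t a", OF 1(2,1)]) (use h DERIV_isCont[OF t_b] in auto)
  then obtain b where b: "a - h / 2 \<le> b" "b \<le> a + h / 2" "t a b = s" by blast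
  then have "\<bar>a - b\<bar> \<le> h / 2" unfolding abs_le_iff by linarith
  with b show ?thesis by blast
qed

lemma \<Phi>_surj:
  assumes s: "\<bar>s\<bar> < h / 16"
  shows "\<exists>p\<in>S. \<Phi> p = (s, y)"
proof -
  obtain B where B: "\<And>a. \<bar>a - B a\<bar> \<le> h / 2" "\<And>a. t a (B a) = s"
    using level_exists[OF s] by metis
  have B': "\<bar>a - B a\<bar> < h" for a using B(1)[of a] h by linarith
  \<comment> \<open>The constant 16 is the ratio of the upper bound 2 for \<open>ta\<close> to the
    lower bound 1/8 for \<open>- tb\<close>. The level curve is monotone: both terms of the change
    of \<open>t\<close> would be positive if \<open>B\<close> decreased.\<close>
  have lip: "\<bar>B a' - B a\<bar> \<le> 16 * \<bar>a' - a\<bar>" if "\<bar>a' - a\<bar> < h / 2" "a \<le> a'" for a a'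
  proof -
    have n: "\<bar>a - B a'\<bar> < h" "\<bar>a' - B a\<bar> < h" using that B(1)[of a] B(1)[of a'] by linarith+
    show ?thesis
    proof (cases "B a \<le> B a'")
      case True
      have "(B a' - B a) / 8 \<le> t a' (B a) - t a' (B a')" by (rule t_rate_b[OF n(2) B' True])
      also have "\<dots> \<le> 2 * (a' - a)" using t_rate_a[OF B' n(2) that(2)] B(2) by simp
      finally show ?thesis using True that by simp
    next
      case False
      have "t a (B a) < t a' (B a')"
        using t_increasing[OF B' B' that(2)] False by auto
      then show ?thesis using B(2) by simp
    qed
  qed
  have Bcont: "isCont B a" for a
    unfolding isCont_def LIM_def
  proof (intro allI impI)
    fix e :: real assume "e > 0"
    show "\<exists>d>0. \<forall>a'. a' \<noteq> a \<and> dist a' a < d \<longrightarrow> dist (B a') (B a) < e"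
    proof (intro exI[of _ "min (h / 2) (e / 16)"] conjI allI impI)
      fix a' assume a': "a' \<noteq> a \<and> dist a' a < min (h / 2) (e / 16)"
      then have "\<bar>a' - a\<bar> < h / 2" "16 * \<bar>a' - a\<bar> < e" by (auto simp: dist_real_def)
      then show "dist (B a') (B a) < e"
        using lip[of a' a] lip[of a a'] by (cases "a \<le> a'") (auto simp: dist_real_def abs_minus_commute)
    qed (use h \<open>e > 0\<close> in auto)
  qed
  \<comment> \<open>On the level curve \<open>x\<close> stays within \<open>2 * h\<close> of
    \<open>a\<close>, because \<open>\<bar>xb\<bar> \<le> 4\<close> over a length
    \<open>h / 2\<close>; so \<open>x\<close> takes every value along it.\<close>
  have x_close: "\<bar>x a (B a) - a\<bar> \<le> 2 * h" for a
  proof -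
    have "norm (x a (B a) - x a a) \<le> 4 * norm (B a - a)"
    proof (rule field_differentiable_bound[of "closed_segment a (B a)" "x a" "xb a"])
      fix z assume "z \<in> closed_segment a (B a)"
      then have "\<bar>a - z\<bar> < h" using B'[of a] by (auto simp: closed_segment_eq_real_ivl split: if_splits)
      then have "\<bar>xb a z\<bar> = \<bar>lam a z\<bar> * \<bar>tb a z\<bar>" "\<bar>tb a z\<bar> \<le> 2"
        using xb_eq[of a z] tb_bounds[of a z] by (auto simp: abs_mult)
      moreover have "\<bar>lam a z\<bar> * \<bar>tb a z\<bar> \<le> 2 * 2"
        using lam_bounds[of a z] \<open>\<bar>tb a z\<bar> \<le> 2\<close> by (intro mult_mono) auto
      ultimately show "norm (xb a z) \<le> 4" by simp
      show "(x a has_real_derivative xb a z) (at z within closed_segment a (B a))"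
        by (rule has_field_derivative_at_within[OF x_b])
    qed auto
    then have "\<bar>x a (B a) - a\<bar> \<le> 4 * \<bar>B a - a\<bar>" by (simp add: x_diag)
    also have "\<dots> \<le> 4 * (h / 2)" using B(1)[of a] by (intro mult_left_mono) (simp_all add: abs_minus_commute)
    finally show ?thesis by simp
  qed
  have "continuous_on UNIV (\<lambda>a. x a (B a))"
    by (rule continuous_on_plane_comp[OF x_cont]) (auto intro: continuous_at_imp_continuous_on Bcont)
  then have "\<exists>a. y - 2 * h \<le> a \<and> a \<le> y + 2 * h \<and> x a (B a) = y"
    using x_close[of "y - 2 * h"] x_close[of "y + 2 * h"] h
    by (intro IVT') (auto intro: continuous_on_subset)
  then obtain a where "x a (B a) = y" by blast
  then show ?thesis
    using B B' by (intro bexI[of _ "(a, B a)"]) (auto simp: \<Phi>_def S_def)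
qed

definition "\<Psi> = inv_into S \<Phi>"

lemma \<Psi>:
  assumes "\<bar>s\<bar> < h / 16"
  shows "\<Psi> (s, y) \<in> S" "\<Phi> (\<Psi> (s, y)) = (s, y)"
proof -
  have "(s, y) \<in> \<Phi> ` S" using \<Phi>_surj[OF assms, of y] by force
  then show "\<Psi> (s, y) \<in> S" "\<Phi> (\<Psi> (s, y)) = (s, y)"
    unfolding \<Psi>_def by (simp_all add: inv_into_into f_inv_into_f)
qed

text \<open>Because \<open>xa = lam * ta\<close> and \<open>xb = - lam * tb\<close>, the Jacobian
  determinant is \<open>- 2 * lam * ta * tb\<close>, nonzero in the strip; the entries are those of
  the inverse matrix.\<close>

lemma \<Psi>_deriv:
  fixes s y :: real
  assumes s: "\<bar>s\<bar> < h / 16"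
  defines "p \<equiv> \<Psi> (s, y)"
  defines "ta' \<equiv> ta (fst p) (snd p)" and "tb' \<equiv> tb (fst p) (snd p)" and "lam' \<equiv> lam (fst p) (snd p)"
  shows "(\<Psi> has_derivative (\<lambda>(\<sigma>, \<upsilon>). (\<sigma> / (2 * ta') + \<upsilon> / (2 * lam' * ta'), \<sigma> / (2 * tb') - \<upsilon> / (2 * lam' * tb')))) (at (s, y))"
proof (rule has_derivative_inverse_strong_x[of S \<Psi> "(s, y)" \<Phi>])
  show "open S" by (rule S_open)
  show "\<Psi> (s, y) \<in> S" by (rule \<Psi>(1)[OF s])
  then have pS: "\<bar>fst p - snd p\<bar> < h" by (simp add: p_def S_def)
  show "continuous_on S \<Phi>" by (rule \<Phi>_cont)
  show "\<Psi> (\<Phi> q) = q" if "q \<in> S" for q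
    unfolding \<Psi>_def by (rule inv_into_f_f[OF \<Phi>_inj that])
  show "(\<Phi> has_derivative (\<lambda>(u, w). (ta' * u + tb' * w, xa (fst p) (snd p) * u + xb (fst p) (snd p) * w))) (at (\<Psi> (s, y)))"
    using \<Phi>_deriv[of "fst p" "snd p"] unfolding ta'_def tb'_def by (simp add: p_def)
  have nz: "ta' \<noteq> 0" "tb' \<noteq> 0" "lam' \<noteq> 0"
    using pos_neg[OF pS] lam_bounds[of "fst p" "snd p"] unfolding ta'_def tb'_def lam'_def by auto
  show "(\<lambda>(u, w). (ta' * u + tb' * w, xa (fst p) (snd p) * u + xb (fst p) (snd p) * w)) \<circ>
      (\<lambda>(\<sigma>, \<upsilon>). (\<sigma> / (2 * ta') + \<upsilon> / (2 * lam' * ta'), \<sigma> / (2 * tb') - \<upsilon> / (2 * lam' * tb'))) = id"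
    unfolding xa_eq[OF pS] xb_eq[OF pS] ta'_def[symmetric] tb'_def[symmetric] lam'_def[symmetric]
    using nz by (auto simp: fun_eq_iff field_simps)
  show "\<Phi> (\<Psi> (s, y)) = (s, y)" by (rule \<Psi>(2)[OF s])
qed

end

lemma oint_FTC:
  assumes "\<And>x. x \<in> closed_segment a b \<Longrightarrow> (F has_real_derivative f x) (at x)"
  shows "oint a b f = F b - F a"
  by (rule oint_eq) (rule has_field_derivative_at_within[OF assms])

section \<open>Time and space as functions of the characteristic coordinates\<close>

locale goursat = speed +
  fixes r s r' s' :: "real \<Rightarrow> real" and D h :: real
  assumes r_deriv: "(r has_real_derivative r' x) (at x)"
    and s_deriv: "(s has_real_derivative s' x) (at x)"
    and r'_cont: "continuous_on UNIV r'" and s'_cont: "continuous_on UNIV s'"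
    and r'_bound: "\<bar>r' x\<bar> \<le> D" and s'_bound: "\<bar>s' x\<bar> \<le> D"
    and h: "h > 0" "h * (K * D) \<le> 1 / 20"
begin

text \<open>The value of \<open>v\<close> where the curve of the first family from \<open>a\<close>
  meets the curve of the second family from \<open>b\<close>. It is determined by the data alone,
  which is what makes the equations for \<open>(t, x)\<close> linear.\<close>

definition "V a b = \<Gamma> ((r a - s b) / 2)"
definition "lam a b = c (V a b)"
definition "lam_a a b = c' (V a b) / lam a b * r' a / 2"
definition "lam_b a b = - (c' (V a b) / lam a b * s' b / 2)"

lemma lam_pos: "lam a b > 0"
  unfolding lam_def by (rule c_pos)

lemma V_has_deriv:
  "((\<lambda>a. V a b) has_real_derivative r' a / (2 * lam a b)) (at a)"
  "(V a has_real_derivative - s' b / (2 * lam a b)) (at b)"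
proof -
  have "((\<lambda>a. (r a - s b) / 2) has_real_derivative r' a / 2) (at a)" "((\<lambda>b. (r a - s b) / 2) has_real_derivative - s' b / 2) (at b)"
    by (auto intro!: derivative_eq_intros r_deriv s_deriv)
  from this[THEN DERIV_chain2[OF \<Gamma>_deriv]]
  show "((\<lambda>a. V a b) has_real_derivative r' a / (2 * lam a b)) (at a)"
    "(V a has_real_derivative - s' b / (2 * lam a b)) (at b)"
    unfolding V_def[abs_def] lam_def by (simp_all add: mult.commute)
qed

lemma lam_has_deriv:
  "((\<lambda>a. lam a b) has_real_derivative lam_a a b) (at a)"
  "(lam a has_real_derivative lam_b a b) (at b)"
  using V_has_deriv[THEN DERIV_chain2[OF c_deriv]]
  unfolding lam_a_def lam_b_def lam_def[abs_def] by (simp_all add: mult_ac)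

lemma r_cont: "continuous_on A r" and s_cont: "continuous_on A s"
  by (meson DERIV_isCont r_deriv s_deriv continuous_at_imp_continuous_on)+

lemma V_cont: "continuous_on UNIV (\<lambda>(a, b). V a b)"
  unfolding V_def split_beta
  by (rule continuous_on_compose2[OF \<Gamma>_cont[of UNIV]])
    (auto intro!: continuous_intros continuous_on_compose2[OF r_cont[of UNIV]] continuous_on_compose2[OF s_cont[of UNIV]])

lemma lam_cont: "continuous_on UNIV (\<lambda>(a, b). lam a b)"
  using continuous_on_compose2[OF c_cont V_cont subset_UNIV] by (simp add: lam_def split_beta)

lemma c'V_cont: "continuous_on UNIV (\<lambda>(a, b). c' (V a b))"
  using continuous_on_compose2[OF c'_cont V_cont subset_UNIV] by (simp add: split_beta)

lemma r'_cont2: "continuous_on A (\<lambda>p. r' (f p))" and s'_cont2: "continuous_on A (\<lambda>p. s' (f p))"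
  if "continuous_on A f"
  using continuous_on_compose2[OF r'_cont that] continuous_on_compose2[OF s'_cont that] by auto

lemma lam_deriv_cont: "continuous_on UNIV (\<lambda>(a, b). lam_a a b)" "continuous_on UNIV (\<lambda>(a, b). lam_b a b)"
proof -
  have nz: "lam (fst p) (snd p) \<noteq> 0" for p using lam_pos[of "fst p" "snd p"] by simp
  show "continuous_on UNIV (\<lambda>(a, b). lam_a a b)" "continuous_on UNIV (\<lambda>(a, b). lam_b a b)"
    using lam_cont c'V_cont nz unfolding lam_a_def lam_b_def split_beta
    by (auto intro!: continuous_intros r'_cont2 s'_cont2)
qed

text \<open>Up to sign the coefficients are \<open>c' * r' / (4 * lam\<^sup>2)\<close> and
  \<open>c' * s' / (4 * lam\<^sup>2)\<close>, and \<open>4 * lam\<^sup>2 \<ge> 1\<close> because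
  \<open>c \<ge> 1 / 2\<close>.\<close>

lemma coefficient_bounds: "\<bar>lam_a a b / (2 * lam a b)\<bar> \<le> K * D" "\<bar>lam_b a b / (2 * lam a b)\<bar> \<le> K * D"
proof -
  have K: "K \<ge> 0" using c'_bound[of 0] by simp
  have q: "\<bar>c' (V a b)\<bar> * \<bar>y\<bar> \<le> K * D" if "\<bar>y\<bar> \<le> D" for y
    using that c'_bound[of "V a b"] K by (intro mult_mono) auto
  have "\<bar>x / (4 * (lam a b)\<^sup>2)\<bar> \<le> \<bar>x\<bar>" for x
  proof -
    have "(1 / 2)\<^sup>2 \<le> (lam a b)\<^sup>2" using c_lower[of "V a b"] unfolding lam_def by (intro power_mono) auto
    then have "1 \<le> 4 * (lam a b)\<^sup>2" by (simp add: power2_eq_square)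
    then have "\<bar>x\<bar> / (4 * (lam a b)\<^sup>2) \<le> \<bar>x\<bar> / 1" by (intro divide_left_mono) auto
    then show ?thesis by (simp add: abs_mult)
  qed
  note this[of "c' (V a b) * r' a"] this[of "- c' (V a b) * s' b"]
  moreover have "lam_a a b / (2 * lam a b) = c' (V a b) * r' a / (4 * (lam a b)\<^sup>2)"
    "lam_b a b / (2 * lam a b) = - c' (V a b) * s' b / (4 * (lam a b)\<^sup>2)"
    using lam_pos[of a b] unfolding lam_a_def lam_b_def by (simp_all add: power2_eq_square field_simps)
  ultimately show "\<bar>lam_a a b / (2 * lam a b)\<bar> \<le> K * D" "\<bar>lam_b a b / (2 * lam a b)\<bar> \<le> K * D"
    using q[OF r'_bound[of a]] q[OF s'_bound[of b]] by (simp_all add: abs_mult)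
qed

text \<open>With \<open>E = - \<partial>\<^sub>a \<partial>\<^sub>b t\<close> the equations \<open>x\<^sub>a = lam t\<^sub>a\<close>, \<open>x\<^sub>b = - lam t\<^sub>b\<close> become the linear Goursat
  equation \<open>2 lam E = lam_b t\<^sub>a + lam_a t\<^sub>b\<close>.\<close>

lemma char_coords_exist:
  obtains t x ta tb xa xb where "char_coords t x ta tb xa xb lam h"
    "continuous_on UNIV (\<lambda>(a, b). ta a b)"
proof -
  \<comment> \<open>On the diagonal \<open>t = 0\<close> and \<open>x = a\<close>, so
    \<open>t_a + t_b = 0\<close> and \<open>x_a + x_b = lam * (t_a - t_b) = 1\<close>; hence
    \<open>t_a = 1 / (2 * lam)\<close> there.\<close>
  define P0 where "P0 a = 1 / (2 * lam a a)" for a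
  have P0: "1 / 4 \<le> P0 a" "P0 a \<le> 1" for a
    using c_lower[of "V a a"] c_upper[of "V a a"] unfolding P0_def lam_def by (simp_all add: divide_simps)
  have P0c: "continuous_on UNIV P0"
    unfolding P0_def using lam_pos[THEN less_imp_neq]
    by (auto intro!: continuous_intros continuous_on_plane_comp[OF lam_cont])
  have nz: "lam (fst p) (snd p) \<noteq> 0" for p using lam_pos[of "fst p" "snd p"] by simp
  have n: "continuous_on UNIV (\<lambda>(a, b). lam_b a b / (2 * lam a b))" "continuous_on UNIV (\<lambda>(a, b). lam_a a b / (2 * lam a b))"
    using lam_cont lam_deriv_cont nz unfolding split_beta by (auto intro!: continuous_intros)
  have P0a: "\<bar>P0 a\<bar> \<le> 1" for a using P0[of a] by auto
  obtain E where E: "continuous_on UNIV (\<lambda>(a, b). E a b)"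
    and Eeq: "\<And>a b. \<bar>a - b\<bar> \<le> h \<Longrightarrow>
      E a b = lam_b a b / (2 * lam a b) * (P0 a - oint a b (E a)) + lam_a a b / (2 * lam a b) * (- P0 b - oint b a (\<lambda>s. E s b))"
    and E1: "\<And>a b. \<bar>a - b\<bar> \<le> h \<Longrightarrow> \<bar>oint a b (E a)\<bar> \<le> 1 / 8"
    and E2: "\<And>a b. \<bar>a - b\<bar> \<le> h \<Longrightarrow> \<bar>oint b a (\<lambda>s. E s b)\<bar> \<le> 1 / 8"
    by (rule goursat_fixed_point[OF n(1) coefficient_bounds(2) n(2) coefficient_bounds(1) P0c P0a h]) (rule that; assumption)
  define P where "P a b = P0 a - oint a b (E a)" for a b
  define Q where "Q a b = - P0 b - oint b a (\<lambda>s. E s b)" for a b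
  \<comment> \<open>\<open>P\<close> and \<open>Q\<close> will be \<open>t_a\<close> and
    \<open>t_b\<close>, and \<open>F\<close> is the derivative of \<open>lam * P\<close> in
    \<open>b\<close>. That it is also the derivative of \<open>- lam * Q\<close> in \<open>a\<close>
    is exactly the Goursat equation, available only near the diagonal.\<close>
  define F where "F a b = lam_b a b * P a b - lam a b * E a b" for a b
  have Ea: "continuous_on UNIV (E a)" and Eb: "continuous_on UNIV (\<lambda>s. E s b)" for a b
    using continuous_on_plane_comp[OF E, of UNIV "\<lambda>_. a" "\<lambda>s. s"]
      continuous_on_plane_comp[OF E, of UNIV "\<lambda>s. s" "\<lambda>_. b"] by simp_all
  have Pc: "continuous_on UNIV (\<lambda>(a, b). P a b)" and Qc: "continuous_on UNIV (\<lambda>(a, b). Q a b)"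
    unfolding P_def Q_def split_beta
    by (intro continuous_intros continuous_on_oint_plane[OF E] continuous_on_compose2[OF P0c]; simp)+
  have Fc: "continuous_on UNIV (\<lambda>(a, b). F a b)"
    using Pc E lam_cont lam_deriv_cont unfolding F_def split_beta by (auto intro!: continuous_intros)
  have Pb: "(P a has_real_derivative - E a b) (at b)" and Qa: "((\<lambda>a. Q a b) has_real_derivative - E a b) (at a)" for a b
    unfolding P_def[abs_def] Q_def
    by (auto intro!: derivative_eq_intros oint_has_derivative[OF Ea] oint_has_derivative[OF Eb])
  have PQ: "2 * lam a b * E a b = lam_b a b * P a b + lam_a a b * Q a b" if "\<bar>a - b\<bar> \<le> h" for a b
    unfolding Eeq[OF that] P_def Q_def using lam_pos[of a b] by (simp add: field_simps)
  have mE: "continuous_on UNIV (\<lambda>(a, b). - E a b)"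
    using E unfolding split_beta by (intro continuous_intros)
  have P0m: "continuous_on UNIV (\<lambda>b. - P0 b)" by (intro continuous_intros P0c)
  obtain t where t: "\<And>a b. ((\<lambda>a. t a b) has_real_derivative P0 a + oint a b (\<lambda>s. - E a s)) (at a)"
    "\<And>a b. (t a has_real_derivative - P0 b + oint b a (\<lambda>s. - E s b)) (at b)" "t 0 0 = 0"
    by (rule potential_exists[OF mE P0c P0m, where ?a0.0=0 and ?t0.0=0]) (rule that; assumption)
  have "P0 a + oint a b (\<lambda>s. - E a s) = P a b" "- P0 b + oint b a (\<lambda>s. - E s b) = Q a b" for a b
    by (simp_all add: P_def Q_def oint_def)
  note t' = t(1,2)[unfolded this]
  have half: "continuous_on UNIV (\<lambda>_ :: real. 1 / 2 :: real)" by (rule continuous_on_const)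
  obtain x where x: "\<And>a b. ((\<lambda>a. x a b) has_real_derivative 1 / 2 + oint a b (F a)) (at a)"
    "\<And>a b. (x a has_real_derivative 1 / 2 + oint b a (\<lambda>s. F s b)) (at b)" "x 0 0 = 0"
    by (rule potential_exists[OF Fc half half, where ?a0.0=0 and ?t0.0=0]) (rule that; assumption)
  define xa where "xa a b = 1 / 2 + oint a b (F a)" for a b
  define xb where "xb a b = 1 / 2 + oint b a (\<lambda>s. F s b)" for a b
  note x' = x(1,2)[folded xa_def xb_def]
  have xbc: "continuous_on UNIV (\<lambda>(a, b). xb a b)"
    unfolding xb_def split_beta
    by (intro continuous_intros continuous_on_oint_plane[OF Fc])
  have xa_eq: "xa a b = lam a b * P a b" for a b
  proof -
    have "oint a b (F a) = lam a b * P a b - lam a a * P a a"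
      by (rule oint_FTC) (auto intro!: derivative_eq_intros lam_has_deriv Pb simp: F_def)
    moreover have "lam a a * P a a = 1 / 2"
      using lam_pos[of a a] by (simp add: P_def P0_def)
    ultimately show ?thesis by (simp add: xa_def)
  qed
  have xb_eq: "xb a b = - lam a b * Q a b" if "\<bar>a - b\<bar> < h" for a b
  proof -
    have "oint b a (\<lambda>s. F s b) = - lam a b * Q a b - (- lam b b * Q b b)"
    proof (rule oint_FTC[where F="\<lambda>a. - lam a b * Q a b"])
      fix z assume "z \<in> closed_segment b a"
      then have "\<bar>z - b\<bar> \<le> h" using that by (auto simp: closed_segment_eq_real_ivl split: if_splits)
      from PQ[OF this] have "F z b = - lam_a z b * Q z b + lam z b * E z b"
        by (simp add: F_def algebra_simps)
      then show "((\<lambda>a. - lam a b * Q a b) has_real_derivative F z b) (at z)"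
        by (auto intro!: derivative_eq_intros lam_has_deriv Qa simp: algebra_simps)
    qed
    moreover have "lam b b * Q b b = - 1 / 2"
      using lam_pos[of b b] by (simp add: Q_def P0_def)
    ultimately show ?thesis by (simp add: xb_def)
  qed
  have t_diag: "t a a = 0" for a
  proof -
    have "((\<lambda>a. t a a) has_real_derivative 0) (at a within UNIV)" for a
      using diagonal_deriv[OF t' Qc, of a] by (simp add: P_def Q_def)
    from has_field_derivative_zero_constant[OF convex_UNIV this] obtain k where "\<And>a. t a a = k" by auto
    then show ?thesis using t(3) by metis
  qed
  have x_diag: "x a a = a" for a
  proof -
    have "((\<lambda>a. x a a - a) has_real_derivative 0) (at a within UNIV)" for a
      using diagonal_deriv[OF x' xbc, of a] by (auto intro!: derivative_eq_intros simp: xa_def xb_def)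
    from has_field_derivative_zero_constant[OF convex_UNIV this] obtain k where k: "\<And>a. x a a - a = k" by auto
    from k[of 0] k[of a] show ?thesis using x(3) by simp
  qed
  show ?thesis
  proof (rule that)
    show "char_coords t x P Q xa xb lam h"
    proof
      show "h > 0" by (rule h)
      show "1 / 2 \<le> lam a b \<and> lam a b \<le> 2" for a b
        unfolding lam_def using c_lower c_upper by blast
      \<comment> \<open>The lower bound is 1/4 from \<open>P0\<close> minus 1/8 from the
        integral.\<close>
      show "1 / 8 \<le> P a b \<and> P a b \<le> 2" if "\<bar>a - b\<bar> < h" for a b
        using E1[OF less_imp_le[OF that]] P0[of a] unfolding P_def abs_le_iff by linarith
      show "1 / 8 \<le> - Q a b \<and> - Q a b \<le> 2" if "\<bar>a - b\<bar> < h" for a b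
        using E2[OF less_imp_le[OF that]] P0[of b] unfolding Q_def abs_le_iff by linarith
      show "xa a b = lam a b * P a b" for a b by (rule xa_eq)
      show "xb a b = - lam a b * Q a b" if "\<bar>a - b\<bar> < h" for a b by (rule xb_eq[OF that])
    qed (fact t' x' Qc xbc t_diag x_diag)+
    show "continuous_on UNIV (\<lambda>(a, b). P a b)" by (rule Pc)
  qed
qed

end

lemma has_derivative_partial:
  fixes f :: "real \<times> real \<Rightarrow> real"
  assumes "(f has_derivative (\<lambda>(u, w). A u w)) (at (a, b))"
  shows "((\<lambda>t. f (t, b)) has_real_derivative A 1 0) (at a)" "((\<lambda>y. f (a, y)) has_real_derivative A 0 1) (at b)"
proof -
  have lin: "bounded_linear (\<lambda>(u, w). A u w)" using assms by (rule has_derivative_bounded_linear)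
  have s: "A u 0 = u * A 1 0" "A 0 u = u * A 0 1" for u
    using linear_cmul[OF bounded_linear.linear[OF lin], of u "(1, 0)"]
      linear_cmul[OF bounded_linear.linear[OF lin], of u "(0, 1)"] by simp_all
  have "((\<lambda>t. (t, b)) has_derivative (\<lambda>u. (u, 0))) (at a)" "((\<lambda>y. (a, y)) has_derivative (\<lambda>u. (0, u))) (at b)"
    by (auto intro!: derivative_eq_intros)
  note d = diff_chain_at[OF this(1) assms] diff_chain_at[OF this(2) assms]
  have s': "A u 0 = A 1 0 * u" "A 0 u = A 0 1 * u" for u
    using s[of u] by (metis mult.commute)+
  show "((\<lambda>t. f (t, b)) has_real_derivative A 1 0) (at a)"
    unfolding has_field_derivative_def
    by (rule has_derivative_eq_rhs[OF d(1)[unfolded o_def]], rule ext, unfold prod.case, rule s')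
  show "((\<lambda>y. f (a, y)) has_real_derivative A 0 1) (at b)"
    unfolding has_field_derivative_def
    by (rule has_derivative_eq_rhs[OF d(2)[unfolded o_def]], rule ext, unfold prod.case, rule s')
qed

section \<open>Return to time and space, and local existence\<close>

context speed
begin

text \<open>The invariants at \<open>(t, x)\<close> are \<open>r\<close> and \<open>s\<close>
  evaluated at the feet \<open>\<alpha>\<close> and \<open>\<beta>\<close> of the two
  characteristics. Differentiating the inverse coordinate map turns this into the first-order
  system.\<close>

lemma goursat_solution:
  assumes "goursat c c' G K r s r' s' D h"
  shows "\<exists>v w vx wx. psystem c (h / 16) v w vx wx \<and>
    (\<forall>x. v 0 x = \<Gamma> ((r x - s x) / 2)) \<and> (\<forall>x. w 0 x = (r x + s x) / 2) \<and>
    (\<forall>t\<in>{0..<h / 16}. \<forall>x. \<bar>vx t x\<bar> \<le> 16 * D \<and> \<bar>wx t x\<bar> \<le> 16 * D)"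
proof -
  interpret goursat c c' G K r s r' s' D h by (rule assms)
  obtain t x ta tb xa xb where cc: "char_coords t x ta tb xa xb lam h"
    and ta_cont: "continuous_on UNIV (\<lambda>(a, b). ta a b)"
    by (rule char_coords_exist)
  interpret cc: char_coords t x ta tb xa xb lam h by (rule cc)
  define \<alpha> where "\<alpha> t y = fst (cc.\<Psi> (t, y))" for t y
  define \<beta> where "\<beta> t y = snd (cc.\<Psi> (t, y))" for t y
  \<comment> \<open>A two-sided time interval, so that time 0 is an interior point for the inverse
    map.\<close>
  let ?J = "{- (h / 16)<..<h / 16}"
  have \<alpha>\<beta>: "\<bar>\<alpha> \<tau> y - \<beta> \<tau> y\<bar> < h" if "\<tau> \<in> ?J" for \<tau> y
    using cc.\<Psi>(1)[of \<tau> y] that by (auto simp: \<alpha>_def \<beta>_def cc.S_def)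
  define A where "A \<tau> y = ta (\<alpha> \<tau> y) (\<beta> \<tau> y)" for \<tau> y
  define B where "B \<tau> y = tb (\<alpha> \<tau> y) (\<beta> \<tau> y)" for \<tau> y
  define L where "L \<tau> y = lam (\<alpha> \<tau> y) (\<beta> \<tau> y)" for \<tau> y
  have \<Psi>d: "(cc.\<Psi> has_derivative (\<lambda>(\<sigma>, \<upsilon>). (\<sigma> / (2 * A \<tau> y) + \<upsilon> / (2 * L \<tau> y * A \<tau> y),
      \<sigma> / (2 * B \<tau> y) - \<upsilon> / (2 * L \<tau> y * B \<tau> y)))) (at (\<tau>, y))" if "\<tau> \<in> ?J" for \<tau> y
    using cc.\<Psi>_deriv[of \<tau> y] that unfolding A_def B_def L_def \<alpha>_def \<beta>_def by auto
  have \<alpha>d: "((\<lambda>p. fst (cc.\<Psi> p)) has_derivative (\<lambda>(\<sigma>, \<upsilon>). \<sigma> / (2 * A \<tau> y) + \<upsilon> / (2 * L \<tau> y * A \<tau> y))) (at (\<tau>, y))"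
    and \<beta>d: "((\<lambda>p. snd (cc.\<Psi> p)) has_derivative (\<lambda>(\<sigma>, \<upsilon>). \<sigma> / (2 * B \<tau> y) - \<upsilon> / (2 * L \<tau> y * B \<tau> y))) (at (\<tau>, y))"
    if "\<tau> \<in> ?J" for \<tau> y
    using has_derivative_fst[OF \<Psi>d[OF that]] has_derivative_snd[OF \<Psi>d[OF that]] by (simp_all add: case_prod_unfold)
  have \<alpha>t: "((\<lambda>\<tau>. \<alpha> \<tau> y) has_real_derivative 1 / (2 * A \<tau> y)) (at \<tau>)"
    and \<alpha>y: "(\<alpha> \<tau> has_real_derivative 1 / (2 * L \<tau> y * A \<tau> y)) (at y)"
    and \<beta>t: "((\<lambda>\<tau>. \<beta> \<tau> y) has_real_derivative 1 / (2 * B \<tau> y)) (at \<tau>)"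
    and \<beta>y: "(\<beta> \<tau> has_real_derivative - 1 / (2 * L \<tau> y * B \<tau> y)) (at y)" if "\<tau> \<in> ?J" for \<tau> y
    using has_derivative_partial[OF \<alpha>d[OF that]] has_derivative_partial[OF \<beta>d[OF that]]
    unfolding \<alpha>_def[abs_def] \<beta>_def[abs_def] by simp_all
  have \<Psi>c: "continuous_on (?J \<times> UNIV) cc.\<Psi>"
  proof (rule has_derivative_continuous_on)
    fix p :: "real \<times> real" assume "p \<in> ?J \<times> UNIV"
    then have "fst p \<in> ?J" by auto
    from has_derivative_at_withinI[OF \<Psi>d[OF this, of "snd p"]]
    show "(cc.\<Psi> has_derivative (\<lambda>(\<sigma>, \<upsilon>). (\<sigma> / (2 * A (fst p) (snd p)) + \<upsilon> / (2 * L (fst p) (snd p) * A (fst p) (snd p)),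
      \<sigma> / (2 * B (fst p) (snd p)) - \<upsilon> / (2 * L (fst p) (snd p) * B (fst p) (snd p))))) (at p within ?J \<times> UNIV)"
      unfolding prod.collapse .
  qed
  have \<alpha>c: "continuous_on (?J \<times> UNIV) (\<lambda>p. \<alpha> (fst p) (snd p))"
    and \<beta>c: "continuous_on (?J \<times> UNIV) (\<lambda>p. \<beta> (fst p) (snd p))"
    unfolding \<alpha>_def \<beta>_def using \<Psi>c by (auto intro!: continuous_intros)
  have comp: "continuous_on (?J \<times> UNIV) (\<lambda>p. f (\<alpha> (fst p) (snd p)) (\<beta> (fst p) (snd p)))"
    if "continuous_on UNIV (\<lambda>(a, b). f a b)" for f :: "real \<Rightarrow> real \<Rightarrow> real"
    by (rule continuous_on_plane_comp[OF that \<alpha>c \<beta>c])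
  have Ac: "continuous_on (?J \<times> UNIV) (\<lambda>p. A (fst p) (snd p))" unfolding A_def by (rule comp[OF ta_cont])
  have Bc: "continuous_on (?J \<times> UNIV) (\<lambda>p. B (fst p) (snd p))" unfolding B_def by (rule comp[OF cc.tb_cont])
  have Lc: "continuous_on (?J \<times> UNIV) (\<lambda>p. L (fst p) (snd p))" unfolding L_def by (rule comp[OF lam_cont])
  have r'c: "continuous_on (?J \<times> UNIV) (\<lambda>p. r' (\<alpha> (fst p) (snd p)))"
    and s'c: "continuous_on (?J \<times> UNIV) (\<lambda>p. s' (\<beta> (fst p) (snd p)))"
    by (rule r'_cont2[OF \<alpha>c], rule s'_cont2[OF \<beta>c])
  have Lb: "1 / 2 \<le> L \<tau> y" "L \<tau> y \<le> 2" for \<tau> y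
    using cc.lam_bounds unfolding L_def by auto
  have Ab: "1 / 8 \<le> A \<tau> y" and Bb: "B \<tau> y \<le> - 1 / 8" if "\<tau> \<in> ?J" for \<tau> y
    using cc.ta_bounds[OF \<alpha>\<beta>[OF that, of y]] cc.tb_bounds[OF \<alpha>\<beta>[OF that, of y]] unfolding A_def B_def by auto
  have nz: "A \<tau> y \<noteq> 0" "B \<tau> y \<noteq> 0" "L \<tau> y \<noteq> 0" if "\<tau> \<in> ?J" for \<tau> y
    using Ab[OF that, of y] Bb[OF that, of y] Lb(1)[of \<tau> y] by auto
  define v where "v \<tau> y = \<Gamma> ((r (\<alpha> \<tau> y) - s (\<beta> \<tau> y)) / 2)" for \<tau> y
  define w where "w \<tau> y = (r (\<alpha> \<tau> y) + s (\<beta> \<tau> y)) / 2" for \<tau> y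
  \<comment> \<open>\<open>rx\<close> and \<open>sx\<close> are the chain rule for
    \<open>r (\<alpha> \<tau> y)\<close> and \<open>s (\<beta> \<tau> y)\<close> in
    \<open>y\<close>; \<open>vx\<close> and \<open>wx\<close> come from solving
    \<open>w_x \<plusminus> c * v_x = r_x, s_x\<close>.\<close>
  define rx where "rx \<tau> y = r' (\<alpha> \<tau> y) / (2 * L \<tau> y * A \<tau> y)" for \<tau> y
  define sx where "sx \<tau> y = - s' (\<beta> \<tau> y) / (2 * L \<tau> y * B \<tau> y)" for \<tau> y
  define vx where "vx \<tau> y = (rx \<tau> y - sx \<tau> y) / (2 * L \<tau> y)" for \<tau> y
  define wx where "wx \<tau> y = (rx \<tau> y + sx \<tau> y) / 2" for \<tau> y
  have Lv: "c (v \<tau> y) = L \<tau> y" for \<tau> y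
    unfolding v_def L_def lam_def V_def ..
  have Gd: "((\<lambda>z. \<Gamma> (f z)) has_real_derivative D / L \<tau> y) (at a)"
    if "(f has_real_derivative D) (at a)" "f a = (r (\<alpha> \<tau> y) - s (\<beta> \<tau> y)) / 2" for f D a \<tau> y
    using DERIV_chain2[OF \<Gamma>_deriv that(1)] that(2) Lv[of \<tau> y] unfolding v_def by simp
  have rd: "(r has_real_derivative r' a) (at a)" "(s has_real_derivative s' a) (at a)" for a
    by (rule r_deriv s_deriv)+
  have derivs: "((\<lambda>\<tau>. v \<tau> y) has_real_derivative wx \<tau> y) (at \<tau>)"
    "((\<lambda>\<tau>. w \<tau> y) has_real_derivative (c (v \<tau> y))\<^sup>2 * vx \<tau> y) (at \<tau>)"
    "(v \<tau> has_real_derivative vx \<tau> y) (at y)"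
    "(w \<tau> has_real_derivative wx \<tau> y) (at y)" if \<tau>: "\<tau> \<in> ?J" for \<tau> y
  proof -
    note n = nz[OF \<tau>, of y]
    have rt: "((\<lambda>\<tau>. r (\<alpha> \<tau> y)) has_real_derivative L \<tau> y * rx \<tau> y) (at \<tau>)"
      using DERIV_chain2[OF rd(1) \<alpha>t[OF \<tau>]] n unfolding rx_def by simp
    have st: "((\<lambda>\<tau>. s (\<beta> \<tau> y)) has_real_derivative - (L \<tau> y * sx \<tau> y)) (at \<tau>)"
      using DERIV_chain2[OF rd(2) \<beta>t[OF \<tau>]] n unfolding sx_def by simp
    have ry: "((\<lambda>y. r (\<alpha> \<tau> y)) has_real_derivative rx \<tau> y) (at y)"
      using DERIV_chain2[OF rd(1) \<alpha>y[OF \<tau>]] unfolding rx_def by simp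
    have sy: "((\<lambda>y. s (\<beta> \<tau> y)) has_real_derivative sx \<tau> y) (at y)"
      using DERIV_chain2[OF rd(2) \<beta>y[OF \<tau>]] unfolding sx_def by simp
    have "((\<lambda>\<tau>. v \<tau> y) has_real_derivative ((L \<tau> y * rx \<tau> y - - (L \<tau> y * sx \<tau> y)) / 2) / L \<tau> y) (at \<tau>)"
      unfolding v_def by (rule Gd[OF DERIV_cdivide[OF DERIV_diff[OF rt st]]]) simp
    also have "((L \<tau> y * rx \<tau> y - - (L \<tau> y * sx \<tau> y)) / 2) / L \<tau> y = wx \<tau> y"
      using n unfolding wx_def by (simp add: field_simps)
    finally show "((\<lambda>\<tau>. v \<tau> y) has_real_derivative wx \<tau> y) (at \<tau>)" .
    have "((\<lambda>\<tau>. w \<tau> y) has_real_derivative (L \<tau> y * rx \<tau> y + - (L \<tau> y * sx \<tau> y)) / 2) (at \<tau>)"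
      unfolding w_def by (rule DERIV_cdivide[OF DERIV_add[OF rt st]])
    also have "(L \<tau> y * rx \<tau> y + - (L \<tau> y * sx \<tau> y)) / 2 = (c (v \<tau> y))\<^sup>2 * vx \<tau> y"
      using n unfolding vx_def Lv by (simp add: power2_eq_square field_simps)
    finally show "((\<lambda>\<tau>. w \<tau> y) has_real_derivative (c (v \<tau> y))\<^sup>2 * vx \<tau> y) (at \<tau>)" .
    have "(v \<tau> has_real_derivative ((rx \<tau> y - sx \<tau> y) / 2) / L \<tau> y) (at y)"
      unfolding v_def[abs_def] by (rule Gd[OF DERIV_cdivide[OF DERIV_diff[OF ry sy]]]) simp
    then show "(v \<tau> has_real_derivative vx \<tau> y) (at y)"
      unfolding vx_def by simp
    show "(w \<tau> has_real_derivative wx \<tau> y) (at y)"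
      unfolding w_def[abs_def] wx_def by (rule DERIV_cdivide[OF DERIV_add[OF ry sy]])
  qed
  have sub: "{0..<h / 16} \<subseteq> ?J" using h(1) by auto
  have conts: "continuous_on (?J \<times> UNIV) (\<lambda>(\<tau>, y). vx \<tau> y)" "continuous_on (?J \<times> UNIV) (\<lambda>(\<tau>, y). wx \<tau> y)"
    unfolding vx_def wx_def rx_def sx_def split_beta
    using nz by (auto intro!: continuous_intros Ac Bc Lc r'c s'c)
  have sys: "psystem c (h / 16) v w vx wx"
    unfolding psystem_def
  proof (intro conjI ballI allI)
    fix \<tau> y assume "\<tau> \<in> {0..<h / 16}"
    then have \<tau>: "\<tau> \<in> ?J" using sub by blast
    show "((\<lambda>\<tau>. v \<tau> y) has_real_derivative wx \<tau> y) (at \<tau> within {0..<h / 16})"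
      "((\<lambda>\<tau>. w \<tau> y) has_real_derivative (c (v \<tau> y))\<^sup>2 * vx \<tau> y) (at \<tau> within {0..<h / 16})"
      by (rule has_field_derivative_at_within[OF derivs(1)[OF \<tau>]], rule has_field_derivative_at_within[OF derivs(2)[OF \<tau>]])
    show "(v \<tau> has_real_derivative vx \<tau> y) (at y)" "(w \<tau> has_real_derivative wx \<tau> y) (at y)"
      by (rule derivs(3,4)[OF \<tau>])+
  qed (use sub in \<open>auto intro: continuous_on_subset[OF conts(1)] continuous_on_subset[OF conts(2)]\<close>)
  have D: "D \<ge> 0" using r'_bound[of 0] by linarith
  \<comment> \<open>Each denominator \<open>2 * L * A\<close> and \<open>2 * L * (- B)\<close> is at
    least 1/8, so \<open>rx\<close> and \<open>sx\<close> are at most \<open>8 * D\<close>.\<close>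
  have bounds: "\<bar>vx \<tau> y\<bar> \<le> 16 * D \<and> \<bar>wx \<tau> y\<bar> \<le> 16 * D" if "\<tau> \<in> {0..<h / 16}" for \<tau> y
  proof -
    have \<tau>: "\<tau> \<in> ?J" using that sub by auto
    have LA: "2 * L \<tau> y * A \<tau> y \<ge> 2 * (1 / 2) * (1 / 8)"
      using Lb[of \<tau> y] Ab[OF \<tau>, of y] by (intro mult_mono) auto
    have LB: "2 * L \<tau> y * (- B \<tau> y) \<ge> 2 * (1 / 2) * (1 / 8)"
      using Lb[of \<tau> y] Bb[OF \<tau>, of y] by (intro mult_mono) auto
    have q: "\<bar>a\<bar> / b \<le> 8 * D" if "\<bar>a\<bar> \<le> D" "1 / 8 \<le> b" for a b
    proof -
      have "\<bar>a\<bar> \<le> 8 * D * b" using that D mult_left_mono[of "1 / 8" b "8 * D"] by simp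
      then show ?thesis using that by (simp add: pos_divide_le_eq)
    qed
    have pos: "L \<tau> y > 0" "A \<tau> y > 0" "B \<tau> y < 0"
      using Lb[of \<tau> y] Ab[OF \<tau>, of y] Bb[OF \<tau>, of y] by auto
    have 1: "\<bar>rx \<tau> y\<bar> \<le> 8 * D"
      using q[OF r'_bound[of "\<alpha> \<tau> y"], of "2 * L \<tau> y * A \<tau> y"] LA pos unfolding rx_def abs_divide by (simp add: abs_mult)
    have 2: "\<bar>sx \<tau> y\<bar> \<le> 8 * D"
      using q[OF s'_bound[of "\<beta> \<tau> y"], of "2 * L \<tau> y * (- B \<tau> y)"] LB pos unfolding sx_def abs_divide by (simp add: abs_mult)
    have "\<bar>rx \<tau> y - sx \<tau> y\<bar> \<le> 16 * D" using 1 2 by linarith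
    also have "\<dots> \<le> 16 * D * (2 * L \<tau> y)" using mult_left_mono[of 1 "2 * L \<tau> y" "16 * D"] Lb[of \<tau> y] D by simp
    finally have "\<bar>vx \<tau> y\<bar> \<le> 16 * D"
      unfolding vx_def abs_divide using Lb[of \<tau> y] by (simp add: pos_divide_le_eq)
    moreover have "\<bar>wx \<tau> y\<bar> \<le> 16 * D" unfolding wx_def using 1 2 by simp
    ultimately show ?thesis by simp
  qed
  have init: "\<alpha> 0 y = y" "\<beta> 0 y = y" for y
  proof -
    have "cc.\<Phi> (y, y) = (0, y)" by (simp add: cc.\<Phi>_def cc.t_diag cc.x_diag)
    moreover have "(y, y) \<in> cc.S" using h by (simp add: cc.S_def)
    ultimately have "cc.\<Psi> (0, y) = (y, y)"
      unfolding cc.\<Psi>_def using inv_into_f_f[OF cc.\<Phi>_inj] by metis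
    then show "\<alpha> 0 y = y" "\<beta> 0 y = y" by (simp_all add: \<alpha>_def \<beta>_def)
  qed
  show ?thesis
    by (intro exI[of _ v] exI[of _ w] exI[of _ vx] exI[of _ wx] conjI sys ballI allI bounds)
      (use bounds in \<open>auto simp: v_def w_def init\<close>)
qed

text \<open>The time \<open>\<tau>\<close> is chosen before the data, which is what lets a solution
  be restarted arbitrarily late with the same step. The factor 48 is 16 times 3: the initial
  invariants have slopes up to \<open>3 * N\<close>, because \<open>c \<le> 2\<close>.\<close>

theorem local_existence:
  assumes N: "N \<ge> 0"
  shows "\<exists>\<tau>>0. \<forall>v0 v0' w0 w0'.
    (\<forall>x. (v0 has_real_derivative v0' x) (at x) \<and> \<bar>v0' x\<bar> \<le> N) \<and> continuous_on UNIV v0' \<and>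
    (\<forall>x. (w0 has_real_derivative w0' x) (at x) \<and> \<bar>w0' x\<bar> \<le> N) \<and> continuous_on UNIV w0' \<longrightarrow>
    (\<exists>v w vx wx. psystem c \<tau> v w vx wx \<and> (\<forall>x. v 0 x = v0 x) \<and> (\<forall>x. w 0 x = w0 x) \<and>
      (\<forall>t\<in>{0..<\<tau>}. \<forall>x. \<bar>vx t x\<bar> \<le> 48 * N \<and> \<bar>wx t x\<bar> \<le> 48 * N))"
proof -
  have K: "K \<ge> 0" using c'_bound[of 0] by simp
  \<comment> \<open>The summand 1 keeps the denominator positive when \<open>K * N\<close>
    vanishes.\<close>
  define h where "h = 1 / (20 * (K * (3 * N) + 1))"
  have pos: "K * (3 * N) + 1 > 0" using K N by (simp add: add_nonneg_pos)
  have h: "h > 0" "h * (K * (3 * N)) \<le> 1 / 20"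
    using pos unfolding h_def by (simp_all add: field_simps)
  show ?thesis
  proof (intro exI[of _ "h / 16"] conjI allI impI; (elim conjE)?)
    show "h / 16 > 0" using h by simp
    fix v0 v0' w0 w0'
    assume v0: "\<forall>x. (v0 has_real_derivative v0' x) (at x) \<and> \<bar>v0' x\<bar> \<le> N" "continuous_on UNIV v0'"
      and w0: "\<forall>x. (w0 has_real_derivative w0' x) (at x) \<and> \<bar>w0' x\<bar> \<le> N" "continuous_on UNIV w0'"
    have v0c: "continuous_on UNIV v0"
      by (meson v0 DERIV_isCont continuous_at_imp_continuous_on)
    have cv: "\<bar>c (v0 x) * v0' x\<bar> \<le> 2 * N" for x
      unfolding abs_mult using v0 c_upper c_pos[THEN less_imp_le] N by (intro mult_mono) auto
    interpret g: goursat c c' G K "\<lambda>x. w0 x + G (v0 x)" "\<lambda>x. w0 x - G (v0 x)"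
      "\<lambda>x. w0' x + c (v0 x) * v0' x" "\<lambda>x. w0' x - c (v0 x) * v0' x" "3 * N" h
    proof
      fix x
      show "((\<lambda>x. w0 x + G (v0 x)) has_real_derivative w0' x + c (v0 x) * v0' x) (at x)"
        "((\<lambda>x. w0 x - G (v0 x)) has_real_derivative w0' x - c (v0 x) * v0' x) (at x)"
        using v0 w0 by (auto intro!: derivative_eq_intros DERIV_chain2[OF G_deriv])
      show "\<bar>w0' x + c (v0 x) * v0' x\<bar> \<le> 3 * N" "\<bar>w0' x - c (v0 x) * v0' x\<bar> \<le> 3 * N"
        using w0(1)[rule_format, of x] cv[of x] by linarith+
      show "continuous_on UNIV (\<lambda>x. w0' x + c (v0 x) * v0' x)" "continuous_on UNIV (\<lambda>x. w0' x - c (v0 x) * v0' x)"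
        by (auto intro!: continuous_intros v0 w0 continuous_on_compose2[OF c_cont[of UNIV] v0c])
    qed (use h in auto)
    from goursat_solution[OF g.goursat_axioms]
    show "\<exists>v w vx wx. psystem c (h / 16) v w vx wx \<and> (\<forall>x. v 0 x = v0 x) \<and> (\<forall>x. w 0 x = w0 x) \<and>
      (\<forall>t\<in>{0..<h / 16}. \<forall>x. \<bar>vx t x\<bar> \<le> 48 * N \<and> \<bar>wx t x\<bar> \<le> 48 * N)"
      by simp
  qed
qed

end

section \<open>Classical solutions\<close>

lemma within_Ici_nontrivial: "(t::real) \<ge> 0 \<Longrightarrow> at t within {0..} \<noteq> bot"
proof -
  assume "t \<ge> 0"
  have "t islimpt {t<..<t + 1}" by (rule islimpt_greaterThanLessThan1) simp
  then have "t islimpt {0..}" by (rule islimpt_subset) (use \<open>t \<ge> 0\<close> in auto)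
  then show ?thesis by (simp add: trivial_limit_within)
qed

lemma at_within_strip:
  fixes t T :: real
  assumes "t \<in> {0..<T}"
  shows "at t within {0..<T} = at t within {0..}"
  by (rule at_within_nhd[of _ "{..<T}"]) (use assms in auto)

lemma dt_eqI:
  assumes "((\<lambda>s. f s x) has_real_derivative D) (at t within {0..<T})" "t \<in> {0..<T}"
  shows "dt f t x = D"
  using assms within_Ici_nontrivial[of t]
  by (auto simp: dt_def deriv_on_def at_within_strip has_real_derivative_iff_has_vector_derivative
      intro: vector_derivative_within)

lemma dx_eqI:
  assumes "(f t has_real_derivative D) (at x)"
  shows "dx f t x = D"
  unfolding dx_def by (rule DERIV_imp_deriv[OF assms])

lemma C1_stripD:
  assumes "C1_strip T f" "t \<in> {0..<T}"
  shows "((\<lambda>s. f s x) has_real_derivative dt f t x) (at t within {0..<T})"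
    and "(f t has_real_derivative dx f t x) (at x)"
proof -
  have "(\<lambda>s. f s x) differentiable (at t within {0..})" "f t differentiable (at x)"
    using assms unfolding C1_strip_def by auto
  then show "((\<lambda>s. f s x) has_real_derivative dt f t x) (at t within {0..<T})"
    "(f t has_real_derivative dx f t x) (at x)"
    unfolding dt_def deriv_on_def at_within_strip[OF assms(2)] dx_def
    by (auto simp: has_real_derivative_iff_has_vector_derivative vector_derivative_works[symmetric]
       DERIV_deriv_iff_real_differentiable[symmetric, unfolded has_real_derivative_iff_has_vector_derivative])
qed

lemma C1_stripI:
  assumes d: "\<And>t x. t \<in> {0..<T} \<Longrightarrow> ((\<lambda>s. f s x) has_real_derivative f1 t x) (at t within {0..<T})"
    "\<And>t x. t \<in> {0..<T} \<Longrightarrow> (f t has_real_derivative f2 t x) (at x)"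
    and c: "continuous_on ({0..<T} \<times> UNIV) (\<lambda>(t, x). f1 t x)" "continuous_on ({0..<T} \<times> UNIV) (\<lambda>(t, x). f2 t x)"
  shows "C1_strip T f"
proof -
  have e: "dt f t x = f1 t x" "dx f t x = f2 t x" if "t \<in> {0..<T}" for t x
    using dt_eqI[OF d(1) that] dx_eqI[OF d(2)] that by auto
  have "continuous_on ({0..<T} \<times> UNIV) (\<lambda>(t, x). dt f t x)" "continuous_on ({0..<T} \<times> UNIV) (\<lambda>(t, x). dx f t x)"
    using c by (auto intro: continuous_on_eq simp: e)
  moreover have "(\<lambda>s. f s x) differentiable (at t within {0..}) \<and> f t differentiable (at x)" if "t \<in> {0..<T}" for t x
    using d[OF that, of x] unfolding at_within_strip[OF that]
    unfolding differentiable_def has_field_derivative_def by blast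
  ultimately show ?thesis unfolding C1_strip_def by blast
qed

text \<open>Near \<open>t\<close> only values of \<open>g\<close> up to some \<open>T' < T\<close>
  matter, so \<open>g\<close> may be continued beyond \<open>T'\<close> by a constant.\<close>

lemma oint_deriv_within:
  assumes g: "continuous_on {0..<T} g" and t: "t \<in> {0..<T}"
  shows "((\<lambda>t. oint 0 t g) has_real_derivative g t) (at t within {0..<T})"
proof -
  define T' where "T' = (t + T) / 2"
  have T': "t < T'" "T' < T" using t by (auto simp: T'_def)
  define cl where "cl s = max 0 (min T' s)" for s
  have cl: "cl s \<in> {0..<T}" "s \<in> {0..T'} \<Longrightarrow> cl s = s" for s
    using T' t by (auto simp: cl_def)
  have cont: "continuous_on UNIV (\<lambda>s. g (cl s))"
    by (rule continuous_on_compose2[OF g]) (use cl in \<open>auto simp: cl_def intro!: continuous_intros\<close>)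
  have eq: "oint 0 s (\<lambda>s. g (cl s)) = oint 0 s g" if "s \<in> {0..T'}" for s
  proof -
    have "cl (0 + \<theta> * (s - 0)) = 0 + \<theta> * (s - 0)" if "\<theta> \<in> {0..1}" for \<theta>
      using that \<open>s \<in> {0..T'}\<close> mult_left_le_one_le[of s \<theta>] by (intro cl(2)) auto
    then show ?thesis unfolding oint_def by (intro arg_cong2[where f="(*)"] integral_cong refl) auto
  qed
  have "((\<lambda>t. oint 0 t (\<lambda>s. g (cl s))) has_real_derivative g (cl t)) (at t within {0..<T})"
    by (rule has_field_derivative_at_within[OF oint_has_derivative[OF cont]])
  then have "((\<lambda>t. oint 0 t (\<lambda>s. g (cl s))) has_real_derivative g t) (at t within {0..<T})"
    using cl(2)[of t] t T' by simp
  then show ?thesis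
  proof (rule has_field_derivative_transform_within[where d="T' - t"])
    fix s assume "s \<in> {0..<T}" "dist s t < T' - t"
    then have "s \<in> {0..T'}" by (auto simp: dist_real_def)
    then show "oint 0 s (\<lambda>s. g (cl s)) = oint 0 s g" by (rule eq)
  qed (use T' t in auto)
qed

lemma strip_slice:
  assumes "continuous_on ({0..<T} \<times> UNIV) (\<lambda>(t, x). f t x)" "A \<subseteq> {0..<T}"
  shows "continuous_on A (\<lambda>t. f t x)"
  by (rule continuous_on_compose2[OF assms(1), of A "\<lambda>t. (t, x)", unfolded split_beta fst_conv snd_conv])
    (use assms in \<open>auto intro!: continuous_intros\<close>)

lemma strip_slice_x:
  assumes "continuous_on ({0..<T} \<times> UNIV) (\<lambda>(t, x). f t x)" "t \<in> {0..<T}"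
  shows "continuous_on UNIV (f t)"
  by (rule continuous_on_compose2[OF assms(1), of UNIV "\<lambda>x. (t, x)", unfolded split_beta fst_conv snd_conv])
    (use assms in \<open>auto intro!: continuous_intros\<close>)

lemma oint_time_x_deriv:
  assumes wx: "\<And>t x. t \<in> {0..<T} \<Longrightarrow> (w t has_real_derivative wx t x) (at x)"
    and w_cont: "continuous_on ({0..<T} \<times> UNIV) (\<lambda>(t, x). w t x)"
    and wx_cont: "continuous_on ({0..<T} \<times> UNIV) (\<lambda>(t, x). wx t x)" and t: "t \<in> {0..<T}"
  shows "((\<lambda>x. oint 0 t (\<lambda>s. w s x)) has_real_derivative oint 0 t (\<lambda>s. wx s x)) (at x)"
proof (rule oint_leibniz)
  have sub: "closed_segment 0 t \<subseteq> {0..<T}" using t by (auto simp: closed_segment_eq_real_ivl)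
  show "(w s has_real_derivative wx s x) (at x)" if "s \<in> closed_segment 0 t" for s x
    using wx that sub by blast
  show "continuous_on (closed_segment 0 t) (\<lambda>s. w s x)" for x
    by (rule strip_slice[OF w_cont sub])
  show "continuous_on (closed_segment 0 t \<times> UNIV) (\<lambda>(s, x). wx s x)"
    by (rule continuous_on_subset[OF wx_cont]) (use sub in auto)
qed

text \<open>Working form of a classical solution, with the derivatives named as separate functions.
  This suits restriction, change of speed and gluing better than derivative operators do.\<close>

definition c2sol where
  "c2sol c T u v w vx wx \<longleftrightarrow> psystem c T v w vx wx \<and>
     (\<forall>t\<in>{0..<T}. \<forall>x. ((\<lambda>s. u s x) has_real_derivative w t x) (at t within {0..<T}) \<and>
        (u t has_real_derivative v t x) (at x))"

lemma psystem_continuous: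
  assumes "psystem c T v w vx wx"
  shows "continuous_on ({0..<T} \<times> UNIV) (\<lambda>(t, x). v t x)" "continuous_on ({0..<T} \<times> UNIV) (\<lambda>(t, x). w t x)"
  using assms plane_continuous[of "{0..<T}" v wx vx] plane_continuous[of "{0..<T}" w "\<lambda>t x. (c (v t x))\<^sup>2 * vx t x" wx]
  unfolding psystem_def by auto

lemma c2sol_classical:
  assumes sol: "c2sol c T u v w vx wx"
    and cv: "continuous_on ({0..<T} \<times> UNIV) (\<lambda>(t, x). c (v t x))"
    and init: "\<And>x. u 0 x = f x" "\<And>x. w 0 x = g x" "T > 0"
  shows "classical_solution c f g T u"
    and "t \<in> {0..<T} \<Longrightarrow> dt u t x = w t x \<and> dx u t x = v t x \<and>
      dt (dt u) t x = (c (v t x))\<^sup>2 * vx t x \<and> dx (dt u) t x = wx t x \<and> dx (dx u) t x = vx t x"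
proof -
  have s: "psystem c T v w vx wx" using sol by (simp add: c2sol_def)
  note cont = psystem_continuous[OF s]
  have ud: "((\<lambda>s. u s x) has_real_derivative w t x) (at t within {0..<T})" "(u t has_real_derivative v t x) (at x)"
    if "t \<in> {0..<T}" for t x
    using sol that unfolding c2sol_def by auto
  have e1: "dt u t x = w t x" "dx u t x = v t x" if "t \<in> {0..<T}" for t x
    using dt_eqI[of u, OF ud(1)[OF that] that] dx_eqI[of u, OF ud(2)[OF that]] by auto
  have e1': "dt u t = w t" "dx u t = v t" if "t \<in> {0..<T}" for t
    using e1 that by blast+
  have wd: "((\<lambda>s. dt u s x) has_real_derivative (c (v t x))\<^sup>2 * vx t x) (at t within {0..<T})"
    "((\<lambda>s. dx u s x) has_real_derivative wx t x) (at t within {0..<T})"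
    "(dt u t has_real_derivative wx t x) (at x)" "(dx u t has_real_derivative vx t x) (at x)" if t: "t \<in> {0..<T}" for t x
  proof -
    have w: "((\<lambda>s. w s x) has_real_derivative (c (v t x))\<^sup>2 * vx t x) (at t within {0..<T})"
      and v: "((\<lambda>s. v s x) has_real_derivative wx t x) (at t within {0..<T})"
      using s t unfolding psystem_def by auto
    show "((\<lambda>s. dt u s x) has_real_derivative (c (v t x))\<^sup>2 * vx t x) (at t within {0..<T})"
      by (rule has_field_derivative_transform_within[OF w zero_less_one t]) (simp add: e1)
    show "((\<lambda>s. dx u s x) has_real_derivative wx t x) (at t within {0..<T})"
      by (rule has_field_derivative_transform_within[OF v zero_less_one t]) (simp add: e1)
    show "(dt u t has_real_derivative wx t x) (at x)" "(dx u t has_real_derivative vx t x) (at x)"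
      using s t unfolding psystem_def e1'[OF t] by auto
  qed
  have vxc: "continuous_on ({0..<T} \<times> UNIV) (\<lambda>(t, x). vx t x)" "continuous_on ({0..<T} \<times> UNIV) (\<lambda>(t, x). wx t x)"
    using s unfolding psystem_def by auto
  have wtc: "continuous_on ({0..<T} \<times> UNIV) (\<lambda>(t, x). (c (v t x))\<^sup>2 * vx t x)"
    using cv vxc(1) unfolding split_beta by (intro continuous_intros)
  have e2: "dt (dt u) t x = (c (v t x))\<^sup>2 * vx t x" "dx (dt u) t x = wx t x" "dx (dx u) t x = vx t x"
    if "t \<in> {0..<T}" for t x
    using dt_eqI[of "dt u", OF wd(1)[OF that] that] dx_eqI[of "dt u", OF wd(3)[OF that]]
      dx_eqI[of "dx u", OF wd(4)[OF that]] by auto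
  have "C2_strip T u"
    unfolding C2_strip_def
    by (intro conjI C1_stripI[OF ud cont(2,1)] C1_stripI[OF wd(1,3) wtc vxc(2)] C1_stripI[OF wd(2,4) vxc(2,1)])
  then show "classical_solution c f g T u"
    unfolding classical_solution_def using init e2 e1 by auto
  show "t \<in> {0..<T} \<Longrightarrow> dt u t x = w t x \<and> dx u t x = v t x \<and>
      dt (dt u) t x = (c (v t x))\<^sup>2 * vx t x \<and> dx (dt u) t x = wx t x \<and> dx (dx u) t x = vx t x"
    using e1 e2 by auto
qed

text \<open>The content is the symmetry of the mixed second derivatives, which encodes
  \<open>v_t = w_x\<close>.\<close>

lemma classical_c2sol:
  assumes "classical_solution c f g T u"
  shows "c2sol c T u (dx u) (dt u) (dx (dx u)) (dx (dt u))"
proof -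
  have C: "C1_strip T u" "C1_strip T (dt u)" "C1_strip T (dx u)"
    and eq: "\<And>t x. t \<in> {0..<T} \<Longrightarrow> dt (dt u) t x = (c (dx u t x))\<^sup>2 * dx (dx u) t x"
    using assms unfolding classical_solution_def C2_strip_def by auto
  have cont: "continuous_on ({0..<T} \<times> UNIV) (\<lambda>(t, x). dt u t x)"
    "continuous_on ({0..<T} \<times> UNIV) (\<lambda>(t, x). dx (dt u) t x)"
    "continuous_on ({0..<T} \<times> UNIV) (\<lambda>(t, x). dx (dx u) t x)"
    using C unfolding C1_strip_def by auto
  \<comment> \<open>Write \<open>u s y - u 0 y\<close> as the time integral of \<open>u_t\<close>
    and differentiate under the integral in space. This represents \<open>u_x\<close> as a time
    integral of \<open>u_tx\<close> and also covers the one-sided derivative at time 0.\<close>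
  have mixed: "dt (dx u) t x = dx (dt u) t x" if t: "t \<in> {0..<T}" for t x
  proof -
    have rep: "dx u s x = dx u 0 x + oint 0 s (\<lambda>s. dx (dt u) s x)" if s: "s \<in> {0..<T}" for s
    proof -
      have seg: "closed_segment 0 s \<subseteq> {0..<T}" using s by (auto simp: closed_segment_eq_real_ivl)
      have "oint 0 s (\<lambda>r. dt u r y) = u s y - u 0 y" for y
        by (rule oint_eq, rule DERIV_subset[OF C1_stripD(1)[OF C(1)]]) (use seg in auto)
      then have "((\<lambda>y. u s y - u 0 y) has_real_derivative oint 0 s (\<lambda>r. dx (dt u) r x)) (at x)"
        using oint_time_x_deriv[OF C1_stripD(2)[OF C(2)] cont(1,2) s, of x] by simp
      moreover have "((\<lambda>y. u s y - u 0 y) has_real_derivative dx u s x - dx u 0 x) (at x)"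
        by (rule DERIV_diff[OF C1_stripD(2)[OF C(1)] C1_stripD(2)[OF C(1)]]) (use s in auto)
      ultimately show ?thesis using DERIV_unique by fastforce
    qed
    have "((\<lambda>s. dx u 0 x + oint 0 s (\<lambda>s. dx (dt u) s x)) has_real_derivative dx (dt u) t x) (at t within {0..<T})"
      using oint_deriv_within[OF strip_slice[OF cont(2) subset_refl] t, of x]
      by (auto intro!: derivative_eq_intros)
    then have "((\<lambda>s. dx u s x) has_real_derivative dx (dt u) t x) (at t within {0..<T})"
      by (rule has_field_derivative_transform_within[OF _ zero_less_one t]) (simp add: rep[symmetric])
    from dt_eqI[of "dx u", OF this t] show ?thesis .
  qed
  show ?thesis
    unfolding c2sol_def psystem_def
    using C1_stripD[OF C(1)] C1_stripD[OF C(2)] C1_stripD[OF C(3)] cont by (simp add: mixed eq)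
qed

text \<open>Integrating \<open>w\<close> in time recovers \<open>u\<close>; its space derivative is
  \<open>v\<close> because \<open>v_t = w_x\<close>.\<close>

lemma psystem_c2sol:
  assumes s: "psystem c T v w vx wx" and f: "\<And>x. (f has_real_derivative v 0 x) (at x)"
  shows "c2sol c T (\<lambda>t x. f x + oint 0 t (\<lambda>s. w s x)) v w vx wx"
proof -
  note cont = psystem_continuous[OF s]
  have d: "((\<lambda>s. v s x) has_real_derivative wx t x) (at t within {0..<T})" "(w t has_real_derivative wx t x) (at x)"
    if "t \<in> {0..<T}" for t x
    using s that unfolding psystem_def by auto
  have wxc: "continuous_on ({0..<T} \<times> UNIV) (\<lambda>(t, x). wx t x)" using s unfolding psystem_def by auto
  have "((\<lambda>s. f x + oint 0 s (\<lambda>s. w s x)) has_real_derivative w t x) (at t within {0..<T})" if "t \<in> {0..<T}" for t x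
    using oint_deriv_within[OF strip_slice[OF cont(2) subset_refl] that, of x]
    by (auto intro!: derivative_eq_intros)
  moreover have "((\<lambda>x. f x + oint 0 t (\<lambda>s. w s x)) has_real_derivative v t x) (at x)" if t: "t \<in> {0..<T}" for t x
  proof -
    have seg: "closed_segment 0 t \<subseteq> {0..<T}" using t by (auto simp: closed_segment_eq_real_ivl)
    have "oint 0 t (\<lambda>r. wx r x) = v t x - v 0 x"
      by (rule oint_eq, rule DERIV_subset[OF d(1)]) (use seg in auto)
    with DERIV_add[OF f oint_time_x_deriv[OF d(2) cont(2) wxc t], of x] show ?thesis by simp
  qed
  ultimately show ?thesis unfolding c2sol_def using s by simp
qed

section \<open>Essential supremum and pointwise bounds\<close>

lemma Linf_norm_le:
  assumes "continuous_on UNIV f" "\<And>x. \<bar>f x\<bar> \<le> B"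
  shows "Linf_norm f \<le> ereal B"
  unfolding Linf_norm_def
  by (rule esssup_I) (use assms borel_measurable_continuous_onI[OF assms(1)] in auto)

lemma Linf_norm_nonneg: "0 \<le> Linf_norm f"
\<comment> \<open>For a non-measurable function the essential supremum is \<open>\<infinity>\<close>
  by convention.\<close>
proof (cases "(\<lambda>x. ereal \<bar>f x\<bar>) \<in> borel_measurable lborel")
  case True
  have "esssup lborel (\<lambda>x :: real. 0 :: ereal) \<le> Linf_norm f"
    unfolding Linf_norm_def by (rule esssup_mono) auto
  then show ?thesis by (subst (asm) esssup_const) auto
qed (simp add: Linf_norm_def esssup_non_measurable top_ereal_def)

text \<open>The set where the bound fails is open by continuity and null by the norm bound, hence
  empty.\<close>

lemma Linf_norm_bound:
  assumes f: "continuous_on UNIV f" and B: "Linf_norm f \<le> ereal B"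
  shows "\<bar>f x\<bar> \<le> B"
proof (rule ccontr)
  assume "\<not> \<bar>f x\<bar> \<le> B"
  define S where "S = {x. B < \<bar>f x\<bar>}"
  have "open S" unfolding S_def by (intro open_Collect_less continuous_intros f)
  moreover have "x \<in> S" using \<open>\<not> \<bar>f x\<bar> \<le> B\<close> by (simp add: S_def)
  ultimately have "\<not> negligible S" using open_not_negligible by blast
  moreover have "AE x in lborel. ereal \<bar>f x\<bar> \<le> Linf_norm f"
    unfolding Linf_norm_def by (rule esssup_AE)
  then have "AE x in lborel. x \<notin> S"
    using B by (auto simp: S_def elim!: eventually_mono) (meson ereal_less_eq(3) order_trans not_less)
  then have "S \<in> null_sets lborel"
    using \<open>open S\<close> by (subst AE_iff_null_sets) auto
  then have "negligible S"
    unfolding negligible_iff_null_sets by (rule null_sets_completionI)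
  ultimately show False by simp
qed

section \<open>Gluing solutions in time\<close>

text \<open>The second piece keeps its own clock, which starts at 0 when the first one shows
  \<open>t0\<close>.\<close>

definition glue :: "real \<Rightarrow> (real \<Rightarrow> 'a) \<Rightarrow> (real \<Rightarrow> 'a) \<Rightarrow> real \<Rightarrow> 'a" where
  "glue t0 f g t = (if t \<le> t0 then f t else g (t - t0))"

lemma glue_deriv:
  fixes f g :: "real \<Rightarrow> real"
  assumes t0: "0 < t0" "t0 < T" "0 < \<tau>"
    and f: "\<And>t. t \<in> {0..<T} \<Longrightarrow> (f has_real_derivative f' t) (at t within {0..<T})"
    and g: "\<And>t. t \<in> {0..<\<tau>} \<Longrightarrow> (g has_real_derivative g' t) (at t within {0..<\<tau>})"
    and eq: "g 0 = f t0" "g' 0 = f' t0" and t: "t \<in> {0..<t0 + \<tau>}"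
  shows "(glue t0 f g has_real_derivative glue t0 f' g' t) (at t within {0..<t0 + \<tau>})"
proof -
  have cl: "closure {0..t0} = {0..t0}" "closure {t0<..<t0 + \<tau>} = {t0..t0 + \<tau>}" using t0 by auto
  have int: "{0..t0} \<inter> {t0..t0 + \<tau>} = {t0}" using t0 by auto
  have un: "{0..t0} \<union> {t0} = {0..t0}" "{t0<..<t0 + \<tau>} \<union> {t0} = {t0..<t0 + \<tau>}" using t0 by auto
  have "((\<lambda>t. if t \<in> {0..t0} then f t else g (t - t0)) has_vector_derivative
     (if t \<in> {0..t0} then f' t else g' (t - t0))) (at t within {0..<t0 + \<tau>})"
  proof (rule has_vector_derivative_If_within_closures[of t "{0..t0}" "{t0<..<t0 + \<tau>}"])
    show "t \<in> {0..t0} \<union> {t0<..<t0 + \<tau>}" "{0..<t0 + \<tau>} = {0..t0} \<union> {t0<..<t0 + \<tau>}" using t t0 by auto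
    show "(f has_vector_derivative f' t) (at t within {0..t0} \<union> closure {0..t0} \<inter> closure {t0<..<t0 + \<tau>})"
      if "t \<in> {0..t0} \<union> closure {0..t0} \<inter> closure {t0<..<t0 + \<tau>}"
      using that DERIV_subset[OF f, of t "{0..t0}"] t0 unfolding cl int un
      by (auto simp: has_real_derivative_iff_has_vector_derivative[symmetric] subset_iff)
    show "((\<lambda>t. g (t - t0)) has_vector_derivative g' (t - t0))
        (at t within {t0<..<t0 + \<tau>} \<union> closure {0..t0} \<inter> closure {t0<..<t0 + \<tau>})"
      if "t \<in> {t0<..<t0 + \<tau>} \<union> closure {0..t0} \<inter> closure {t0<..<t0 + \<tau>}"
    proof -
      have t': "t - t0 \<in> {0..<\<tau>}" using that t0 unfolding cl int un by auto
      have im: "(\<lambda>t. t - t0) ` {t0..<t0 + \<tau>} \<subseteq> {0..<\<tau>}" by auto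
      have d: "((\<lambda>t. t - t0) has_real_derivative 1) (at t within {t0..<t0 + \<tau>})"
        by (auto intro!: derivative_eq_intros)
      show ?thesis
        using DERIV_image_chain[OF DERIV_subset[OF g[OF t'] im] d]
        unfolding cl int un o_def by (simp add: has_real_derivative_iff_has_vector_derivative)
    qed
    show "f t = g (t - t0)" "f' t = g' (t - t0)" if "t \<in> closure {0..t0}" "t \<in> closure {t0<..<t0 + \<tau>}"
    proof -
      have "t = t0" using that unfolding cl by auto
      then show "f t = g (t - t0)" "f' t = g' (t - t0)" using eq by simp_all
    qed
  qed
  then have d: "((\<lambda>t. if t \<in> {0..t0} then f t else g (t - t0)) has_real_derivative glue t0 f' g' t) (at t within {0..<t0 + \<tau>})"
    using t by (simp add: has_real_derivative_iff_has_vector_derivative glue_def)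
  show ?thesis
    by (rule has_field_derivative_transform_within[OF d zero_less_one t]) (auto simp: glue_def)
qed

lemma glue_continuous:
  fixes f g :: "real \<Rightarrow> real \<Rightarrow> real"
  assumes t0: "0 < t0" "t0 < T"
    and f: "continuous_on ({0..<T} \<times> UNIV) (\<lambda>(t, x). f t x)"
    and g: "continuous_on ({0..<\<tau>} \<times> UNIV) (\<lambda>(t, x). g t x)"
    and eq: "g 0 = f t0"
  shows "continuous_on ({0..<t0 + \<tau>} \<times> UNIV) (\<lambda>(t, x). glue t0 f g t x)"
proof -
  have "continuous_on ({0..<t0 + \<tau>} \<times> UNIV) (\<lambda>p. if fst p \<le> t0 then f (fst p) (snd p) else g (fst p - t0) (snd p))"
  proof (rule continuous_on_cases_le)
    show "continuous_on {p \<in> {0..<t0 + \<tau>} \<times> UNIV. fst p \<le> t0} (\<lambda>p. f (fst p) (snd p))"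
      using f unfolding split_beta by (rule continuous_on_subset) (use t0 in auto)
    show "continuous_on {p \<in> {0..<t0 + \<tau>} \<times> UNIV. t0 \<le> fst p} (\<lambda>p. g (fst p - t0) (snd p))"
      by (rule continuous_on_compose2[OF g, where f="\<lambda>p. (fst p - t0, snd p)", unfolded split_beta fst_conv snd_conv])
        (auto intro!: continuous_intros)
    show "f (fst p) (snd p) = g (fst p - t0) (snd p)" if "fst p = t0" for p using eq that by simp
  qed (auto intro!: continuous_intros)
  moreover have "(\<lambda>(t, x). glue t0 f g t x) = (\<lambda>p. if fst p \<le> t0 then f (fst p) (snd p) else g (fst p - t0) (snd p))"
    by (auto simp: glue_def fun_eq_iff)
  ultimately show ?thesis by simp
qed

text \<open>Agreement of \<open>u\<close>, \<open>v\<close>, \<open>w\<close> at time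
  \<open>t0\<close> as functions of \<open>x\<close> forces that of \<open>v_x\<close> and
  \<open>w_x\<close>, and through the system that of all time derivatives. The one-sided derivatives
  therefore match at \<open>t0\<close>.\<close>

lemma c2sol_glue:
  assumes s1: "c2sol c T u1 v1 w1 vx1 wx1" and s2: "c2sol c \<tau> u2 v2 w2 vx2 wx2"
    and t0: "0 < t0" "t0 < T" "0 < \<tau>"
    and eq: "u2 0 = u1 t0" "v2 0 = v1 t0" "w2 0 = w1 t0"
  shows "c2sol c (t0 + \<tau>) (glue t0 u1 u2) (glue t0 v1 v2) (glue t0 w1 w2) (glue t0 vx1 vx2) (glue t0 wx1 wx2)"
proof -
  have d1: "((\<lambda>s. u1 s x) has_real_derivative w1 t x) (at t within {0..<T})"
    "((\<lambda>s. v1 s x) has_real_derivative wx1 t x) (at t within {0..<T})"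
    "((\<lambda>s. w1 s x) has_real_derivative (c (v1 t x))\<^sup>2 * vx1 t x) (at t within {0..<T})"
    "(u1 t has_real_derivative v1 t x) (at x)" "(v1 t has_real_derivative vx1 t x) (at x)" "(w1 t has_real_derivative wx1 t x) (at x)"
    if "t \<in> {0..<T}" for t x
    using s1 that unfolding c2sol_def psystem_def by auto
  have d2: "((\<lambda>s. u2 s x) has_real_derivative w2 t x) (at t within {0..<\<tau>})"
    "((\<lambda>s. v2 s x) has_real_derivative wx2 t x) (at t within {0..<\<tau>})"
    "((\<lambda>s. w2 s x) has_real_derivative (c (v2 t x))\<^sup>2 * vx2 t x) (at t within {0..<\<tau>})"
    "(u2 t has_real_derivative v2 t x) (at x)" "(v2 t has_real_derivative vx2 t x) (at x)" "(w2 t has_real_derivative wx2 t x) (at x)"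
    if "t \<in> {0..<\<tau>}" for t x
    using s2 that unfolding c2sol_def psystem_def by auto
  have t0': "t0 \<in> {0..<T}" "0 \<in> {0..<\<tau>}" using t0 by auto
  have eqx: "vx2 0 = vx1 t0" "wx2 0 = wx1 t0"
    using DERIV_unique[OF d2(5)[OF t0'(2), unfolded eq] d1(5)[OF t0'(1)]]
      DERIV_unique[OF d2(6)[OF t0'(2), unfolded eq] d1(6)[OF t0'(1)]] by auto
  have ap: "(\<lambda>s. glue t0 f g s x) = glue t0 (\<lambda>s. f s x) (\<lambda>s. g s x)" for f g :: "real \<Rightarrow> real \<Rightarrow> real" and x
    by (auto simp: glue_def)
  have ap': "glue t0 f g s x = glue t0 (\<lambda>s. f s x) (\<lambda>s. g s x) s" for f g :: "real \<Rightarrow> real \<Rightarrow> real" and x s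
    by (auto simp: glue_def)
  have cc: "(c (glue t0 v1 v2 t x))\<^sup>2 * glue t0 vx1 vx2 t x =
      glue t0 (\<lambda>s. (c (v1 s x))\<^sup>2 * vx1 s x) (\<lambda>s. (c (v2 s x))\<^sup>2 * vx2 s x) t" for t x
    by (simp add: glue_def)
  have sub: "t \<le> t0 \<Longrightarrow> t \<in> {0..<t0 + \<tau>} \<Longrightarrow> t \<in> {0..<T}" "\<not> t \<le> t0 \<Longrightarrow> t \<in> {0..<t0 + \<tau>} \<Longrightarrow> t - t0 \<in> {0..<\<tau>}" for t
    using t0 by auto
  have conts: "continuous_on ({0..<T} \<times> UNIV) (\<lambda>(t, x). vx1 t x)" "continuous_on ({0..<T} \<times> UNIV) (\<lambda>(t, x). wx1 t x)"
    "continuous_on ({0..<\<tau>} \<times> UNIV) (\<lambda>(t, x). vx2 t x)" "continuous_on ({0..<\<tau>} \<times> UNIV) (\<lambda>(t, x). wx2 t x)"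
    using s1 s2 unfolding c2sol_def psystem_def by auto
  show ?thesis
    unfolding c2sol_def psystem_def
  proof (intro conjI ballI allI)
    fix t x assume t: "t \<in> {0..<t0 + \<tau>}"
    show "((\<lambda>s. glue t0 u1 u2 s x) has_real_derivative glue t0 w1 w2 t x) (at t within {0..<t0 + \<tau>})"
      unfolding ap ap'[of w1] by (rule glue_deriv[OF t0 d1(1) d2(1) _ _ t]) (simp_all add: eq)
    show "((\<lambda>s. glue t0 v1 v2 s x) has_real_derivative glue t0 wx1 wx2 t x) (at t within {0..<t0 + \<tau>})"
      unfolding ap ap'[of wx1] by (rule glue_deriv[OF t0 d1(2) d2(2) _ _ t]) (simp_all add: eq eqx)
    show "((\<lambda>s. glue t0 w1 w2 s x) has_real_derivative (c (glue t0 v1 v2 t x))\<^sup>2 * glue t0 vx1 vx2 t x) (at t within {0..<t0 + \<tau>})"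
      unfolding ap cc by (rule glue_deriv[OF t0 d1(3) d2(3) _ _ t]) (simp_all add: eq eqx)
    show "(glue t0 u1 u2 t has_real_derivative glue t0 v1 v2 t x) (at x)"
      "(glue t0 v1 v2 t has_real_derivative glue t0 vx1 vx2 t x) (at x)"
      "(glue t0 w1 w2 t has_real_derivative glue t0 wx1 wx2 t x) (at x)"
      using d1(4-6)[OF sub(1)[OF _ t], of x] d2(4-6)[OF sub(2)[OF _ t], of x] by (auto simp: glue_def)
  qed (rule glue_continuous[OF t0(1,2)] conts eqx)+
qed

section \<open>Admissible solutions\<close>

text \<open>The range of \<open>u_x\<close> lies in the closed interval
  \<open>{- \<delta>..\<delta>}\<close>, hence so does its closure.\<close>

lemma admissibleI:
  assumes sol: "c2sol c T u v w vx wx" and T: "T > 0" and init: "\<And>x. u 0 x = f x" "\<And>x. w 0 x = g x"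
    and U: "{- \<delta>..\<delta>} \<subseteq> U" and cv: "continuous_on ({0..<T} \<times> UNIV) (\<lambda>(t, x). c (v t x))"
    and bounds: "\<And>t x. t \<in> {0..<T} \<Longrightarrow> \<bar>v t x\<bar> \<le> \<delta> \<and> \<bar>c (v t x)\<bar> \<le> 2 \<and> \<bar>u t x\<bar> \<le> B \<and> \<bar>v t x\<bar> \<le> B \<and> \<bar>w t x\<bar> \<le> B \<and>
       \<bar>vx t x\<bar> \<le> B \<and> \<bar>wx t x\<bar> \<le> B"
  shows "admissible_solution U c f g T u"
proof -
  note cl = c2sol_classical[OF sol cv init T]
  have s: "psystem c T v w vx wx" using sol by (simp add: c2sol_def)
  have xc: "continuous_on UNIV (v t)" "continuous_on UNIV (w t)" "continuous_on UNIV (vx t)" "continuous_on UNIV (wx t)"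
    "continuous_on UNIV (\<lambda>x. (c (v t x))\<^sup>2 * vx t x)" "continuous_on UNIV (u t)" if t: "t \<in> {0..<T}" for t
  proof -
    have "continuous_on ({0..<T} \<times> UNIV) (\<lambda>(t, x). vx t x)" "continuous_on ({0..<T} \<times> UNIV) (\<lambda>(t, x). wx t x)"
      using s unfolding psystem_def by auto
    note 1 = strip_slice_x[OF psystem_continuous(1)[OF s] t] strip_slice_x[OF psystem_continuous(2)[OF s] t]
      strip_slice_x[OF this(1) t] strip_slice_x[OF this(2) t]
    show "continuous_on UNIV (v t)" "continuous_on UNIV (w t)" "continuous_on UNIV (vx t)" "continuous_on UNIV (wx t)"
      by (rule 1)+
    show "continuous_on UNIV (\<lambda>x. (c (v t x))\<^sup>2 * vx t x)"
      by (intro continuous_on_mult continuous_on_power 1(3) strip_slice_x[where f="\<lambda>t x. c (v t x)", OF cv t])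
    have "\<And>x. (u t has_real_derivative v t x) (at x)" using sol t unfolding c2sol_def by auto
    then show "continuous_on UNIV (u t)" by (meson DERIV_isCont continuous_at_imp_continuous_on)
  qed
  have "Linf_norm (u t) + Linf_norm (dt u t) + Linf_norm (dx u t) +
        Linf_norm (dt (dt u) t) + Linf_norm (dx (dt u) t) + Linf_norm (dx (dx u) t) \<le> ereal B + ereal B + ereal B + ereal (4 * B) + ereal B + ereal B"
    if t: "t \<in> {0..<T}" for t
  proof -
    have e: "dt u t = w t" "dx u t = v t" "dt (dt u) t = (\<lambda>x. (c (v t x))\<^sup>2 * vx t x)" "dx (dt u) t = wx t" "dx (dx u) t = vx t"
      using cl(2)[OF t] by auto
    \<comment> \<open>The equation expresses \<open>u_tt\<close> through \<open>u_xx\<close>, with a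
      factor of at most 4.\<close>
    have "\<bar>(c (v t x))\<^sup>2 * vx t x\<bar> \<le> 4 * B" for x
    proof -
      have "\<bar>c (v t x)\<bar>\<^sup>2 \<le> 2\<^sup>2" using bounds[OF t, of x] by (intro power_mono) auto
      then show ?thesis
        unfolding abs_mult using bounds[OF t, of x] by (intro mult_mono) auto
    qed
    note 1 = Linf_norm_le[OF xc(5)[OF t] this]
    have "Linf_norm (u t) \<le> B" "Linf_norm (v t) \<le> B" "Linf_norm (w t) \<le> B" "Linf_norm (vx t) \<le> B" "Linf_norm (wx t) \<le> B"
      by (rule Linf_norm_le, rule xc[OF t], use bounds[OF t] in blast)+
    with 1 show ?thesis
      unfolding e by (intro add_mono)
  qed
  then have "(SUP t\<in>{0..<T}. Linf_norm (u t) + Linf_norm (dt u t) + Linf_norm (dx u t) +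
        Linf_norm (dt (dt u) t) + Linf_norm (dx (dt u) t) + Linf_norm (dx (dx u) t)) \<le> ereal B + ereal B + ereal B + ereal (4 * B) + ereal B + ereal B"
    by (rule SUP_least)
  also have "\<dots> < \<infinity>" by simp
  finally have "(SUP t\<in>{0..<T}. Linf_norm (u t) + Linf_norm (dt u t) + Linf_norm (dx u t) +
        Linf_norm (dt (dt u) t) + Linf_norm (dx (dt u) t) + Linf_norm (dx (dx u) t)) < \<infinity>" .
  moreover have "closure ((\<lambda>(t, x). dx u t x) ` ({0..<T} \<times> UNIV)) \<subseteq> {- \<delta>..\<delta>}"
  proof (rule closure_minimal)
    have "dx u t x \<in> {- \<delta>..\<delta>}" if "t \<in> {0..<T}" for t x
      using cl(2)[OF that, of x] bounds[OF that, of x] by (simp add: abs_le_iff)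
    then show "(\<lambda>(t, x). dx u t x) ` ({0..<T} \<times> UNIV) \<subseteq> {- \<delta>..\<delta>}"
      unfolding image_subset_iff by (metis (no_types, lifting) SigmaE case_prod_conv)
  qed simp
  ultimately show ?thesis
    unfolding admissible_solution_def using cl(1) U by blast
qed

lemma le_sum_of_nonneg:
  fixes a b c d e f :: ereal
  assumes "0 \<le> a" "0 \<le> b" "0 \<le> c" "0 \<le> d" "0 \<le> e" "0 \<le> f"
  shows "a \<le> a + b + c + d + e + f" "b \<le> a + b + c + d + e + f" "c \<le> a + b + c + d + e + f"
    "e \<le> a + b + c + d + e + f" "f \<le> a + b + c + d + e + f"
proof -
  show "a \<le> a + b + c + d + e + f"
    by (rule add_increasing2[OF assms(6)], rule add_increasing2[OF assms(5)], rule add_increasing2[OF assms(4)],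
        rule add_increasing2[OF assms(3)], rule add_increasing2[OF assms(2)], rule order_refl)
  show "b \<le> a + b + c + d + e + f"
    by (rule add_increasing2[OF assms(6)], rule add_increasing2[OF assms(5)], rule add_increasing2[OF assms(4)],
        rule add_increasing2[OF assms(3)], rule add_increasing[OF assms(1)], rule order_refl)
  show "c \<le> a + b + c + d + e + f"
    by (rule add_increasing2[OF assms(6)], rule add_increasing2[OF assms(5)], rule add_increasing2[OF assms(4)],
        rule add_increasing, intro add_nonneg_nonneg assms(1,2), rule order_refl)
  show "e \<le> a + b + c + d + e + f"
    by (rule add_increasing2[OF assms(6)], rule add_increasing, intro add_nonneg_nonneg assms(1-4), rule order_refl)
  show "f \<le> a + b + c + d + e + f"
    by (rule add_increasing, intro add_nonneg_nonneg assms(1-5), rule order_refl)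
qed

lemma admissible_bounds:
  assumes adm: "admissible_solution U c f g T u"
  obtains N where "\<And>t x. t \<in> {0..<T} \<Longrightarrow> \<bar>u t x\<bar> \<le> N \<and> \<bar>dt u t x\<bar> \<le> N \<and> \<bar>dx u t x\<bar> \<le> N \<and> \<bar>dx (dt u) t x\<bar> \<le> N \<and> \<bar>dx (dx u) t x\<bar> \<le> N"
proof (cases "T > 0")
  case True
  have sol: "c2sol c T u (dx u) (dt u) (dx (dx u)) (dx (dt u))"
    using adm classical_c2sol unfolding admissible_solution_def by blast
  then have s: "psystem c T (dx u) (dt u) (dx (dx u)) (dx (dt u))" by (simp add: c2sol_def)
  define F where "F t = Linf_norm (u t) + Linf_norm (dt u t) + Linf_norm (dx u t) +
        Linf_norm (dt (dt u) t) + Linf_norm (dx (dt u) t) + Linf_norm (dx (dx u) t)" for t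
  have lt: "(SUP t\<in>{0..<T}. F t) < \<infinity>"
    using adm unfolding admissible_solution_def F_def by blast
  \<comment> \<open>Nonnegativity excludes the value \<open>- \<infinity>\<close>, so a supremum
    below \<open>\<infinity>\<close> is a real number.\<close>
  have "0 \<le> F 0" unfolding F_def by (intro add_nonneg_nonneg Linf_norm_nonneg)
  also have "F 0 \<le> (SUP t\<in>{0..<T}. F t)" by (rule SUP_upper) (use True in simp)
  finally obtain N where N: "(SUP t\<in>{0..<T}. F t) = ereal N"
    using lt by (cases "SUP t\<in>{0..<T}. F t") auto
  show ?thesis
  proof (rule that)
    fix t x assume t: "t \<in> {0..<T}"
    have FN: "F t \<le> ereal N" unfolding N[symmetric] by (rule SUP_upper[OF t])
    have parts: "Linf_norm (u t) \<le> F t" "Linf_norm (dt u t) \<le> F t" "Linf_norm (dx u t) \<le> F t"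
      "Linf_norm (dx (dt u) t) \<le> F t" "Linf_norm (dx (dx u) t) \<le> F t"
      unfolding F_def by (rule le_sum_of_nonneg; rule Linf_norm_nonneg)+
    have c: "continuous_on UNIV (dx u t)" "continuous_on UNIV (dt u t)" "continuous_on UNIV (dx (dx u) t)" "continuous_on UNIV (dx (dt u) t)"
    proof -
      have "continuous_on ({0..<T} \<times> UNIV) (\<lambda>(t, x). dx (dx u) t x)" "continuous_on ({0..<T} \<times> UNIV) (\<lambda>(t, x). dx (dt u) t x)"
        using s unfolding psystem_def by auto
      from strip_slice_x[OF this(1) t] strip_slice_x[OF this(2) t] strip_slice_x[OF psystem_continuous(1)[OF s] t]
        strip_slice_x[OF psystem_continuous(2)[OF s] t]
      show "continuous_on UNIV (dx u t)" "continuous_on UNIV (dt u t)" "continuous_on UNIV (dx (dx u) t)" "continuous_on UNIV (dx (dt u) t)"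
        by auto
    qed
    have "\<And>x. (u t has_real_derivative dx u t x) (at x)" using sol t unfolding c2sol_def by auto
    then have "continuous_on UNIV (u t)" by (meson DERIV_isCont continuous_at_imp_continuous_on)
    then show "\<bar>u t x\<bar> \<le> N \<and> \<bar>dt u t x\<bar> \<le> N \<and> \<bar>dx u t x\<bar> \<le> N \<and> \<bar>dx (dt u) t x\<bar> \<le> N \<and> \<bar>dx (dx u) t x\<bar> \<le> N"
      using Linf_norm_bound[OF _ order_trans[OF _ FN]] c parts by blast
  qed
qed (use that in auto)

section \<open>Bounds on the lifespan\<close>

text \<open>Here \<open>p\<close> and \<open>q\<close> are the profiles of \<open>u_x\<close> and
  \<open>u_t\<close>, that is \<open>\<phi>'\<close> and \<open>\<psi>\<close>. The qualitative
  bound \<open>N\<close> is quantified inside, after \<open>C'\<close>. As a predicate of the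
  profiles it can be transferred to reflected data.\<close>

definition lifespan_le where
  "lifespan_le c \<delta> e p q \<epsilon>0 C' \<longleftrightarrow> (\<forall>\<epsilon> T N v w vx wx. 0 < \<epsilon> \<and> \<epsilon> \<le> \<epsilon>0 \<and> 0 < T \<and> psystem c T v w vx wx \<and>
     (\<forall>t\<in>{0..<T}. \<forall>x. \<bar>vx t x\<bar> \<le> N \<and> \<bar>wx t x\<bar> \<le> N \<and> \<bar>v t x\<bar> \<le> \<delta>) \<and>
     (\<forall>x. v 0 x = \<epsilon> * p x) \<and> (\<forall>x. w 0 x = \<epsilon> * q x) \<longrightarrow> T \<le> C' * \<epsilon> powr (- (e + 1)))"

lemma psystem_cong_speed:
  assumes s: "psystem c1 T v w vx wx" and "T1 \<le> T"
    and eq: "\<And>t x. t \<in> {0..<T1} \<Longrightarrow> c1 (v t x) = c2 (v t x)"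
  shows "psystem c2 T1 v w vx wx"
proof -
  have sub: "{0..<T1} \<subseteq> {0..<T}" using assms(2) by auto
  show ?thesis
    unfolding psystem_def
  proof (intro conjI ballI allI)
    fix t x assume t: "t \<in> {0..<T1}"
    then have "t \<in> {0..<T}" using sub by blast
    then have d: "((\<lambda>s. v s x) has_real_derivative wx t x) (at t within {0..<T})"
      "((\<lambda>s. w s x) has_real_derivative (c1 (v t x))\<^sup>2 * vx t x) (at t within {0..<T})"
      "(v t has_real_derivative vx t x) (at x)" "(w t has_real_derivative wx t x) (at x)"
      using s unfolding psystem_def by auto
    show "((\<lambda>s. v s x) has_real_derivative wx t x) (at t within {0..<T1})"
      by (rule DERIV_subset[OF d(1) sub])
    show "((\<lambda>s. w s x) has_real_derivative (c2 (v t x))\<^sup>2 * vx t x) (at t within {0..<T1})"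
      using DERIV_subset[OF d(2) sub] by (simp add: eq[OF t])
    show "(v t has_real_derivative vx t x) (at x)" "(w t has_real_derivative wx t x) (at x)"
      by (rule d)+
  qed (use s sub in \<open>auto simp: psystem_def intro: continuous_on_subset\<close>)
qed

text \<open>The reflection \<open>u(t, x) \<mapsto> - u(t, - x)\<close> of the wave equation, in terms of \<open>u\<^sub>x\<close> and \<open>u\<^sub>t\<close>.\<close>

lemma psystem_reflect:
  assumes "psystem c T v w vx wx"
  shows "psystem c T (\<lambda>t x. v t (- x)) (\<lambda>t x. - w t (- x)) (\<lambda>t x. - vx t (- x)) (\<lambda>t x. wx t (- x))"
  unfolding psystem_def
proof (intro conjI ballI allI)
  fix t x assume t: "t \<in> {0..<T}"
  have d: "((\<lambda>s. v s y) has_real_derivative wx t y) (at t within {0..<T})"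
      "((\<lambda>s. w s y) has_real_derivative (c (v t y))\<^sup>2 * vx t y) (at t within {0..<T})"
      "(v t has_real_derivative vx t y) (at y)" "(w t has_real_derivative wx t y) (at y)" for y
    using assms t unfolding psystem_def by auto
  show "((\<lambda>s. v s (- x)) has_real_derivative wx t (- x)) (at t within {0..<T})" by (rule d)
  show "((\<lambda>s. - w s (- x)) has_real_derivative (c (v t (- x)))\<^sup>2 * - vx t (- x)) (at t within {0..<T})"
    using DERIV_minus[OF d(2)] by simp
  have m: "((\<lambda>x. - x) has_real_derivative - 1) (at x)" by (auto intro!: derivative_eq_intros)
  show "((\<lambda>x. v t (- x)) has_real_derivative - vx t (- x)) (at x)"
    "((\<lambda>x. - w t (- x)) has_real_derivative wx t (- x)) (at x)"
    using DERIV_chain2[OF d(3) m] DERIV_minus[OF DERIV_chain2[OF d(4) m]] by simp_all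
next
  have c: "continuous_on ({0..<T} \<times> UNIV) (\<lambda>(t, x). vx t x)" "continuous_on ({0..<T} \<times> UNIV) (\<lambda>(t, x). wx t x)"
    using assms unfolding psystem_def by auto
  show "continuous_on ({0..<T} \<times> UNIV) (\<lambda>(t, x). - vx t (- x))"
    unfolding split_beta
    by (rule continuous_on_minus[OF continuous_on_compose2[OF c(1), where f="\<lambda>p. (fst p, - snd p)",
          unfolded split_beta fst_conv snd_conv]]) (auto intro!: continuous_intros)
  show "continuous_on ({0..<T} \<times> UNIV) (\<lambda>(t, x). wx t (- x))"
    unfolding split_beta
    by (rule continuous_on_compose2[OF c(2), where f="\<lambda>p. (fst p, - snd p)",
          unfolded split_beta fst_conv snd_conv]) (auto intro!: continuous_intros)
qed

context speed
begin

lemma K_nonneg: "K \<ge> 0"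
  using c'_bound[of 0] by simp

text \<open>\<open>v\<close> is Lipschitz in time, so the bound \<open>\<bar>v\<bar> \<le> \<delta>\<close>, under which the two speeds agree, can be
  continued by time steps of a fixed length.\<close>

lemma small_solution:
  assumes s: "psystem c0 T v w vx wx" and eq: "\<forall>\<theta>. \<bar>\<theta>\<bar> \<le> \<delta> \<longrightarrow> c0 \<theta> = c \<theta>"
    and bound: "\<forall>t\<in>{0..<T}. \<forall>x. \<bar>vx t x\<bar> \<le> N \<and> \<bar>wx t x\<bar> \<le> N"
    and riem0: "\<forall>x. \<bar>w 0 x + G (v 0 x)\<bar> \<le> \<eta> \<and> \<bar>w 0 x - G (v 0 x)\<bar> \<le> \<eta>"
    and \<delta>: "0 < \<delta>" "4 * \<eta> \<le> \<delta>"
  shows "psystem c T v w vx wx" and "\<forall>t\<in>{0..<T}. \<forall>x. \<bar>v t x\<bar> \<le> 2 * \<eta> \<and> \<bar>w t x\<bar> \<le> \<eta>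
     \<and> \<bar>w t x + G (v t x)\<bar> \<le> \<eta> \<and> \<bar>w t x - G (v t x)\<bar> \<le> \<eta>"
proof -
  have c0: "\<And>\<theta>. \<bar>\<theta>\<bar> \<le> \<delta> \<Longrightarrow> c0 \<theta> = c \<theta>"
    and N: "\<And>t x. t \<in> {0..<T} \<Longrightarrow> \<bar>vx t x\<bar> \<le> N \<and> \<bar>wx t x\<bar> \<le> N"
    and init: "\<And>x. \<bar>w 0 x + G (v 0 x)\<bar> \<le> \<eta>" "\<And>x. \<bar>w 0 x - G (v 0 x)\<bar> \<le> \<eta>"
    using eq bound riem0 by blast+
  have \<eta>: "\<eta> \<ge> 0" using init(1)[of 0] by linarith
  have v0: "\<bar>v 0 x\<bar> \<le> 2 * \<eta>" for x
    using G_abs_lower[of "v 0 x"] init(1)[of x] init(2)[of x] by linarith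
  have step: "psystem c T1 v w vx wx"
    "\<And>t x. t \<in> {0..<T1} \<Longrightarrow> \<bar>v t x\<bar> \<le> 2 * \<eta> \<and> \<bar>w t x\<bar> \<le> \<eta> \<and> \<bar>w t x + G (v t x)\<bar> \<le> \<eta> \<and> \<bar>w t x - G (v t x)\<bar> \<le> \<eta>"
    if T1: "T1 \<le> T" and small: "\<And>t x. t \<in> {0..<T1} \<Longrightarrow> \<bar>v t x\<bar> \<le> \<delta>" for T1
  proof -
    show p: "psystem c T1 v w vx wx"
      by (rule psystem_cong_speed[OF s T1 c0[OF small]])
    interpret psys c c' G K T1 N v w vx wx
    proof unfold_locales
      show "psystem c T1 v w vx wx" by (rule p)
      show "\<bar>vx t x\<bar> \<le> N" "\<bar>wx t x\<bar> \<le> N" if "0 \<le> t" "t < T1" for t x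
        using N[of t x] that T1 by simp_all
    qed
    have i: "\<And>x. \<bar>riem 1 0 x\<bar> \<le> \<eta>" "\<And>x. \<bar>riem (- 1) 0 x\<bar> \<le> \<eta>"
      using init by (simp_all add: riem_def)
    show "\<bar>v t x\<bar> \<le> 2 * \<eta> \<and> \<bar>w t x\<bar> \<le> \<eta> \<and> \<bar>w t x + G (v t x)\<bar> \<le> \<eta> \<and> \<bar>w t x - G (v t x)\<bar> \<le> \<eta>"
      if t: "t \<in> {0..<T1}" for t x
      using v_bound[OF i t, of x] w_bound[OF i t, of x] riem_bound[of 1, OF _ i(1) t, of x]
        riem_bound[of "- 1", OF _ i(2) t, of x]
      by (simp add: riem_def)
  qed
  \<comment> \<open>In time \<open>\<theta>\<close> the value of \<open>v\<close> moves by at most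
    \<open>\<delta> / 2\<close>, the gap left between \<open>2 * \<eta>\<close> and
    \<open>\<delta>\<close>.\<close>
  define \<theta> where "\<theta> = \<delta> / (2 * (\<bar>N\<bar> + 1))"
  have \<theta>0: "\<theta> > 0"
    unfolding \<theta>_def using \<delta> by (intro divide_pos_pos) auto
  have "(\<bar>N\<bar> + 1) * \<theta> = \<delta> / 2"
    unfolding \<theta>_def using abs_ge_zero[of N] by (simp add: divide_simps)
  then have \<theta>: "\<theta> > 0" "\<bar>N\<bar> * \<theta> \<le> \<delta> / 2"
    using \<theta>0 by (simp_all add: distrib_right)
  have close: "\<bar>v t x - v s x\<bar> \<le> \<delta> / 2" if st: "0 \<le> s" "s \<le> t" "t - s \<le> \<theta>" "t < T" for s t x
  proof -
    have "norm (v t x - v s x) \<le> \<bar>N\<bar> * norm (t - s)"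
    proof (rule field_differentiable_bound[of "{s..t}" "\<lambda>s. v s x" "\<lambda>s. wx s x"])
      fix z assume z: "z \<in> {s..t}"
      then have z': "z \<in> {0..<T}" using st by auto
      have "((\<lambda>s. v s x) has_real_derivative wx z x) (at z within {0..<T})"
        using s z' unfolding psystem_def by auto
      then show "((\<lambda>s. v s x) has_real_derivative wx z x) (at z within {s..t})"
        by (rule DERIV_subset) (use st in auto)
      show "norm (wx z x) \<le> \<bar>N\<bar>" using N[OF z', of x] by auto
    qed (use st in auto)
    also have "\<dots> \<le> \<bar>N\<bar> * \<theta>" using st by (intro mult_left_mono) auto
    finally show ?thesis using \<theta> by simp
  qed
  have small: "\<bar>v t x\<bar> \<le> \<delta>" if "0 \<le> t" "t < T" "t < real n * \<theta>" for n t x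
    using that
  proof (induction n arbitrary: t x)
    case (Suc n)
    show ?case
    proof (cases "t < \<theta>")
      case True
      then have "\<bar>v t x - v 0 x\<bar> \<le> \<delta> / 2" using close[of 0 t x] Suc.prems by auto
      then show ?thesis using v0[of x] \<delta> by linarith
    next
      case False
      \<comment> \<open>On the part already covered \<open>\<bar>v\<bar> \<le> \<delta>\<close>
        improves to \<open>\<bar>v\<bar> \<le> 2 * \<eta>\<close>, since the invariants do not grow;
        one more step costs at most \<open>\<delta> / 2\<close>.\<close>
      define s where "s = t - \<theta>"
      have "t < real n * \<theta> + \<theta>" using Suc.prems(3) by (simp add: distrib_right)
      then have s: "0 \<le> s" "s < T" "s < real n * \<theta>" using False Suc.prems(2) \<theta>(1) by (simp_all add: s_def)
      define T1 where "T1 = min T (real n * \<theta>)"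
      have sm: "\<bar>v r y\<bar> \<le> \<delta>" if "r \<in> {0..<T1}" for r y
        by (rule Suc.IH) (use that in \<open>simp_all add: T1_def\<close>)
      have "T1 \<le> T" "s \<in> {0..<T1}" using s by (simp_all add: T1_def)
      from step(2)[OF this(1) sm this(2), of x] have "\<bar>v s x\<bar> \<le> 2 * \<eta>" by blast
      moreover have "\<bar>v t x - v s x\<bar> \<le> \<delta> / 2"
        using s(1) Suc.prems(2) \<theta>(1) by (intro close) (simp_all add: s_def)
      ultimately show ?thesis using \<delta> by linarith
    qed
  qed simp
  have all: "\<bar>v t x\<bar> \<le> \<delta>" if "t \<in> {0..<T}" for t x
  proof -
    obtain n where "t < real n * \<theta>" using reals_Archimedean3[OF \<theta>(1)] by blast
    then show ?thesis using small[of t n x] that by auto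
  qed
  show "psystem c T v w vx wx" by (rule step(1)[OF order_refl all])
  show "\<forall>t\<in>{0..<T}. \<forall>x. \<bar>v t x\<bar> \<le> 2 * \<eta> \<and> \<bar>w t x\<bar> \<le> \<eta>
     \<and> \<bar>w t x + G (v t x)\<bar> \<le> \<eta> \<and> \<bar>w t x - G (v t x)\<bar> \<le> \<eta>"
    by (intro ballI allI) (rule step(2)[OF order_refl all])
qed

text \<open>For data of size \<open>\<epsilon>\<close> the Riemann invariants and their slopes
  differ from those of the linear wave equation only by terms quadratic in
  \<open>\<epsilon>\<close>.\<close>

lemma c_near_1:
  assumes "c 0 = 1"
  shows "\<bar>c x - 1\<bar> \<le> K * \<bar>x\<bar>" "\<bar>G x - x\<bar> \<le> K * \<bar>x\<bar> * \<bar>x\<bar>"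
proof -
  show *: "\<bar>c x - 1\<bar> \<le> K * \<bar>x\<bar>" for x
    using c_lipschitz[of x 0] assms by simp
  have "norm ((G x - x) - (G 0 - 0)) \<le> (K * \<bar>x\<bar>) * norm (x - 0)"
  proof (rule field_differentiable_bound[of "closed_segment 0 x" "\<lambda>x. G x - x" "\<lambda>x. c x - 1"])
    fix z assume "z \<in> closed_segment 0 x"
    then have "\<bar>z\<bar> \<le> \<bar>x\<bar>" by (auto simp: closed_segment_eq_real_ivl split: if_splits)
    then show "norm (c z - 1) \<le> K * \<bar>x\<bar>"
      using *[of z] mult_left_mono[OF _ K_nonneg, of "\<bar>z\<bar>" "\<bar>x\<bar>"] by simp
    show "((\<lambda>x. G x - x) has_real_derivative c z - 1) (at z within closed_segment 0 x)"
      by (auto intro!: derivative_eq_intros has_field_derivative_at_within[OF G_deriv])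
  qed auto
  then show "\<bar>G x - x\<bar> \<le> K * \<bar>x\<bar> * \<bar>x\<bar>" by (simp add: G_0)
qed

text \<open>The exponent \<open>e\<close> is \<open>p - 2\<close> in case (A) and \<open>0\<close> in case (B).\<close>

lemma lifespan_bound_plus:
  fixes p p' q q' :: "real \<Rightarrow> real"
  assumes c0: "c 0 = 1"
    and c'_lower: "\<And>\<theta>. \<bar>\<theta>\<bar> \<le> \<delta> \<Longrightarrow> C * \<bar>\<theta>\<bar> powr e \<le> c' \<theta>" and C: "C > 0" "e \<ge> 0"
    and p: "\<And>x. (p has_real_derivative p' x) (at x)" and q: "\<And>x. (q has_real_derivative q' x) (at x)"
    and p'_cont: "isCont p' x0" and q'_cont: "isCont q' x0"
    and bounds: "\<And>x. \<bar>p x\<bar> \<le> M" "\<And>x. \<bar>p' x\<bar> \<le> M"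
    and decay: "(p \<longlongrightarrow> 0) at_bot" "(q \<longlongrightarrow> 0) at_bot"
    and x0: "q' x0 + p' x0 > 0"
  shows "\<exists>\<epsilon>0>0. \<exists>C'>0. lifespan_le c \<delta> e p q \<epsilon>0 C'"
proof -
  have "isCont (\<lambda>x. q' x + p' x) x0" by (intro continuous_intros p'_cont q'_cont)
  then have "((\<lambda>x. q' x + p' x) \<longlongrightarrow> q' x0 + p' x0) (nhds x0)"
    unfolding isCont_def by (rule tendsto_at_iff_tendsto_nhds[THEN iffD1])
  from order_tendstoD(1)[OF this x0]
  obtain d where d: "d > 0" "\<And>x. \<bar>x - x0\<bar> < d \<Longrightarrow> q' x + p' x > 0"
    by (auto simp: eventually_nhds_metric dist_real_def)
  \<comment> \<open>If \<open>q + p\<close> vanished near \<open>x0\<close>, its derivative at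
    \<open>x0\<close> would be 0. A nonzero value is needed to keep \<open>v\<close> away from 0
    later.\<close>
  have "\<exists>x1. q' x1 + p' x1 > 0 \<and> q x1 + p x1 \<noteq> 0"
  proof (rule ccontr)
    assume "\<not> ?thesis"
    then have z: "q x + p x = 0" if "\<bar>x - x0\<bar> < d" for x
      using d(2)[OF that] by blast
    have "((\<lambda>x. q x + p x) has_real_derivative q' x0 + p' x0) (at x0)"
      by (intro derivative_intros p q)
    moreover have "((\<lambda>x. q x + p x) has_real_derivative 0) (at x0)"
      by (rule has_field_derivative_transform_within[OF DERIV_const[of 0] d(1)]) (auto simp: z dist_real_def)
    ultimately have "q' x0 + p' x0 = 0" by (rule DERIV_unique)
    then show False using x0 by simp
  qed
  then obtain x1 where x1: "q' x1 + p' x1 > 0" "q x1 + p x1 \<noteq> 0" by blast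
  define \<mu> where "\<mu> = q' x1 + p' x1"
  define m where "m = \<bar>q x1 + p x1\<bar>"
  have pos: "\<mu> > 0" "m > 0" using x1 by (auto simp: \<mu>_def m_def)
  have M: "M \<ge> 0" using bounds(1)[of 0] by linarith
  \<comment> \<open>Then \<open>2 * \<bar>p y\<bar> + \<bar>q y\<bar> \<le> m / 4\<close>, so
    \<open>s\<close> is at most half of the lower bound \<open>\<epsilon> * m / 2\<close> for
    \<open>r\<close>.\<close>
  have "eventually (\<lambda>y. \<bar>p y\<bar> < m / 16) at_bot" "eventually (\<lambda>y. \<bar>q y\<bar> < m / 16) at_bot"
    using tendstoD[OF decay(1), of "m / 16"] tendstoD[OF decay(2), of "m / 16"] pos by simp_all
  then have "eventually (\<lambda>y. \<bar>p y\<bar> < m / 16 \<and> \<bar>q y\<bar> < m / 16) at_bot" by (rule eventually_conj)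
  then obtain R where R: "\<And>y. y \<le> R \<Longrightarrow> \<bar>p y\<bar> < m / 16 \<and> \<bar>q y\<bar> < m / 16"
    unfolding eventually_at_bot_linorder by blast
  define t1 where "t1 = \<bar>x1 - R\<bar>"
  \<comment> \<open>The quadratic errors \<open>\<epsilon>\<^sup>2 * K * M\<^sup>2\<close> then
    consume at most half of the linear parts \<open>\<epsilon> * m\<close> and
    \<open>\<epsilon> * \<mu>\<close>. The bound 1 lets the fixed time \<open>t1\<close> be absorbed
    into a negative power of \<open>\<epsilon>\<close>.\<close>
  define \<epsilon>0 where "\<epsilon>0 = min 1 (min m \<mu> / (2 * (K * (M * M) + 1)))"
  have KM: "K * (M * M) \<ge> 0" using K_nonneg M by simp
  have \<epsilon>0: "\<epsilon>0 > 0" using pos KM by (auto simp: \<epsilon>0_def intro!: divide_pos_pos add_nonneg_pos)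
  \<comment> \<open>The bound of \<open>blowup_time\<close> for
    \<open>\<eta> = \<epsilon> * m / 2\<close> and \<open>\<rho> = \<epsilon> * \<mu> / 2\<close>,
    with the powers of \<open>\<epsilon>\<close> taken out.\<close>
  define C2 where "C2 = 12 / ((C * (m / 16) powr e) * (\<mu> / 2))"
  have C2: "C2 > 0" using C pos by (simp add: C2_def)
  show ?thesis
  proof (rule exI[of _ \<epsilon>0], rule conjI[OF \<epsilon>0], rule exI[of _ "t1 + C2"], unfold lifespan_le_def, intro conjI allI impI)
    show "t1 + C2 > 0" using C2 by (simp add: t1_def)
    fix \<epsilon> T N :: real and v w vx wx
    assume *: "0 < \<epsilon> \<and> \<epsilon> \<le> \<epsilon>0 \<and> 0 < T \<and> psystem c T v w vx wx \<and>
     (\<forall>t\<in>{0..<T}. \<forall>x. \<bar>vx t x\<bar> \<le> N \<and> \<bar>wx t x\<bar> \<le> N \<and> \<bar>v t x\<bar> \<le> \<delta>) \<and>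
     (\<forall>x. v 0 x = \<epsilon> * p x) \<and> (\<forall>x. w 0 x = \<epsilon> * q x)"
    then have \<epsilon>: "0 < \<epsilon>" "\<epsilon> \<le> 1" and T: "0 < T" and v0: "\<And>x. v 0 x = \<epsilon> * p x" and w0: "\<And>x. w 0 x = \<epsilon> * q x"
      and sys: "psystem c T v w vx wx" by (auto simp: \<epsilon>0_def)
    have vx_le: "\<bar>vx t x\<bar> \<le> N" and wx_le: "\<bar>wx t x\<bar> \<le> N" if "0 \<le> t" "t < T" for t x
      using * that by simp_all
    interpret psys c c' G K T N v w vx wx
      by unfold_locales (fact sys vx_le wx_le)+
    have "\<epsilon> \<le> min m \<mu> / (2 * (K * (M * M) + 1))" using * by (auto simp: \<epsilon>0_def)
    then have "\<epsilon> * (2 * (K * (M * M) + 1)) \<le> min m \<mu>" using KM by (simp add: pos_le_divide_eq)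
    then have \<epsilon>KM: "\<epsilon> * (K * (M * M)) \<le> m / 2" "\<epsilon> * (K * (M * M)) \<le> \<mu> / 2"
      using \<epsilon> by (auto simp: algebra_simps)
    have zero: "0 \<in> {0..<T}" using T by simp
    have vx0: "vx 0 x = \<epsilon> * p' x" and wx0: "wx 0 x = \<epsilon> * q' x" for x
    proof -
      have "v 0 = (\<lambda>x. \<epsilon> * p x)" "w 0 = (\<lambda>x. \<epsilon> * q x)" using v0 w0 by auto
      then show "vx 0 x = \<epsilon> * p' x" "wx 0 x = \<epsilon> * q' x"
        using DERIV_unique[OF v_x[OF zero] DERIV_cmult[OF p, of \<epsilon> x, folded \<open>v 0 = _\<close>]]
          DERIV_unique[OF w_x[OF zero] DERIV_cmult[OF q, of \<epsilon> x, folded \<open>w 0 = _\<close>]] by auto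
    qed
    have r1: "\<epsilon> * m / 2 \<le> \<bar>riem 1 0 x1\<bar>"
    proof -
      have "\<bar>G (\<epsilon> * p x1) - \<epsilon> * p x1\<bar> \<le> K * \<bar>\<epsilon> * p x1\<bar> * \<bar>\<epsilon> * p x1\<bar>"
        by (rule c_near_1(2)[OF c0])
      also have "\<dots> = \<epsilon> * (\<epsilon> * (K * (\<bar>p x1\<bar> * \<bar>p x1\<bar>)))" using \<epsilon> by (simp add: abs_mult)
      also have "\<dots> \<le> \<epsilon> * (\<epsilon> * (K * (M * M)))"
        using \<epsilon> K_nonneg M bounds(1)[of x1] by (intro mult_left_mono mult_mono) auto
      also have "\<dots> \<le> \<epsilon> * (m / 2)" using \<epsilon>KM(1) \<epsilon> by (intro mult_left_mono) auto
      finally have 1: "\<bar>G (\<epsilon> * p x1) - \<epsilon> * p x1\<bar> \<le> \<epsilon> * m / 2" by simp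
      have "riem 1 0 x1 = \<epsilon> * (q x1 + p x1) + (G (\<epsilon> * p x1) - \<epsilon> * p x1)"
        by (simp add: riem_def v0 w0 algebra_simps)
      moreover have "\<bar>\<epsilon> * (q x1 + p x1)\<bar> = \<epsilon> * m" using \<epsilon> by (simp add: abs_mult m_def)
      ultimately show ?thesis using 1 by linarith
    qed
    have r2: "\<epsilon> * \<mu> / 2 \<le> riemx 1 0 x1"
    proof -
      have "\<bar>(c (\<epsilon> * p x1) - 1) * (\<epsilon> * p' x1)\<bar> \<le> (K * \<bar>\<epsilon> * p x1\<bar>) * \<bar>\<epsilon> * p' x1\<bar>"
        unfolding abs_mult[of "c (\<epsilon> * p x1) - 1"] by (intro mult_right_mono c_near_1(1)[OF c0]) auto
      also have "\<dots> = \<epsilon> * (\<epsilon> * (K * (\<bar>p x1\<bar> * \<bar>p' x1\<bar>)))" using \<epsilon> by (simp add: abs_mult)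
      also have "\<dots> \<le> \<epsilon> * (\<epsilon> * (K * (M * M)))"
        using \<epsilon> K_nonneg M bounds(1)[of x1] bounds(2)[of x1] by (intro mult_left_mono mult_mono) auto
      also have "\<dots> \<le> \<epsilon> * (\<mu> / 2)" using \<epsilon>KM(2) \<epsilon> by (intro mult_left_mono) auto
      finally have 1: "\<bar>(c (\<epsilon> * p x1) - 1) * (\<epsilon> * p' x1)\<bar> \<le> \<epsilon> * \<mu> / 2" by simp
      have "riemx 1 0 x1 = \<epsilon> * \<mu> + (c (\<epsilon> * p x1) - 1) * (\<epsilon> * p' x1)"
        by (simp add: riemx_def v0 vx0 wx0 \<mu>_def algebra_simps)
      then show ?thesis using 1 by linarith
    qed
    have dec: "\<bar>riem (- 1) 0 y\<bar> \<le> \<epsilon> * m / 2 / 2" if "y \<le> x1 - t1" for y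
    proof -
      have "y \<le> R" using that by (auto simp: t1_def)
      then have "2 * \<bar>p y\<bar> + \<bar>q y\<bar> \<le> m / 4" using R[of y] pos by linarith
      then have "\<epsilon> * (2 * \<bar>p y\<bar> + \<bar>q y\<bar>) \<le> \<epsilon> * (m / 4)" using \<epsilon> by (intro mult_left_mono) auto
      moreover have "\<bar>riem (- 1) 0 y\<bar> \<le> \<bar>\<epsilon> * q y\<bar> + 2 * \<bar>\<epsilon> * p y\<bar>"
        using G_abs_upper[of "\<epsilon> * p y"] by (simp add: riem_def v0 w0)
      moreover have "\<bar>\<epsilon> * q y\<bar> + 2 * \<bar>\<epsilon> * p y\<bar> = \<epsilon> * (2 * \<bar>p y\<bar> + \<bar>q y\<bar>)"
        using \<epsilon> by (simp add: abs_mult algebra_simps)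
      ultimately show ?thesis by simp
    qed
    have "T \<le> t1 + 12 / ((C * (\<epsilon> * m / 2 / 8) powr e) * (\<epsilon> * \<mu> / 2))"
      by (rule blowup_time[OF _ c'_lower C _ r1 _ r2 dec]) (use * pos \<epsilon> in \<open>auto simp: t1_def\<close>)
    also have "12 / ((C * (\<epsilon> * m / 2 / 8) powr e) * (\<epsilon> * \<mu> / 2)) = C2 * \<epsilon> powr (- (e + 1))"
    proof -
      have "(\<epsilon> * m / 2 / 8) powr e = \<epsilon> powr e * (m / 16) powr e"
        using powr_mult[of \<epsilon> "m / 16" e] \<epsilon> pos by simp
      moreover have "\<epsilon> powr (- (e + 1)) = 1 / (\<epsilon> powr e * \<epsilon>)"
        unfolding powr_minus powr_add using \<epsilon> by (simp add: inverse_eq_divide)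
      ultimately show ?thesis by (simp add: C2_def)
    qed
    also have "t1 + C2 * \<epsilon> powr (- (e + 1)) \<le> t1 * \<epsilon> powr (- (e + 1)) + C2 * \<epsilon> powr (- (e + 1))"
    proof -
      have "\<epsilon> powr (e + 1) \<le> 1 powr (e + 1)" using \<epsilon> C by (intro powr_mono2) auto
      then have "1 \<le> \<epsilon> powr (- (e + 1))"
        unfolding powr_minus using \<epsilon> by (intro one_le_inverse) auto
      then have "t1 * 1 \<le> t1 * \<epsilon> powr (- (e + 1))" by (intro mult_left_mono) (auto simp: t1_def)
      then show ?thesis by simp
    qed
    finally show "T \<le> (t1 + C2) * \<epsilon> powr (- (e + 1))" by (simp add: algebra_simps)
  qed
qed

end

context speed
begin

text \<open>In the second case the reflection carries the profiles to \<open>p (- x)\<close> and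
  \<open>- q (- x)\<close>. Their slopes are \<open>- p' (- x)\<close> and \<open>q' (- x)\<close>,
  so the sum of slopes at \<open>- x0\<close> is \<open>q' x0 - p' x0\<close>.\<close>

lemma lifespan_bound:
  fixes p p' q q' :: "real \<Rightarrow> real"
  assumes c0: "c 0 = 1"
    and c'_lower: "\<And>\<theta>. \<bar>\<theta>\<bar> \<le> \<delta> \<Longrightarrow> C * \<bar>\<theta>\<bar> powr e \<le> c' \<theta>" and C: "C > 0" "e \<ge> 0"
    and p: "\<And>x. (p has_real_derivative p' x) (at x)" and q: "\<And>x. (q has_real_derivative q' x) (at x)"
    and p'_cont: "continuous_on UNIV p'" and q'_cont: "continuous_on UNIV q'"
    and bounds: "\<And>x. \<bar>p x\<bar> \<le> M" "\<And>x. \<bar>p' x\<bar> \<le> M"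
    and decay: "(p \<longlongrightarrow> 0) at_infinity" "(q \<longlongrightarrow> 0) at_infinity"
    and x0: "q' x0 + p' x0 > 0 \<or> q' x0 - p' x0 > 0"
  shows "\<exists>\<epsilon>0>0. \<exists>C'>0. lifespan_le c \<delta> e p q \<epsilon>0 C'"
  using x0
proof
  assume pos: "q' x0 + p' x0 > 0"
  have cont: "isCont p' x0" "isCont q' x0"
    using p'_cont q'_cont by (auto simp: continuous_on_eq_continuous_at)
  show ?thesis
    by (rule lifespan_bound_plus[OF c0 c'_lower C p q cont bounds tendsto_mono[OF at_bot_le_at_infinity decay(1)]
        tendsto_mono[OF at_bot_le_at_infinity decay(2)] pos])
next
  assume pos: "q' x0 - p' x0 > 0"
  have m: "((\<lambda>x :: real. - x) has_real_derivative - 1) (at x)" for x by (auto intro!: derivative_eq_intros)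
  have lim: "((\<lambda>x. f (- x)) \<longlongrightarrow> 0) at_bot" if "(f \<longlongrightarrow> 0) at_infinity" for f :: "real \<Rightarrow> real"
    using tendsto_mono[OF at_top_le_at_infinity that] filterlim_at_bot_mirror[of "\<lambda>x. f (- x)"] by simp
  have p2: "((\<lambda>x. p (- x)) has_real_derivative - p' (- x)) (at x)" for x
    using DERIV_chain2[OF p m, of x] by simp
  have q2: "((\<lambda>x. - q (- x)) has_real_derivative q' (- x)) (at x)" for x
    using DERIV_minus[OF DERIV_chain2[OF q m, of x]] by simp
  have lq: "((\<lambda>x. - q (- x)) \<longlongrightarrow> 0) at_bot"
    using tendsto_minus[OF lim[OF decay(2)]] by simp
  have cont: "isCont (\<lambda>x. - p' (- x)) (- x0)" "isCont (\<lambda>x. q' (- x)) (- x0)"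
  proof -
    have "isCont p' (- (- x0))" "isCont q' (- (- x0))" using p'_cont q'_cont by (auto simp: continuous_on_eq_continuous_at)
    from isCont_o2[where f="\<lambda>x. - x", OF _ this(1)] isCont_o2[where f="\<lambda>x. - x", OF _ this(2)]
    show "isCont (\<lambda>x. - p' (- x)) (- x0)" "isCont (\<lambda>x. q' (- x)) (- x0)" by (auto intro!: continuous_intros)
  qed
  have b: "\<bar>p (- x)\<bar> \<le> M" "\<bar>- p' (- x)\<bar> \<le> M" for x using bounds by simp_all
  have "q' (- (- x0)) + - p' (- (- x0)) > 0" using pos by simp
  from lifespan_bound_plus[OF c0 c'_lower C p2 q2 cont b lim[OF decay(1)] lq this]
  obtain \<epsilon>0 C' where \<epsilon>0: "\<epsilon>0 > 0" "C' > 0"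
    and le: "lifespan_le c \<delta> e (\<lambda>x. p (- x)) (\<lambda>x. - q (- x)) \<epsilon>0 C'"
    by blast
  have "lifespan_le c \<delta> e p q \<epsilon>0 C'"
    unfolding lifespan_le_def
  proof (intro allI impI)
    fix \<epsilon> T N v w vx wx
    assume A: "0 < \<epsilon> \<and> \<epsilon> \<le> \<epsilon>0 \<and> 0 < T \<and> psystem c T v w vx wx \<and>
     (\<forall>t\<in>{0..<T}. \<forall>x. \<bar>vx t x\<bar> \<le> N \<and> \<bar>wx t x\<bar> \<le> N \<and> \<bar>v t x\<bar> \<le> \<delta>) \<and>
     (\<forall>x. v 0 x = \<epsilon> * p x) \<and> (\<forall>x. w 0 x = \<epsilon> * q x)"
    then have "psystem c T v w vx wx" by blast
    note refl = psystem_reflect[OF this]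
    show "T \<le> C' * \<epsilon> powr (- (e + 1))"
      by (rule le[unfolded lifespan_le_def, THEN spec[of _ \<epsilon>], THEN spec[of _ T], THEN spec[of _ N],
          THEN spec[of _ "\<lambda>t x. v t (- x)"], THEN spec[of _ "\<lambda>t x. - w t (- x)"],
          THEN spec[of _ "\<lambda>t x. - vx t (- x)"], THEN spec[of _ "\<lambda>t x. wx t (- x)"], THEN mp])
        (use A refl in simp)
  qed
  with \<epsilon>0 show ?thesis by blast
qed

text \<open>Uniform local solvability for the given speed \<open>c0\<close>, while \<open>G\<close>
  belongs to the extended speed. The bound on \<open>u\<close> grows by
  \<open>\<tau> * \<eta>\<close> because \<open>\<bar>u_t\<bar> \<le> \<eta>\<close>.\<close>

definition solvable where
  "solvable c0 \<eta> N \<tau> \<longleftrightarrow> (\<forall>u0 v0 v0' w0 w0'.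
    (\<forall>x. (u0 has_real_derivative v0 x) (at x)) \<and>
    (\<forall>x. (v0 has_real_derivative v0' x) (at x) \<and> \<bar>v0' x\<bar> \<le> N) \<and> continuous_on UNIV v0' \<and>
    (\<forall>x. (w0 has_real_derivative w0' x) (at x) \<and> \<bar>w0' x\<bar> \<le> N) \<and> continuous_on UNIV w0' \<and>
    (\<forall>x. \<bar>w0 x + G (v0 x)\<bar> \<le> \<eta> \<and> \<bar>w0 x - G (v0 x)\<bar> \<le> \<eta>) \<longrightarrow>
    (\<exists>u v w vx wx. c2sol c0 \<tau> u v w vx wx \<and> u 0 = u0 \<and> v 0 = v0 \<and> w 0 = w0 \<and>
      (\<forall>t\<in>{0..<\<tau>}. \<forall>x. \<bar>u t x\<bar> \<le> \<bar>u0 x\<bar> + \<tau> * \<eta> \<and> \<bar>v t x\<bar> \<le> 2 * \<eta> \<and> \<bar>w t x\<bar> \<le> \<eta> \<and>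
         \<bar>vx t x\<bar> \<le> 48 * N \<and> \<bar>wx t x\<bar> \<le> 48 * N)))"

text \<open>Solve with the extended speed; small invariants keep
  \<open>\<bar>v\<bar> \<le> \<delta>\<close>, where the solution does not see the difference
  between the speeds.\<close>

lemma local_c2sol:
  assumes eq: "\<forall>\<theta>. \<bar>\<theta>\<bar> \<le> \<delta> \<longrightarrow> c \<theta> = c0 \<theta>" and \<delta>: "0 < \<delta>" "4 * \<eta> \<le> \<delta>" and N: "N \<ge> 0"
  shows "\<exists>\<tau>>0. solvable c0 \<eta> N \<tau>"
proof -
  obtain \<tau> where h: "\<tau> > 0 \<and> (\<forall>v0 v0' w0 w0'.
    (\<forall>x. (v0 has_real_derivative v0' x) (at x) \<and> \<bar>v0' x\<bar> \<le> N) \<and> continuous_on UNIV v0' \<and>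
    (\<forall>x. (w0 has_real_derivative w0' x) (at x) \<and> \<bar>w0' x\<bar> \<le> N) \<and> continuous_on UNIV w0' \<longrightarrow>
    (\<exists>v w vx wx. psystem c \<tau> v w vx wx \<and> (\<forall>x. v 0 x = v0 x) \<and> (\<forall>x. w 0 x = w0 x) \<and>
      (\<forall>t\<in>{0..<\<tau>}. \<forall>x. \<bar>vx t x\<bar> \<le> 48 * N \<and> \<bar>wx t x\<bar> \<le> 48 * N)))"
    by (rule exE[OF local_existence[OF N]]) (rule that)
  note \<tau> = conjunct1[OF h] and ex = conjunct2[OF h]
  show ?thesis
  proof (rule exI[of _ \<tau>], rule conjI[OF \<tau>], unfold solvable_def, intro allI impI)
    fix u0 v0 v0' w0 w0'
    assume A: "(\<forall>x. (u0 has_real_derivative v0 x) (at x)) \<and>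
      (\<forall>x. (v0 has_real_derivative v0' x) (at x) \<and> \<bar>v0' x\<bar> \<le> N) \<and> continuous_on UNIV v0' \<and>
      (\<forall>x. (w0 has_real_derivative w0' x) (at x) \<and> \<bar>w0' x\<bar> \<le> N) \<and> continuous_on UNIV w0' \<and>
      (\<forall>x. \<bar>w0 x + G (v0 x)\<bar> \<le> \<eta> \<and> \<bar>w0 x - G (v0 x)\<bar> \<le> \<eta>)"
    have u0: "(u0 has_real_derivative v0 x) (at x)" for x using A by blast
    have init: "\<bar>w0 x + G (v0 x)\<bar> \<le> \<eta>" "\<bar>w0 x - G (v0 x)\<bar> \<le> \<eta>" for x using A by blast+
    have data: "(\<forall>x. (v0 has_real_derivative v0' x) (at x) \<and> \<bar>v0' x\<bar> \<le> N) \<and> continuous_on UNIV v0' \<and>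
      (\<forall>x. (w0 has_real_derivative w0' x) (at x) \<and> \<bar>w0' x\<bar> \<le> N) \<and> continuous_on UNIV w0'"
      using A by blast
    note ex' = mp[OF ex[THEN spec, THEN spec, THEN spec, THEN spec] data]
    obtain v w vx wx where h': "psystem c \<tau> v w vx wx \<and> (\<forall>x. v 0 x = v0 x) \<and> (\<forall>x. w 0 x = w0 x) \<and>
      (\<forall>t\<in>{0..<\<tau>}. \<forall>x. \<bar>vx t x\<bar> \<le> 48 * N \<and> \<bar>wx t x\<bar> \<le> 48 * N)"
      by (rule exE[OF ex'], erule exE, erule exE, erule exE) (rule that)
    have s: "psystem c \<tau> v w vx wx" and i: "\<And>x. v 0 x = v0 x" "\<And>x. w 0 x = w0 x"
      and b: "\<And>t x. t \<in> {0..<\<tau>} \<Longrightarrow> \<bar>vx t x\<bar> \<le> 48 * N \<and> \<bar>wx t x\<bar> \<le> 48 * N"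
      using h' by simp_all
    have i': "v 0 = v0" "w 0 = w0" using i by auto
    have riem0: "\<forall>x. \<bar>w 0 x + G (v 0 x)\<bar> \<le> \<eta> \<and> \<bar>w 0 x - G (v 0 x)\<bar> \<le> \<eta>"
      unfolding i using init by blast
    have bound: "\<forall>t\<in>{0..<\<tau>}. \<forall>x. \<bar>vx t x\<bar> \<le> 48 * N \<and> \<bar>wx t x\<bar> \<le> 48 * N"
      using h' by blast
    have "\<forall>\<theta>. \<bar>\<theta>\<bar> \<le> \<delta> \<longrightarrow> c \<theta> = c \<theta>" by simp
    note small_all = small_solution(2)[OF s this bound riem0 \<delta>]
    have small: "\<bar>v t x\<bar> \<le> 2 * \<eta>" "\<bar>w t x\<bar> \<le> \<eta>" if "t \<in> {0..<\<tau>}" for t x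
      using small_all that by blast+
    have \<eta>: "\<eta> \<ge> 0" using init(1)[of 0] by linarith
    have v\<delta>: "\<bar>v t x\<bar> \<le> \<delta>" if "t \<in> {0..<\<tau>}" for t x
      using small(1)[OF that, of x] \<delta> \<eta> by linarith
    have s': "psystem c0 \<tau> v w vx wx"
      by (rule psystem_cong_speed[OF s order_refl eq[rule_format, OF v\<delta>]])
    define u where "u t x = u0 x + oint 0 t (\<lambda>s. w s x)" for t x
    have sol: "c2sol c0 \<tau> u v w vx wx"
      unfolding u_def[abs_def] by (rule psystem_c2sol[OF s']) (simp add: i' u0)
    have u_init: "u 0 = u0" by (simp add: u_def[abs_def])
    have bounds: "\<forall>t\<in>{0..<\<tau>}. \<forall>x. \<bar>u t x\<bar> \<le> \<bar>u0 x\<bar> + \<tau> * \<eta> \<and> \<bar>v t x\<bar> \<le> 2 * \<eta> \<and> \<bar>w t x\<bar> \<le> \<eta> \<and>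
         \<bar>vx t x\<bar> \<le> 48 * N \<and> \<bar>wx t x\<bar> \<le> 48 * N"
    proof (rule ballI, rule allI)
      fix t x assume t: "t \<in> {0..<\<tau>}"
      have seg: "closed_segment 0 t \<subseteq> {0..<\<tau>}" using t by (auto simp: closed_segment_eq_real_ivl)
      have "\<bar>w z x\<bar> \<le> \<eta>" if "z \<in> closed_segment 0 t" for z
        by (rule small(2)) (use seg that in blast)
      from oint_bound[OF this strip_slice[OF psystem_continuous(2)[OF s] seg]]
      have "\<bar>oint 0 t (\<lambda>s. w s x)\<bar> \<le> \<bar>t - 0\<bar> * \<eta>" .
      also have "\<bar>t - 0\<bar> * \<eta> \<le> \<tau> * \<eta>" using t \<eta> by (intro mult_right_mono) auto
      finally have "\<bar>u t x\<bar> \<le> \<bar>u0 x\<bar> + \<tau> * \<eta>" unfolding u_def by linarith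
      then show "\<bar>u t x\<bar> \<le> \<bar>u0 x\<bar> + \<tau> * \<eta> \<and> \<bar>v t x\<bar> \<le> 2 * \<eta> \<and> \<bar>w t x\<bar> \<le> \<eta> \<and>
         \<bar>vx t x\<bar> \<le> 48 * N \<and> \<bar>wx t x\<bar> \<le> 48 * N"
        using small[OF t, of x] b[OF t, of x] by simp
    qed
    show "\<exists>u v w vx wx. c2sol c0 \<tau> u v w vx wx \<and> u 0 = u0 \<and> v 0 = v0 \<and> w 0 = w0 \<and>
      (\<forall>t\<in>{0..<\<tau>}. \<forall>x. \<bar>u t x\<bar> \<le> \<bar>u0 x\<bar> + \<tau> * \<eta> \<and> \<bar>v t x\<bar> \<le> 2 * \<eta> \<and> \<bar>w t x\<bar> \<le> \<eta> \<and>
         \<bar>vx t x\<bar> \<le> 48 * N \<and> \<bar>wx t x\<bar> \<le> 48 * N)"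
      by (rule exI[of _ u], rule exI[of _ v], rule exI[of _ w], rule exI[of _ vx], rule exI[of _ wx])
        (intro conjI sol u_init i' bounds)
  qed
qed

end

section \<open>Extension of the speed to the line\<close>

text \<open>The derivative is extended rather than the function: \<open>c'\<close> is frozen outside
  \<open>{- \<delta>..\<delta>}\<close>, faded out linearly up to distance
  \<open>2 * \<delta>\<close>, and integrated. Differentiability of the result is then
  automatic.\<close>

lemma speed_extension:
  fixes c c' :: "real \<Rightarrow> real"
  assumes d: "d > 0" and c0: "c 0 = 1"
    and c': "\<And>x. \<bar>x\<bar> \<le> d \<Longrightarrow> (c has_real_derivative c' x) (at x)" and cont: "continuous_on {- d..d} c'"
  obtains \<delta> ct ct' G K where "0 < \<delta>" "\<delta> \<le> d" "speed ct ct' G K"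
    "\<And>x. \<bar>x\<bar> \<le> \<delta> \<Longrightarrow> ct x = c x" "\<And>x. \<bar>x\<bar> \<le> \<delta> \<Longrightarrow> ct' x = c' x"
proof -
  obtain K where K: "\<And>x. x \<in> {- d..d} \<Longrightarrow> \<bar>c' x\<bar> \<le> K"
  proof -
    have "bounded (c' ` {- d..d})" by (rule compact_imp_bounded[OF compact_continuous_image[OF cont]]) simp
    then obtain a where "\<And>x. x \<in> {- d..d} \<Longrightarrow> norm (c' x) \<le> a" unfolding bounded_iff by blast
    then show ?thesis by (intro that[of a]) (simp add: real_norm_def)
  qed
  have K0: "K \<ge> 0" using K[of 0] d by auto
  \<comment> \<open>The derivative is at most \<open>K\<close> and lives on distance
    \<open>2 * \<delta>\<close> from 0, so the speed departs from 1 by at most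
    \<open>2 * \<delta> * K \<le> 1 / 2\<close>.\<close>
  define \<delta> where "\<delta> = min d (1 / (4 * (K + 1)))"
  have \<delta>: "\<delta> > 0" "\<delta> \<le> d" using d K0 by (auto simp: \<delta>_def)
  have "\<delta> * (4 * (K + 1)) \<le> 1"
    using K0 unfolding \<delta>_def by (subst pos_le_divide_eq[symmetric]) auto
  then have \<delta>K: "2 * \<delta> * K \<le> 1 / 2" using \<delta> by (simp add: algebra_simps)
  define cut where "cut x = max 0 (min 1 (2 - \<bar>x\<bar> / \<delta>))" for x
  define k where "k x = c' (max (- \<delta>) (min \<delta> x)) * cut x" for x
  have cut: "0 \<le> cut x" "cut x \<le> 1" for x by (auto simp: cut_def)
  have cl: "max (- \<delta>) (min \<delta> x) \<in> {- d..d}" for x using \<delta> by auto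
  have k_bd: "\<bar>k x\<bar> \<le> K" for x
    unfolding k_def abs_mult using K[OF cl[of x]] cut[of x] K0 mult_mono[of "\<bar>c' (max (- \<delta>) (min \<delta> x))\<bar>" K "\<bar>cut x\<bar>" 1] by simp
  have k_eq: "k x = c' x" if "\<bar>x\<bar> \<le> \<delta>" for x
  proof -
    have "\<bar>x\<bar> / \<delta> \<le> 1" using that \<delta> by simp
    then have "cut x = 1" by (simp add: cut_def)
    moreover have "max (- \<delta>) (min \<delta> x) = x" using that by auto
    ultimately show ?thesis by (simp add: k_def)
  qed
  have k_0: "k x = 0" if "\<bar>x\<bar> \<ge> 2 * \<delta>" for x
  proof -
    have "\<bar>x\<bar> / \<delta> \<ge> 2" using that \<delta> by (simp add: pos_le_divide_eq)
    then show ?thesis by (simp add: k_def cut_def)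
  qed
  have k_cont: "continuous_on UNIV k"
    unfolding k_def cut_def using \<delta> cl
    by (intro continuous_intros continuous_on_compose2[OF cont]) auto
  obtain ct where ct: "ct 0 = 1" "\<And>x. (ct has_real_derivative k x) (at x)"
    by (rule antiderivative_UNIV[OF k_cont, of 0 1]) (rule that; assumption)
  have near: "\<bar>ct x - 1\<bar> \<le> 1 / 2" for x
  proof -
    \<comment> \<open>\<open>y\<close> is the point nearest to \<open>x\<close> in the interval
      outside of which \<open>k\<close> vanishes, so \<open>ct\<close> has the same value at
      \<open>x\<close> and \<open>y\<close>.\<close>
    define y where "y = max (- 2 * \<delta>) (min (2 * \<delta>) x)"
    have "norm (ct y - ct 0) \<le> K * norm (y - 0)"
      by (rule field_differentiable_bound[of UNIV ct k]) (use ct k_bd in auto)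
    also have "\<dots> \<le> K * (2 * \<delta>)" using K0 \<delta> by (intro mult_left_mono) (auto simp: y_def)
    finally have 1: "\<bar>ct y - 1\<bar> \<le> 1 / 2" using \<delta>K ct(1) by (simp add: mult_ac)
    have "norm (ct x - ct y) \<le> 0 * norm (x - y)" if "x \<noteq> y"
    proof (rule field_differentiable_bound[of "closed_segment y x" ct k])
      fix z assume z: "z \<in> closed_segment y x"
      show "(ct has_real_derivative k z) (at z within closed_segment y x)" by (rule has_field_derivative_at_within[OF ct(2)])
      show "norm (k z) \<le> 0"
      proof -
        have "\<bar>z\<bar> \<ge> 2 * \<delta>"
          using z \<delta> that by (auto simp: y_def closed_segment_eq_real_ivl max_def min_def split: if_splits)
        then show ?thesis by (simp add: k_0)
      qed
    qed auto
    then show ?thesis using 1 by (cases "x = y") simp_all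
  qed
  have ct_cont: "continuous_on UNIV ct"
    by (meson DERIV_isCont ct(2) continuous_at_imp_continuous_on)
  obtain G where G: "G 0 = 0" "\<And>x. (G has_real_derivative ct x) (at x)"
    by (rule antiderivative_UNIV[OF ct_cont, of 0 0]) (rule that; assumption)
  show ?thesis
  proof (rule that[OF \<delta>])
    show "speed ct k G K"
    proof
      show "1 / 2 \<le> ct x" "ct x \<le> 2" for x using near[of x] unfolding abs_le_iff by linarith+
    qed (fact ct k_cont k_bd G)+
    show "k x = c' x" if "\<bar>x\<bar> \<le> \<delta>" for x by (rule k_eq[OF that])
    fix x :: real assume x: "\<bar>x\<bar> \<le> \<delta>"
    have "norm ((ct x - c x) - (ct 0 - c 0)) \<le> 0 * norm (x - 0)"
    proof (rule field_differentiable_bound[of "{- \<delta>..\<delta>}" "\<lambda>x. ct x - c x" "\<lambda>_. 0"])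
      fix z assume "z \<in> {- \<delta>..\<delta>}"
      then have z: "\<bar>z\<bar> \<le> \<delta>" "\<bar>z\<bar> \<le> d" using \<delta> by auto
      show "((\<lambda>x. ct x - c x) has_real_derivative 0) (at z within {- \<delta>..\<delta>})"
        using has_field_derivative_at_within[OF DERIV_diff[OF ct(2) c'[OF z(2)]]] k_eq[OF z(1)] by simp
    qed (use x \<delta> in \<open>auto simp: abs_le_iff\<close>)
    then show "ct x = c x" using ct(1) c0 by simp
  qed
qed

section \<open>Continuation of small solutions\<close>

locale small_data = speed +
  fixes U :: "real set" and c0 f f1 f2 g g1 :: "real \<Rightarrow> real" and \<delta> \<eta> M :: real
  assumes c0: "\<forall>\<theta>. \<bar>\<theta>\<bar> \<le> \<delta> \<longrightarrow> c \<theta> = c0 \<theta>"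
    and U: "{- \<delta>..\<delta>} \<subseteq> U"
    and \<delta>: "0 < \<delta>" "4 * \<eta> \<le> \<delta>"
    and f_deriv: "(f has_real_derivative f1 x) (at x)"
    and f1_deriv: "(f1 has_real_derivative f2 x) (at x)"
    and g_deriv: "(g has_real_derivative g1 x) (at x)"
    and f2_cont: "continuous_on UNIV f2" and g1_cont: "continuous_on UNIV g1"
    and f_bound: "\<bar>f x\<bar> \<le> M" and f2_bound: "\<bar>f2 x\<bar> \<le> M" and g1_bound: "\<bar>g1 x\<bar> \<le> M"
    and init: "\<bar>g x + G (f1 x)\<bar> \<le> \<eta> \<and> \<bar>g x - G (f1 x)\<bar> \<le> \<eta>"
begin

lemma \<eta>_nonneg: "\<eta> \<ge> 0"
  using init[of 0] by linarith

lemma admissible_props: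
  assumes adm: "admissible_solution U c0 f g T u" and T: "0 < T"
  shows "c2sol c0 T u (dx u) (dt u) (dx (dx u)) (dx (dt u))"
    and "psystem c T (dx u) (dt u) (dx (dx u)) (dx (dt u))"
    and "u 0 = f" "dx u 0 = f1" "dt u 0 = g"
    and "\<exists>N. \<forall>t\<in>{0..<T}. \<forall>x. \<bar>u t x\<bar> \<le> N \<and> \<bar>dx (dx u) t x\<bar> \<le> N \<and> \<bar>dx (dt u) t x\<bar> \<le> N"
    and "\<forall>t\<in>{0..<T}. \<forall>x. \<bar>dx u t x\<bar> \<le> 2 * \<eta> \<and> \<bar>dt u t x\<bar> \<le> \<eta> \<and>
      \<bar>dt u t x + G (dx u t x)\<bar> \<le> \<eta> \<and> \<bar>dt u t x - G (dx u t x)\<bar> \<le> \<eta>"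
proof -
  have cl: "classical_solution c0 f g T u" using adm by (simp add: admissible_solution_def)
  show sol: "c2sol c0 T u (dx u) (dt u) (dx (dx u)) (dx (dt u))" by (rule classical_c2sol[OF cl])
  show u0: "u 0 = f" "dt u 0 = g" using cl by (auto simp: classical_solution_def)
  have zero: "0 \<in> {0..<T}" using T by simp
  show v0: "dx u 0 = f1"
  proof (rule ext)
    fix x show "dx u 0 x = f1 x" by (rule dx_eqI) (simp add: u0 f_deriv)
  qed
  obtain N where N: "\<And>t x. t \<in> {0..<T} \<Longrightarrow> \<bar>u t x\<bar> \<le> N \<and> \<bar>dt u t x\<bar> \<le> N \<and> \<bar>dx u t x\<bar> \<le> N \<and> \<bar>dx (dt u) t x\<bar> \<le> N \<and> \<bar>dx (dx u) t x\<bar> \<le> N"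
    by (rule admissible_bounds[OF adm]) (rule that; assumption)
  have N': "\<forall>t\<in>{0..<T}. \<forall>x. \<bar>u t x\<bar> \<le> N \<and> \<bar>dx (dx u) t x\<bar> \<le> N \<and> \<bar>dx (dt u) t x\<bar> \<le> N"
    using N by simp
  then show "\<exists>N. \<forall>t\<in>{0..<T}. \<forall>x. \<bar>u t x\<bar> \<le> N \<and> \<bar>dx (dx u) t x\<bar> \<le> N \<and> \<bar>dx (dt u) t x\<bar> \<le> N"
    by (rule exI[of _ N])
  have s: "psystem c0 T (dx u) (dt u) (dx (dx u)) (dx (dt u))" using sol by (simp add: c2sol_def)
  have bound: "\<forall>t\<in>{0..<T}. \<forall>x. \<bar>dx (dx u) t x\<bar> \<le> N \<and> \<bar>dx (dt u) t x\<bar> \<le> N"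
    using N' by blast
  have riem0: "\<forall>x. \<bar>dt u 0 x + G (dx u 0 x)\<bar> \<le> \<eta> \<and> \<bar>dt u 0 x - G (dx u 0 x)\<bar> \<le> \<eta>"
    unfolding u0 v0 using init by blast
  have eq: "\<forall>\<theta>. \<bar>\<theta>\<bar> \<le> \<delta> \<longrightarrow> c0 \<theta> = c \<theta>" using c0 by simp
  show "psystem c T (dx u) (dt u) (dx (dx u)) (dx (dt u))"
    by (rule small_solution(1)[OF s eq bound riem0 \<delta>])
  show "\<forall>t\<in>{0..<T}. \<forall>x. \<bar>dx u t x\<bar> \<le> 2 * \<eta> \<and> \<bar>dt u t x\<bar> \<le> \<eta> \<and>
      \<bar>dt u t x + G (dx u t x)\<bar> \<le> \<eta> \<and> \<bar>dt u t x - G (dx u t x)\<bar> \<le> \<eta>"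
    by (rule small_solution(2)[OF s eq bound riem0 \<delta>])
qed

lemma small_admissible:
  assumes sol: "c2sol c0 T u v w vx wx" and T: "T > 0" and i: "u 0 = f" "w 0 = g"
    and b: "\<And>t x. t \<in> {0..<T} \<Longrightarrow> \<bar>u t x\<bar> \<le> B \<and> \<bar>v t x\<bar> \<le> 2 * \<eta> \<and> \<bar>w t x\<bar> \<le> \<eta> \<and> \<bar>vx t x\<bar> \<le> B \<and> \<bar>wx t x\<bar> \<le> B"
  shows "admissible_solution U c0 f g T u"
proof -
  have s: "psystem c0 T v w vx wx" using sol by (simp add: c2sol_def)
  have v: "c (v t x) = c0 (v t x)" "\<bar>v t x\<bar> \<le> \<delta>" if "t \<in> {0..<T}" for t x
  proof -
    show "\<bar>v t x\<bar> \<le> \<delta>" using b[OF that, of x] \<delta> \<eta>_nonneg by linarith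
    then show "c (v t x) = c0 (v t x)" using c0 by blast
  qed
  have "continuous_on ({0..<T} \<times> UNIV) (\<lambda>p. c (v (fst p) (snd p)))"
    using continuous_on_compose2[OF c_cont psystem_continuous(1)[OF s] subset_UNIV] by (simp add: split_beta)
  then have "continuous_on ({0..<T} \<times> UNIV) (\<lambda>p. c0 (v (fst p) (snd p)))"
    by (rule continuous_on_eq) (use v(1) in \<open>simp add: mem_Times_iff\<close>)
  then have cv: "continuous_on ({0..<T} \<times> UNIV) (\<lambda>(t, x). c0 (v t x))" by (simp add: split_beta)
  have bounds: "\<bar>v t x\<bar> \<le> \<delta> \<and> \<bar>c0 (v t x)\<bar> \<le> 2 \<and> \<bar>u t x\<bar> \<le> max B (2 * \<eta>) \<and> \<bar>v t x\<bar> \<le> max B (2 * \<eta>) \<and> \<bar>w t x\<bar> \<le> max B (2 * \<eta>) \<and>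
       \<bar>vx t x\<bar> \<le> max B (2 * \<eta>) \<and> \<bar>wx t x\<bar> \<le> max B (2 * \<eta>)" if t: "t \<in> {0..<T}" for t x
  proof -
  have "\<bar>c0 (v t x)\<bar> \<le> 2"
    using c_upper[of "v t x"] c_pos[of "v t x"] v(1)[OF t, of x] by simp
  moreover have "B \<le> max B (2 * \<eta>)" "2 * \<eta> \<le> max B (2 * \<eta>)" by simp_all
  ultimately show ?thesis
    using v(2)[OF t, of x] b[OF t, of x] \<eta>_nonneg by linarith
  qed
  have "u 0 x = f x" "w 0 x = g x" for x by (simp_all add: i)
  from admissibleI[OF sol T this U cv bounds] show ?thesis by blast
qed

lemma short_time_solution: "\<exists>\<tau>>0. \<exists>u. admissible_solution U c0 f g \<tau> u"
proof -
  have M: "M \<ge> 0" using f_bound[of 0] by linarith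
  obtain \<tau> where \<tau>: "\<tau> > 0" and solv: "solvable c0 \<eta> M \<tau>"
    using local_c2sol[OF c0 \<delta> M] by blast
  note ex = solv[unfolded solvable_def, THEN spec[of _ f], THEN spec[of _ f1], THEN spec[of _ f2], THEN spec[of _ g], THEN spec[of _ g1], THEN mp]
  have "\<exists>u v w vx wx. c2sol c0 \<tau> u v w vx wx \<and> u 0 = f \<and> v 0 = f1 \<and> w 0 = g \<and>
      (\<forall>t\<in>{0..<\<tau>}. \<forall>x. \<bar>u t x\<bar> \<le> \<bar>f x\<bar> + \<tau> * \<eta> \<and> \<bar>v t x\<bar> \<le> 2 * \<eta> \<and> \<bar>w t x\<bar> \<le> \<eta> \<and>
         \<bar>vx t x\<bar> \<le> 48 * M \<and> \<bar>wx t x\<bar> \<le> 48 * M)"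
    by (rule ex) (simp add: f_deriv f1_deriv g_deriv f2_cont g1_cont f2_bound g1_bound init)
  then obtain u v w vx wx where sol: "c2sol c0 \<tau> u v w vx wx" and i: "u 0 = f" "w 0 = g"
    and b: "\<forall>t\<in>{0..<\<tau>}. \<forall>x. \<bar>u t x\<bar> \<le> \<bar>f x\<bar> + \<tau> * \<eta> \<and> \<bar>v t x\<bar> \<le> 2 * \<eta> \<and> \<bar>w t x\<bar> \<le> \<eta> \<and>
         \<bar>vx t x\<bar> \<le> 48 * M \<and> \<bar>wx t x\<bar> \<le> 48 * M"
    by blast
  have te: "\<tau> * \<eta> \<ge> 0" using \<tau> \<eta>_nonneg by simp
  have "admissible_solution U c0 f g \<tau> u"
  proof (rule small_admissible[OF sol \<tau> i, where B="48 * M + \<tau> * \<eta>"])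
    fix t x assume t: "t \<in> {0..<\<tau>}"
    have "\<bar>u t x\<bar> \<le> \<bar>f x\<bar> + \<tau> * \<eta> \<and> \<bar>v t x\<bar> \<le> 2 * \<eta> \<and> \<bar>w t x\<bar> \<le> \<eta> \<and> \<bar>vx t x\<bar> \<le> 48 * M \<and> \<bar>wx t x\<bar> \<le> 48 * M"
      using b t by blast
    then show "\<bar>u t x\<bar> \<le> 48 * M + \<tau> * \<eta> \<and> \<bar>v t x\<bar> \<le> 2 * \<eta> \<and> \<bar>w t x\<bar> \<le> \<eta> \<and> \<bar>vx t x\<bar> \<le> 48 * M + \<tau> * \<eta> \<and> \<bar>wx t x\<bar> \<le> 48 * M + \<tau> * \<eta>"
      using f_bound[of x] te M by linarith
  qed
  with \<tau> show ?thesis by blast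
qed

text \<open>Restart at \<open>t0\<close> and glue. The size \<open>\<eta>\<close> of the invariants
  does not grow, so the step \<open>\<tau>\<close> depends on the slope bound \<open>N\<close> but
  neither on \<open>t0\<close> nor on the solution.\<close>

lemma continuation:
  assumes N: "N \<ge> 0"
  shows "\<exists>\<tau>>0. \<forall>T u t0. admissible_solution U c0 f g T u \<and> 0 < t0 \<and> t0 < T \<and>
    (\<forall>x. \<bar>dx (dx u) t0 x\<bar> \<le> N \<and> \<bar>dx (dt u) t0 x\<bar> \<le> N) \<longrightarrow>
    (\<exists>u'. admissible_solution U c0 f g (t0 + \<tau>) u')"
proof -
  obtain \<tau> where \<tau>: "\<tau> > 0" and solv: "solvable c0 \<eta> N \<tau>"
    using local_c2sol[OF c0 \<delta> N] by blast
  have "\<exists>u'. admissible_solution U c0 f g (t0 + \<tau>) u'"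
    if adm: "admissible_solution U c0 f g T u" and t0: "0 < t0" "t0 < T"
      and bN: "\<And>x. \<bar>dx (dx u) t0 x\<bar> \<le> N \<and> \<bar>dx (dt u) t0 x\<bar> \<le> N" for T u t0
  proof -
    have T: "0 < T" and t0': "t0 \<in> {0..<T}" using t0 by auto
    note props = admissible_props[OF adm T]
    obtain N2 where N2: "\<forall>t\<in>{0..<T}. \<forall>x. \<bar>u t x\<bar> \<le> N2 \<and> \<bar>dx (dx u) t x\<bar> \<le> N2 \<and> \<bar>dx (dt u) t x\<bar> \<le> N2"
      using props(6) by blast
    have d: "(u t0 has_real_derivative dx u t0 x) (at x)" "(dx u t0 has_real_derivative dx (dx u) t0 x) (at x)"
      "(dt u t0 has_real_derivative dx (dt u) t0 x) (at x)" for x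
      using props(1) t0' unfolding c2sol_def psystem_def by blast+
    have cont: "continuous_on ({0..<T} \<times> UNIV) (\<lambda>(t, x). dx (dx u) t x)" "continuous_on ({0..<T} \<times> UNIV) (\<lambda>(t, x). dx (dt u) t x)"
      using props(1) unfolding c2sol_def psystem_def by blast+
    have riem: "\<bar>dt u t0 x + G (dx u t0 x)\<bar> \<le> \<eta> \<and> \<bar>dt u t0 x - G (dx u t0 x)\<bar> \<le> \<eta>" for x
      using props(7) t0' by blast
    note ex = solv[unfolded solvable_def, THEN spec[of _ "u t0"], THEN spec[of _ "dx u t0"], THEN spec[of _ "dx (dx u) t0"],
        THEN spec[of _ "dt u t0"], THEN spec[of _ "dx (dt u) t0"], THEN mp]
    have "\<exists>u' v w vx wx. c2sol c0 \<tau> u' v w vx wx \<and> u' 0 = u t0 \<and> v 0 = dx u t0 \<and> w 0 = dt u t0 \<and>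
      (\<forall>t\<in>{0..<\<tau>}. \<forall>x. \<bar>u' t x\<bar> \<le> \<bar>u t0 x\<bar> + \<tau> * \<eta> \<and> \<bar>v t x\<bar> \<le> 2 * \<eta> \<and> \<bar>w t x\<bar> \<le> \<eta> \<and>
         \<bar>vx t x\<bar> \<le> 48 * N \<and> \<bar>wx t x\<bar> \<le> 48 * N)"
      by (rule ex) (intro conjI allI d bN[THEN conjunct1] bN[THEN conjunct2] riem[THEN conjunct1] riem[THEN conjunct2]
          strip_slice_x[OF cont(1) t0'] strip_slice_x[OF cont(2) t0'])
    then obtain u' v w vx wx where sol: "c2sol c0 \<tau> u' v w vx wx" and i: "u' 0 = u t0" "v 0 = dx u t0" "w 0 = dt u t0"
      and b: "\<forall>t\<in>{0..<\<tau>}. \<forall>x. \<bar>u' t x\<bar> \<le> \<bar>u t0 x\<bar> + \<tau> * \<eta> \<and> \<bar>v t x\<bar> \<le> 2 * \<eta> \<and> \<bar>w t x\<bar> \<le> \<eta> \<and>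
         \<bar>vx t x\<bar> \<le> 48 * N \<and> \<bar>wx t x\<bar> \<le> 48 * N"
      by blast
    note glued = c2sol_glue[OF props(1) sol t0 \<tau> i]
    have te: "\<tau> * \<eta> \<ge> 0" using \<tau> \<eta>_nonneg by simp
    have N2_0: "N2 \<ge> 0" using N2[rule_format, OF t0', of 0] by linarith
    have "admissible_solution U c0 f g (t0 + \<tau>) (glue t0 u u')"
    proof (rule small_admissible[OF glued, where B="48 * N + N2 + \<tau> * \<eta>"])
      show "t0 + \<tau> > 0" using t0 \<tau> by simp
      show "glue t0 u u' 0 = f" "glue t0 (dt u) w 0 = g" using t0 props(3,5) by (simp_all add: glue_def)
      fix t x assume t: "t \<in> {0..<t0 + \<tau>}"
      show "\<bar>glue t0 u u' t x\<bar> \<le> 48 * N + N2 + \<tau> * \<eta> \<and> \<bar>glue t0 (dx u) v t x\<bar> \<le> 2 * \<eta> \<and> \<bar>glue t0 (dt u) w t x\<bar> \<le> \<eta> \<and>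
        \<bar>glue t0 (dx (dx u)) vx t x\<bar> \<le> 48 * N + N2 + \<tau> * \<eta> \<and> \<bar>glue t0 (dx (dt u)) wx t x\<bar> \<le> 48 * N + N2 + \<tau> * \<eta>"
      proof (cases "t \<le> t0")
        case True
        then have t': "t \<in> {0..<T}" using t t0 by auto
        show ?thesis
          using N2[rule_format, OF t', of x] props(7)[rule_format, OF t', of x] True te N by (simp add: glue_def)
      next
        case False
        then have t': "t - t0 \<in> {0..<\<tau>}" using t by auto
        show ?thesis
          using b[rule_format, OF t', of x] N2[rule_format, OF t0', of x] False te N N2_0 by (simp add: glue_def)
      qed
    qed
    then show ?thesis by blast
  qed
  with \<tau> show ?thesis by blast
qed

lemma lifespan_pos: "lifespan U c0 f g > 0"
proof -
  obtain \<tau> u where "\<tau> > 0" "admissible_solution U c0 f g \<tau> u" using short_time_solution by blast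
  then have "ereal \<tau> \<le> lifespan U c0 f g"
    unfolding lifespan_def by (intro Sup_upper) auto
  moreover have "0 < ereal \<tau>" using \<open>\<tau> > 0\<close> by simp
  ultimately show ?thesis by (rule less_le_trans[rotated])
qed

text \<open>A finite limit superior would bound the second derivatives at all times shortly before
  \<open>L\<close>. Restarting less than one step before \<open>L\<close> would then produce an
  admissible solution beyond the lifespan.\<close>

lemma limsup_infinite:
  assumes L: "lifespan U c0 f g = ereal L" and u: "maximal_solution U c0 f g u"
  shows "Limsup (at_left L) (\<lambda>t. Linf_norm (dx (dt u) t) + Linf_norm (dx (dx u) t)) = \<infinity>"
proof (rule ccontr)
  let ?F = "\<lambda>t. Linf_norm (dx (dt u) t) + Linf_norm (dx (dx u) t)"
  assume "Limsup (at_left L) ?F \<noteq> \<infinity>"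
  then have "Limsup (at_left L) ?F < \<infinity>" by simp
  then obtain N0 where "Limsup (at_left L) ?F < ereal N0"
    using less_PInf_Ex_of_nat by fastforce
  then have "eventually (\<lambda>t. ?F t < ereal N0) (at_left L)" by (rule Limsup_lessD)
  then obtain a where a: "a < L" "\<And>t. a < t \<Longrightarrow> t < L \<Longrightarrow> ?F t < ereal N0"
    using eventually_at_left[of "L - 1" L] by auto
  have Lpos: "L > 0" using lifespan_pos L by simp
  define N where "N = \<bar>N0\<bar>"
  have "N \<ge> 0" by (simp add: N_def)
  from continuation[OF this] obtain \<tau> where \<tau>: "\<tau> > 0" and cont: "\<And>T u t0. admissible_solution U c0 f g T u \<and> 0 < t0 \<and> t0 < T \<and>
    (\<forall>x. \<bar>dx (dx u) t0 x\<bar> \<le> N \<and> \<bar>dx (dt u) t0 x\<bar> \<le> N) \<Longrightarrow> \<exists>u'. admissible_solution U c0 f g (t0 + \<tau>) u'"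
    by blast
  \<comment> \<open>\<open>t0\<close>, halfway from \<open>m\<close> to \<open>L\<close>, lies where
    the bound holds and less than \<open>\<tau>\<close> before \<open>L\<close>.\<close>
  define m where "m = max a (max 0 (L - \<tau>))"
  have m: "m < L" "a \<le> m" "0 \<le> m" "L - \<tau> \<le> m" using a(1) Lpos \<tau> by (auto simp: m_def)
  define t0 where "t0 = (m + L) / 2"
  \<comment> \<open>The maximal solution is known to be admissible only on intervals ending strictly
    before \<open>L\<close>.\<close>
  define T where "T = (t0 + L) / 2"
  have t0: "a < t0" "t0 < L" "0 < t0" "L < t0 + \<tau>" using m by (auto simp: t0_def field_simps)
  have T: "t0 < T" "T < L" "0 < T" using t0 by (auto simp: T_def)
  have adm: "admissible_solution U c0 f g T u"
    using u T L unfolding maximal_solution_def by simp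
  have t0T: "t0 \<in> {0..<T}" using t0 T by simp
  note props = admissible_props[OF adm T(3)]
  have c: "continuous_on ({0..<T} \<times> UNIV) (\<lambda>(t, x). dx (dx u) t x)" "continuous_on ({0..<T} \<times> UNIV) (\<lambda>(t, x). dx (dt u) t x)"
    using props(1) unfolding c2sol_def psystem_def by blast+
  have F: "?F t0 \<le> ereal N" using a(2)[OF t0(1,2)] by (auto simp: N_def intro: order_trans[OF less_imp_le])
  have le: "Linf_norm (dx (dx u) t0) \<le> ?F t0" "Linf_norm (dx (dt u) t0) \<le> ?F t0"
    by (rule add_increasing[OF Linf_norm_nonneg order_refl], rule add_increasing2[OF Linf_norm_nonneg order_refl])
  have "\<bar>dx (dx u) t0 x\<bar> \<le> N \<and> \<bar>dx (dt u) t0 x\<bar> \<le> N" for x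
    using Linf_norm_bound[OF strip_slice_x[OF c(1) t0T] order_trans[OF le(1) F], of x]
      Linf_norm_bound[OF strip_slice_x[OF c(2) t0T] order_trans[OF le(2) F], of x] by simp
  then obtain u' where "admissible_solution U c0 f g (t0 + \<tau>) u'"
    using cont[of T u t0] adm t0 T by blast
  then have "ereal (t0 + \<tau>) \<le> lifespan U c0 f g"
    unfolding lifespan_def by (intro Sup_upper) (use t0 \<tau> in auto)
  then show False using L t0 by simp
qed

end

section \<open>From the hypotheses of the theorem to the estimates\<close>

lemma C_bounded_classD:
  assumes "f \<in> C_bounded_class m"
  shows "k < m \<Longrightarrow> ((deriv ^^ k) f has_real_derivative (deriv ^^ Suc k) f x) (at x)"
    and "k \<le> m \<Longrightarrow> continuous_on UNIV ((deriv ^^ k) f)"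
    and "k \<le> m \<Longrightarrow> \<exists>B. \<forall>x. \<bar>(deriv ^^ k) f x\<bar> \<le> B"
proof -
  have d: "deriv_on UNIV = deriv" by (rule ext) (rule deriv_on_UNIV)
  show "k < m \<Longrightarrow> ((deriv ^^ k) f has_real_derivative (deriv ^^ Suc k) f x) (at x)"
    using assms unfolding C_bounded_class_def times_differentiable_on_def d
    by (simp add: DERIV_deriv_iff_real_differentiable)
  show "k \<le> m \<Longrightarrow> continuous_on UNIV ((deriv ^^ k) f)"
    using assms unfolding C_bounded_class_def d by blast
  assume "k \<le> m"
  then have "bounded (range ((deriv ^^ k) f))"
    using assms unfolding C_bounded_class_def d by blast
  then show "\<exists>B. \<forall>x. \<bar>(deriv ^^ k) f x\<bar> \<le> B" unfolding bounded_iff by auto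
qed

text \<open>Both cases reduce to a continuous \<open>c'\<close> near 0 with a lower bound by a power
  of \<open>\<bar>x\<bar>\<close>: the exponent is \<open>p - 2\<close> in (A) and 0 in (B).\<close>

lemma speed_hypotheses:
  assumes U: "0 \<in> interior U"
    and cases: "(\<exists>p. degenerate_speed U c p \<and> q = p - 1) \<or> (nondegenerate_speed U c \<and> q = 1)"
  obtains d e C where "d > 0" "e \<ge> 0" "C > 0" "q = e + 1" "{- d..d} \<subseteq> U"
    "\<And>x. \<bar>x\<bar> \<le> d \<Longrightarrow> (c has_real_derivative deriv_on U c x) (at x)"
    "continuous_on {- d..d} (deriv_on U c)" "\<And>x. \<bar>x\<bar> \<le> d \<Longrightarrow> C * \<bar>x\<bar> powr e \<le> deriv_on U c x"
proof -
  obtain r where r: "r > 0" "ball 0 r \<subseteq> U" using U mem_interior by blast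
  have int: "x \<in> interior U" if "\<bar>x\<bar> < r" for x
    using that interior_maximal[OF r(2) open_ball] by (auto simp: subset_eq)
  have regular: "\<forall>x\<in>U. c differentiable (at x within U)" "continuous_on U (deriv_on U c)"
  proof -
    have "(\<forall>x\<in>U. c differentiable (at x within U)) \<and> continuous_on U (deriv_on U c)"
      using cases
    proof (elim disjE exE conjE)
      assume "nondegenerate_speed U c"
      then show ?thesis
        unfolding nondegenerate_speed_def C_class_def times_differentiable_on_def by auto
    next
      fix p assume "degenerate_speed U c p"
      then have p: "p > 2" and td: "times_differentiable_on (nat \<lceil>p - 2\<rceil>) U c" and
        hol: "\<exists>K. \<forall>x\<in>U. \<forall>y\<in>U. \<bar>(deriv_on U ^^ nat \<lceil>p - 2\<rceil>) c x - (deriv_on U ^^ nat \<lceil>p - 2\<rceil>) c y\<bar> \<le> K * \<bar>x - y\<bar> powr (p - of_int \<lceil>p - 1\<rceil>)"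
        unfolding degenerate_speed_def C_holder_class_def by auto
      define m where "m = nat \<lceil>p - 2\<rceil>"
      have m: "m \<ge> 1" using p unfolding m_def by linarith
      have d0: "\<forall>x\<in>U. c differentiable (at x within U)"
      proof
        fix x assume "x \<in> U"
        with td m have "(deriv_on U ^^ 0) c differentiable (at x within U)"
          unfolding times_differentiable_on_def m_def[symmetric] by fastforce
        then show "c differentiable (at x within U)" by simp
      qed
      have "continuous_on U (deriv_on U c)"
      \<comment> \<open>For \<open>m = 1\<close> continuity of \<open>c'\<close> comes from the
        Hoelder condition, whose exponent is positive because the ceiling of \<open>p - 1\<close> is
        below \<open>p\<close>. For larger \<open>m\<close>, \<open>c'\<close> is itself
        differentiable.\<close>
      proof (cases "m = 1")
        case True
        obtain K where K: "\<And>x y. x \<in> U \<Longrightarrow> y \<in> U \<Longrightarrow> \<bar>deriv_on U c x - deriv_on U c y\<bar> \<le> K * \<bar>x - y\<bar> powr (p - of_int \<lceil>p - 1\<rceil>)"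
          using hol unfolding m_def[symmetric] True by auto
        have \<alpha>: "p - of_int \<lceil>p - 1\<rceil> > 0" by linarith
        show ?thesis
          unfolding continuous_on_def
        proof
          fix x assume x: "x \<in> U"
          have lim0: "((\<lambda>y. K * \<bar>y - x\<bar> powr (p - of_int \<lceil>p - 1\<rceil>)) \<longlongrightarrow> K * 0) (at x within U)"
          proof (rule tendsto_mult[OF tendsto_const])
            have "((\<lambda>y. \<bar>y - x\<bar>) \<longlongrightarrow> \<bar>x - x\<bar>) (at x within U)" by (intro tendsto_intros)
            then have "((\<lambda>y. \<bar>y - x\<bar>) \<longlongrightarrow> 0) (at x within U)" by simp
            from tendsto_powr'[OF this tendsto_const[of "p - of_int \<lceil>p - 1\<rceil>"]] \<alpha>
            show "((\<lambda>y. \<bar>y - x\<bar> powr (p - of_int \<lceil>p - 1\<rceil>)) \<longlongrightarrow> 0) (at x within U)" by simp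
          qed
          have "((\<lambda>y. deriv_on U c y - deriv_on U c x) \<longlongrightarrow> 0) (at x within U)"
            by (rule Lim_null_comparison[OF _ lim0[simplified]])
              (use K x in \<open>auto simp: eventually_at_filter\<close>)
          then show "(deriv_on U c \<longlongrightarrow> deriv_on U c x) (at x within U)" by (rule LIM_zero_cancel)
        qed
      next
        case False
        then have "1 < m" using m by simp
        have "deriv_on U c differentiable (at x within U)" if "x \<in> U" for x
        proof -
          have "(deriv_on U ^^ 1) c differentiable (at x within U)"
            using td that \<open>1 < m\<close> unfolding times_differentiable_on_def m_def[symmetric] by blast
          then show ?thesis by simp
        qed
        then show ?thesis
          by (simp add: continuous_on_eq_continuous_within differentiable_imp_continuous_within)
      qed
      with d0 show ?thesis by blast
    qed
    then show "\<forall>x\<in>U. c differentiable (at x within U)" "continuous_on U (deriv_on U c)" by auto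
  qed
  have deriv: "(c has_real_derivative deriv_on U c x) (at x)" if "\<bar>x\<bar> < r" for x
  proof -
    have "x \<in> U" using int[OF that] interior_subset by blast
    then have "c differentiable (at x within U)" using regular(1) by blast
    then have "c differentiable (at x)" unfolding at_within_interior[OF int[OF that]] .
    then show ?thesis
      unfolding deriv_on_interior[OF int[OF that]] by (rule DERIV_deriv_iff_real_differentiable[THEN iffD2])
  qed
  have sub: "{- d..d} \<subseteq> U" if "d < r" for d
  proof
    fix x assume "x \<in> {- d..d}"
    then have "\<bar>x\<bar> < r" using that by (simp add: abs_less_iff)
    then have "x \<in> ball 0 r" by simp
    then show "x \<in> U" using r(2) by blast
  qed
  show ?thesis
    using cases
  proof (elim disjE exE conjE)
    fix p assume deg: "degenerate_speed U c p" and q: "q = p - 1"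
    then obtain C where C: "C > 0" "\<forall>\<theta>\<in>U. C * \<bar>\<theta>\<bar> powr (p - 2) \<le> deriv_on U c \<theta>" and p: "p > 2"
      unfolding degenerate_speed_def by auto
    have s: "{- (r / 2)..r / 2} \<subseteq> U" by (rule sub) (use r in auto)
    show ?thesis
    proof (rule that[of "r / 2" "p - 2" C])
      show "continuous_on {- (r / 2)..r / 2} (deriv_on U c)" by (rule continuous_on_subset[OF regular(2) s])
      fix x :: real assume x: "\<bar>x\<bar> \<le> r / 2"
      then have "x \<in> {- (r / 2)..r / 2}" unfolding abs_le_iff atLeastAtMost_iff by linarith
      then have "x \<in> U" using s by blast
      then show "C * \<bar>x\<bar> powr (p - 2) \<le> deriv_on U c x" using C(2) by blast
      show "(c has_real_derivative deriv_on U c x) (at x)" by (rule deriv) (use x r in auto)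
    qed (fact C(1) s | use r p q in simp)+
  next
    assume nd: "nondegenerate_speed U c" and q: "q = 1"
    define a where "a = deriv_on U c 0"
    have a: "a > 0" using nd by (simp add: nondegenerate_speed_def a_def)
    have "0 \<in> U" using U interior_subset by blast
    then have "continuous (at 0 within U) (deriv_on U c)" using regular(2) by (simp add: continuous_on_eq_continuous_within)
    then have "isCont (deriv_on U c) 0" unfolding at_within_interior[OF U] .
    then have near0: "(deriv_on U c \<longlongrightarrow> deriv_on U c 0) (nhds 0)"
      unfolding isCont_def by (rule tendsto_at_iff_tendsto_nhds[THEN iffD1])
    have "a / 2 < deriv_on U c 0" using a by (simp add: a_def)
    from order_tendstoD(1)[OF near0 this]
    obtain d1 where d1: "d1 > 0" "\<And>x. \<bar>x\<bar> < d1 \<Longrightarrow> a / 2 < deriv_on U c x"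
      unfolding eventually_nhds_metric dist_real_def by auto
    define d where "d = min r d1 / 2"
    have d: "d > 0" "d < r" "d < d1" using r d1 by (auto simp: d_def)
    have s: "{- d..d} \<subseteq> U" by (rule sub[OF d(2)])
    show ?thesis
    proof (rule that[of d 0 "a / 2"])
      show "continuous_on {- d..d} (deriv_on U c)" by (rule continuous_on_subset[OF regular(2) s])
      fix x :: real assume x: "\<bar>x\<bar> \<le> d"
      \<comment> \<open>\<open>\<bar>x\<bar> powr 0\<close> is 1 except at \<open>x = 0\<close>,
        where it is 0; in both cases it is at most 1.\<close>
      have "a / 2 * \<bar>x\<bar> powr 0 \<le> a / 2" using a by simp
      also have "\<dots> \<le> deriv_on U c x" using d1(2)[of x] x d by simp
      finally show "a / 2 * \<bar>x\<bar> powr 0 \<le> deriv_on U c x" .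
      show "(c has_real_derivative deriv_on U c x) (at x)" by (rule deriv) (use x d in auto)
    qed (fact d(1) s | use a q in simp)+
  qed
qed

theorem theorem2:
  fixes U :: "real set" and c \<phi> \<psi> :: "real \<Rightarrow> real" and q :: real
  assumes "0 \<in> interior U"
    and "c 0 = 1"
    and "\<forall>\<theta>\<in>U. c \<theta> > 0"
    and "\<phi> \<in> C_bounded_class 2"
    and "\<psi> \<in> C_bounded_class 1"
    and "(deriv \<phi> \<longlongrightarrow> 0) at_infinity"
    and "(\<psi> \<longlongrightarrow> 0) at_infinity"
    and "(\<exists>p. degenerate_speed U c p \<and> q = p - 1) \<or> (nondegenerate_speed U c \<and> q = 1)"
    and "\<exists>x0. deriv \<psi> x0 + deriv (deriv \<phi>) x0 > 0 \<or> deriv \<psi> x0 - deriv (deriv \<phi>) x0 > 0"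
  shows "\<exists>\<epsilon>0>0. \<exists>C'>0. \<forall>\<epsilon>. 0 < \<epsilon> \<and> \<epsilon> \<le> \<epsilon>0 \<longrightarrow>
    (let f = (\<lambda>x. \<epsilon> * \<phi> x); g = (\<lambda>x. \<epsilon> * \<psi> x); Tstar = lifespan U c f g in
       Tstar \<le> ereal (C' * \<epsilon> powr (- q)) \<and>
       (\<forall>u. maximal_solution U c f g u \<longrightarrow>
          Limsup (at_left (real_of_ereal Tstar))
            (\<lambda>t. Linf_norm (dx (dt u) t) + Linf_norm (dx (dx u) t)) = \<infinity>))"
proof -
  obtain d e C where d: "d > 0" and e: "e \<ge> 0" and C: "C > 0" and q: "q = e + 1" and dU: "{- d..d} \<subseteq> U"
    and c': "\<And>x. \<bar>x\<bar> \<le> d \<Longrightarrow> (c has_real_derivative deriv_on U c x) (at x)"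
    and c'_cont: "continuous_on {- d..d} (deriv_on U c)"
    and c'_lower: "\<And>x. \<bar>x\<bar> \<le> d \<Longrightarrow> C * \<bar>x\<bar> powr e \<le> deriv_on U c x"
    by (rule speed_hypotheses[OF assms(1,8)]) (rule that; assumption)
  obtain \<delta> ct ct' G K where \<delta>: "0 < \<delta>" "\<delta> \<le> d" and sp: "speed ct ct' G K"
    and ct: "\<And>x. \<bar>x\<bar> \<le> \<delta> \<Longrightarrow> ct x = c x" and ct': "\<And>x. \<bar>x\<bar> \<le> \<delta> \<Longrightarrow> ct' x = deriv_on U c x"
    by (rule speed_extension[where c=c, OF d assms(2) _ c'_cont]) (rule c', assumption, rule that, assumption+)
  interpret speed ct ct' G K by (rule sp)
  define p p' q' where "p = deriv \<phi>" and "p' = deriv (deriv \<phi>)" and "q' = deriv \<psi>"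
  have \<phi>: "(\<phi> has_real_derivative p x) (at x)" and p: "(p has_real_derivative p' x) (at x)"
    and \<psi>: "(\<psi> has_real_derivative q' x) (at x)" for x
    using C_bounded_classD(1)[OF assms(4), of 0 x] C_bounded_classD(1)[OF assms(4), of 1 x]
      C_bounded_classD(1)[OF assms(5), of 0 x]
    by (simp_all add: p_def p'_def q'_def numeral_2_eq_2)
  have p'_cont: "continuous_on UNIV p'" and q'_cont: "continuous_on UNIV q'"
    using C_bounded_classD(2)[OF assms(4), of 2] C_bounded_classD(2)[OF assms(5), of 1]
    by (simp_all add: p'_def q'_def numeral_2_eq_2)
  obtain B0 B1 B2 B3 B4 where B: "\<And>x. \<bar>\<phi> x\<bar> \<le> B0" "\<And>x. \<bar>p x\<bar> \<le> B1" "\<And>x. \<bar>p' x\<bar> \<le> B2" "\<And>x. \<bar>\<psi> x\<bar> \<le> B3" "\<And>x. \<bar>q' x\<bar> \<le> B4"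
  proof -
    have "\<exists>B. \<forall>x. \<bar>\<phi> x\<bar> \<le> B" "\<exists>B. \<forall>x. \<bar>p x\<bar> \<le> B" "\<exists>B. \<forall>x. \<bar>p' x\<bar> \<le> B" "\<exists>B. \<forall>x. \<bar>\<psi> x\<bar> \<le> B" "\<exists>B. \<forall>x. \<bar>q' x\<bar> \<le> B"
      using C_bounded_classD(3)[OF assms(4), of 0] C_bounded_classD(3)[OF assms(4), of 1] C_bounded_classD(3)[OF assms(4), of 2]
        C_bounded_classD(3)[OF assms(5), of 0] C_bounded_classD(3)[OF assms(5), of 1]
      by (simp_all add: p_def p'_def q'_def numeral_2_eq_2)
    then show ?thesis using that by (elim exE) blast
  qed
  define M where "M = max B0 (max B1 (max B2 (max B3 B4)))"
  have M: "\<bar>\<phi> x\<bar> \<le> M" "\<bar>p x\<bar> \<le> M" "\<bar>p' x\<bar> \<le> M" "\<bar>\<psi> x\<bar> \<le> M" "\<bar>q' x\<bar> \<le> M" for x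
    unfolding M_def le_max_iff_disj using B by blast+
  have M0: "M \<ge> 0" using M(1)[of 0] by linarith
  have ct0: "ct 0 = 1" using ct[of 0] \<delta> assms(2) by simp
  have ct'_lower: "C * \<bar>\<theta>\<bar> powr e \<le> ct' \<theta>" if "\<bar>\<theta>\<bar> \<le> \<delta>" for \<theta>
    using c'_lower[of \<theta>] ct'[OF that] that \<delta> by simp
  obtain x0 where x0: "q' x0 + p' x0 > 0 \<or> q' x0 - p' x0 > 0"
    using assms(9) by (auto simp: p'_def q'_def)
  have "\<exists>\<epsilon>1>0. \<exists>C'>0. lifespan_le ct \<delta> e p \<psi> \<epsilon>1 C'"
    by (rule lifespan_bound[OF ct0 _ C e p \<psi> p'_cont q'_cont M(2,3) assms(6)[folded p_def] assms(7) x0])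
      (rule ct'_lower)
  then obtain \<epsilon>1 C' where \<epsilon>1: "\<epsilon>1 > 0" and C': "C' > 0" and le: "lifespan_le ct \<delta> e p \<psi> \<epsilon>1 C'"
    by blast
  \<comment> \<open>The invariants of the scaled data are at most
    \<open>\<epsilon> * M + 2 * \<epsilon> * M\<close>, because
    \<open>\<bar>G x\<bar> \<le> 2 * \<bar>x\<bar>\<close>. The factor 4 in the smallness condition
    turns 3 into 12.\<close>
  define \<epsilon>0 where "\<epsilon>0 = min \<epsilon>1 (\<delta> / (12 * (M + 1)))"
  have \<epsilon>0: "\<epsilon>0 > 0" using \<epsilon>1 \<delta> M0 by (simp add: \<epsilon>0_def)
  show ?thesis
  proof (rule exI[of _ \<epsilon>0], rule conjI[OF \<epsilon>0], rule exI[of _ C'], rule conjI[OF C'], intro allI impI)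
    fix \<epsilon> assume "0 < \<epsilon> \<and> \<epsilon> \<le> \<epsilon>0"
    then have \<epsilon>: "0 < \<epsilon>" "\<epsilon> \<le> \<epsilon>1" "\<epsilon> \<le> \<delta> / (12 * (M + 1))" by (auto simp: \<epsilon>0_def)
    have "\<epsilon> * (12 * (M + 1)) \<le> \<delta>" using \<epsilon>(3) M0 by (simp add: pos_le_divide_eq)
    then have small: "4 * (3 * \<epsilon> * M) \<le> \<delta>" using \<epsilon>(1) by (simp add: algebra_simps)
    define f g where "f x = \<epsilon> * \<phi> x" and "g x = \<epsilon> * \<psi> x" for x
    have scaled: "\<bar>\<epsilon> * y\<bar> \<le> \<epsilon> * M" if "\<bar>y\<bar> \<le> M" for y
      using that \<epsilon>(1) by (simp add: abs_mult)
    interpret small_data ct ct' G K U c f "\<lambda>x. \<epsilon> * p x" "\<lambda>x. \<epsilon> * p' x" g "\<lambda>x. \<epsilon> * q' x" \<delta> "3 * \<epsilon> * M" "\<epsilon> * M"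
    proof
      show "\<forall>\<theta>. \<bar>\<theta>\<bar> \<le> \<delta> \<longrightarrow> ct \<theta> = c \<theta>" using ct by blast
      show "{- \<delta>..\<delta>} \<subseteq> U" using dU \<delta> by (auto simp: subset_eq)
      show "0 < \<delta>" "4 * (3 * \<epsilon> * M) \<le> \<delta>" by (fact \<delta> small)+
      fix x
      show "(f has_real_derivative \<epsilon> * p x) (at x)" unfolding f_def[abs_def] by (rule DERIV_cmult[OF \<phi>])
      show "((\<lambda>x. \<epsilon> * p x) has_real_derivative \<epsilon> * p' x) (at x)" by (rule DERIV_cmult[OF p])
      show "(g has_real_derivative \<epsilon> * q' x) (at x)" unfolding g_def[abs_def] by (rule DERIV_cmult[OF \<psi>])
      show "continuous_on UNIV (\<lambda>x. \<epsilon> * p' x)" "continuous_on UNIV (\<lambda>x. \<epsilon> * q' x)"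
        by (intro continuous_intros p'_cont q'_cont)+
      show "\<bar>f x\<bar> \<le> \<epsilon> * M" "\<bar>\<epsilon> * p' x\<bar> \<le> \<epsilon> * M" "\<bar>\<epsilon> * q' x\<bar> \<le> \<epsilon> * M"
        unfolding f_def by (rule scaled, rule M)+
      have "\<bar>g x\<bar> \<le> \<epsilon> * M" "\<bar>\<epsilon> * p x\<bar> \<le> \<epsilon> * M" unfolding g_def by (rule scaled, rule M)+
      then show "\<bar>g x + G (\<epsilon> * p x)\<bar> \<le> 3 * \<epsilon> * M \<and> \<bar>g x - G (\<epsilon> * p x)\<bar> \<le> 3 * \<epsilon> * M"
        using G_abs_upper[of "\<epsilon> * p x"] by linarith
    qed
    have upper: "lifespan U c f g \<le> ereal (C' * \<epsilon> powr (- q))"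
      unfolding lifespan_def
    proof (rule Sup_least)
      fix y assume "y \<in> ereal ` {T. 0 < T \<and> (\<exists>u. admissible_solution U c f g T u)}"
      then obtain T u where y: "y = ereal T" and T: "0 < T" and adm: "admissible_solution U c f g T u" by blast
      note props = admissible_props[OF adm T]
      obtain N where N: "\<forall>t\<in>{0..<T}. \<forall>x. \<bar>u t x\<bar> \<le> N \<and> \<bar>dx (dx u) t x\<bar> \<le> N \<and> \<bar>dx (dt u) t x\<bar> \<le> N"
        using props(6) by blast
      have v: "\<bar>dx u t x\<bar> \<le> \<delta>" if "t \<in> {0..<T}" for t x
        using props(7)[rule_format, OF that, of x] small \<eta>_nonneg by linarith
      have "T \<le> C' * \<epsilon> powr (- (e + 1))"
        by (rule le[unfolded lifespan_le_def, THEN spec[of _ \<epsilon>], THEN spec[of _ T], THEN spec[of _ N],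
          THEN spec[of _ "dx u"], THEN spec[of _ "dt u"], THEN spec[of _ "dx (dx u)"], THEN spec[of _ "dx (dt u)"], THEN mp])
          (use \<epsilon> T props(2,4,5) N v in \<open>simp add: g_def\<close>)
      then show "y \<le> ereal (C' * \<epsilon> powr (- q))" by (simp add: y q)
    qed
    \<comment> \<open>The lifespan is positive and has a finite upper bound, so it is a real number
      and \<open>real_of_ereal\<close> returns its true value.\<close>
    obtain L where L: "lifespan U c f g = ereal L"
      using upper lifespan_pos by (cases "lifespan U c f g") auto
    have "lifespan U c f g \<le> ereal (C' * \<epsilon> powr (- q)) \<and>
       (\<forall>u. maximal_solution U c f g u \<longrightarrow>
          Limsup (at_left (real_of_ereal (lifespan U c f g)))
            (\<lambda>t. Linf_norm (dx (dt u) t) + Linf_norm (dx (dx u) t)) = \<infinity>)"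
      using upper limsup_infinite[OF L] by (simp add: L)
    then show "let f = (\<lambda>x. \<epsilon> * \<phi> x); g = (\<lambda>x. \<epsilon> * \<psi> x); Tstar = lifespan U c f g in
       Tstar \<le> ereal (C' * \<epsilon> powr (- q)) \<and>
       (\<forall>u. maximal_solution U c f g u \<longrightarrow>
          Limsup (at_left (real_of_ereal Tstar))
            (\<lambda>t. Linf_norm (dx (dt u) t) + Linf_norm (dx (dx u) t)) = \<infinity>)"
      unfolding Let_def f_def[abs_def] g_def[abs_def] .
  qed
qed

end
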